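(* Given a copyless streaming string transducer $\mathcal{Z}$ with $n$ states and $m$ variables, one can effectively construct a reversible two-way finite state transducer with $8m\cdot n^2$ states that is equivalent to $\mathcal{Z}$ (i.e. defines the same transduction).
   Context: For a finite alphabet $A$, let $A_{\vdash\dashv}=A\uplus\{\vdash,\dashv\}$, where $\vdash,\dashv$ are new symbols called endmarkers. A two-way finite state automaton (2FA) is a tuple $\mathcal{A}=(A,Q,q_I,q_F,\Delta)$, where $A$ is a finite alphabet, $Q$ is a finite set of states partitioned into forward states $Q^+$ and backward states $Q^-$, $q_I\in Q^+$ is the initial state, $q_F\in Q^+$ is the final state, and $\Delta\subseteq Q\times A_{\vdash\dashv}\times Q$. By convention, $q_I$ is the only forward state $p$ with a transition $(p,\vdash,q)\in\Delta$ and $q_F$ is the only forward state $p$ with a transition $(q,\dashv,p)\in\Delta$ (backward states may have transitions $(p,\vdash,q)$ and $(q,\dashv,p)$). A configuration $u.p.u'$ consists of words $u,u'\in A_{\vdash\dashv}^*$ and a state $p$. If $p\in Q^+$ and $u'=a'v'$ with $a'$ a letter, then for each $(p,a',q)\in\Delta$ a successor of $u.p.u'$ is $ua'.q.v'$ if $q\in Q^+$, and $u.q.u'$ if $q\in Q^-$. If $p\in Q^-$ and $u=va$ with $a$ a letter, then for each $(p,a,q)\in\Delta$ a successor of $u.p.u'$ is $u.q.u'$ if $q\in Q^+$, and $v.q.au'$ if $q\in Q^-$. A run on $w$ is a finite sequence of successive configurations $u_i.q_i.u_i'$ with $u_iu_i'=w$; it is accepting if it starts in $q_I.w$ and ends in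 $w.q_F$. The language recognized is the set of $u\in A^*$ such that $\vdash u\dashv$ admits an accepting run. The automaton is one-way if $Q^-=\emptyset$; deterministic if for all $(p,a)\in Q\times A_{\vdash\dashv}$ there is at most one $q$ with $(p,a,q)\in\Delta$; co-deterministic if for all $(q,a)\in Q\times A_{\vdash\dashv}$ there is at most one $p$ with $(p,a,q)\in\Delta$; reversible if it is both deterministic and co-deterministic. A two-way finite state transducer (2FT) is a tuple $\mathcal{T}=(A,B,Q,q_I,q_F,\Delta,\mu)$ where $B$ is a finite (output) alphabet, $(A,Q,q_I,q_F,\Delta)$ is a 2FA (the underlying automaton) and $\mu:\Delta\to B^*$. For a run $\rho$, $\mu(\rho)$ is the concatenation of the outputs of the transitions along $\rho$. The transduction $\mathcal{R}_{\mathcal{T}}\subseteq A^*\times B^*$ is the set of pairs $(u,\mu(\rho))$ with $\rho$ an accepting run on $\vdash u\dashv$. A transducer is reversible if its underlying automaton is. The number of states is $|Q|$. Substitutions. For a finite alphabet $B$ and a finite set $\mathcal{X}$ of variables, $\mathcal{S}_{\mathcal{X},B}$ is the set of functions $\sigma:\mathcal{X}\to(\mathcal{X}\cup B)^*$, called substitutions. Each $\sigma$ extends to a monoid morphism $\hat\sigma:(\mathcal{X}\cup B)^*\to(\mathcal{X}\cup B)^*$ that is the identity on $B$; composition is $\sigma_2\circ\sigma_1:=\hat\sigma_2\circ\sigma_1$. Let $\sigma_\varepsilon$ map every variable to $\varepsilon$. A substitution $\sigma$ is copyless if each variable $Y\in\mathcal{X}$ appears at most once in each $\sigma(X)$, and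 for every $Y\in\mathcal{X}$ there is at most one $X\in\mathcal{X}$ such that $Y$ appears in $\sigma(X)$. A streaming string transducer (SST) is a tuple $\mathcal{Z}=(A,B,Q,q_I,q_F,\Delta,\mathcal{X},O,\tau)$ where $B$ is the output alphabet, $(A,Q,q_I,q_F,\Delta)$ is a one-way deterministic automaton (the underlying automaton), $\mathcal{X}$ is a finite set of variables, $O\in\mathcal{X}$ is the final variable and $\tau:\Delta\to\mathcal{S}_{\mathcal{X},B}$. For a run $\rho$ using the successive transitions $t_1,\dots,t_k$, $\tau(\rho)=\tau(t_1)\circ\tau(t_2)\circ\cdots\circ\tau(t_k)$. The transduction $\mathcal{R}_{\mathcal{Z}}$ is the function mapping each $u$ in the language of the underlying automaton to $(\sigma_\varepsilon\circ\tau(\rho))(O)\in B^*$, where $\rho$ is the unique accepting run on $\vdash u\dashv$. $\mathcal{Z}$ is copyless if $\tau(\rho)$ is copyless for every run $\rho$. Its number of states is $|Q|$ and its number of variables is $|\mathcal{X}|$. *)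

theory Defs
  imports Main "HOL-Library.Nat_Bijection"
begin

section \<open>Two-way automata\<close>

datatype 'a sym = LEnd | REnd | Letter 'a

definition marked :: "'a set \<Rightarrow> 'a sym set" where
  "marked A = insert LEnd (insert REnd (Letter ` A))"

definition bracket :: "'a list \<Rightarrow> 'a sym list" where
  "bracket u = LEnd # map Letter u @ [REnd]"

type_synonym ('a, 'q) trans = "'q \<times> 'a sym \<times> 'q"

text \<open>A configuration \<open>u.p.u'\<close>.\<close>

type_synonym ('a, 'q) config = "'a sym list \<times> 'q \<times> 'a sym list"

record ('a, 'q) fa2 =
  in_alph :: "'a set"
  fwd :: "'q set"
  bwd :: "'q set"
  q_init :: 'q
  q_final :: 'q
  delta :: "('a, 'q) trans set"

definition states :: "('a, 'q, 'z) fa2_scheme \<Rightarrow> 'q set" where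
  "states M = fwd M \<union> bwd M"

definition is_fa2 :: "('a, 'q, 'z) fa2_scheme \<Rightarrow> bool" where
  "is_fa2 M \<longleftrightarrow>
     finite (in_alph M) \<and> finite (fwd M) \<and> finite (bwd M) \<and> fwd M \<inter> bwd M = {} \<and>
     q_init M \<in> fwd M \<and> q_final M \<in> fwd M \<and>
     delta M \<subseteq> states M \<times> marked (in_alph M) \<times> states M \<and>
     (\<forall>p q. (p, LEnd, q) \<in> delta M \<longrightarrow> p \<in> fwd M \<longrightarrow> p = q_init M) \<and>
     (\<forall>p q. (q, REnd, p) \<in> delta M \<longrightarrow> p \<in> fwd M \<longrightarrow> p = q_final M)"

definition one_way :: "('a, 'q, 'z) fa2_scheme \<Rightarrow> bool" where
  "one_way M \<longleftrightarrow> bwd M = {}"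

definition deterministic :: "('a, 'q, 'z) fa2_scheme \<Rightarrow> bool" where
  "deterministic M \<longleftrightarrow>
     (\<forall>p a q q'. (p, a, q) \<in> delta M \<longrightarrow> (p, a, q') \<in> delta M \<longrightarrow> q = q')"

definition codeterministic :: "('a, 'q, 'z) fa2_scheme \<Rightarrow> bool" where
  "codeterministic M \<longleftrightarrow>
     (\<forall>q a p p'. (p, a, q) \<in> delta M \<longrightarrow> (p', a, q) \<in> delta M \<longrightarrow> p = p')"

definition reversible :: "('a, 'q, 'z) fa2_scheme \<Rightarrow> bool" where
  "reversible M \<longleftrightarrow> deterministic M \<and> codeterministic M"

inductive step ::
  "('a, 'q, 'z) fa2_scheme \<Rightarrow> ('a, 'q) config \<Rightarrow> ('a, 'q) trans \<Rightarrow> ('a, 'q) config \<Rightarrow> bool"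
  for M where
  fwd_fwd: "(p, a, q) \<in> delta M \<Longrightarrow> p \<in> fwd M \<Longrightarrow> q \<in> fwd M \<Longrightarrow>
    step M (u, p, a # v) (p, a, q) (u @ [a], q, v)"
| fwd_bwd: "(p, a, q) \<in> delta M \<Longrightarrow> p \<in> fwd M \<Longrightarrow> q \<in> bwd M \<Longrightarrow>
    step M (u, p, a # v) (p, a, q) (u, q, a # v)"
| bwd_fwd: "(p, a, q) \<in> delta M \<Longrightarrow> p \<in> bwd M \<Longrightarrow> q \<in> fwd M \<Longrightarrow>
    step M (v @ [a], p, u) (p, a, q) (v @ [a], q, u)"
| bwd_bwd: "(p, a, q) \<in> delta M \<Longrightarrow> p \<in> bwd M \<Longrightarrow> q \<in> bwd M \<Longrightarrow>
    step M (v @ [a], p, u) (p, a, q) (v, q, a # u)"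

text \<open>
  A run on \<open>w\<close> is given by its first configuration and the transitions it takes; together they
  determine the whole sequence of configurations, and conversely. A step does not change the word
  \<open>u @ u'\<close>, so it is enough to compare it with \<open>w\<close> once.
\<close>

inductive run ::
  "('a, 'q, 'z) fa2_scheme \<Rightarrow> 'a sym list \<Rightarrow>
   ('a, 'q) config \<Rightarrow> ('a, 'q) trans list \<Rightarrow> ('a, 'q) config \<Rightarrow> bool"
  for M w where
  run_refl: "w \<in> lists (marked (in_alph M)) \<Longrightarrow> u @ u' = w \<Longrightarrow> p \<in> states M \<Longrightarrow>
    run M w (u, p, u') [] (u, p, u')"
| run_step: "step M c t c' \<Longrightarrow> run M w c' ts c'' \<Longrightarrow> run M w c (t # ts) c''"

definition accepting_run ::
  "('a, 'q, 'z) fa2_scheme \<Rightarrow> 'a sym list \<Rightarrow> ('a, 'q) trans list \<Rightarrow> bool" where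
  "accepting_run M w ts \<longleftrightarrow> run M w ([], q_init M, w) ts (w, q_final M, [])"


section \<open>Two-way transducers\<close>

record ('a, 'q, 'b) ft2 = "('a, 'q) fa2" +
  out_alph :: "'b set"
  out :: "('a, 'q) trans \<Rightarrow> 'b list"

definition is_ft2 :: "('a, 'q, 'b) ft2 \<Rightarrow> bool" where
  "is_ft2 T \<longleftrightarrow>
     is_fa2 T \<and> finite (out_alph T) \<and> (\<forall>t \<in> delta T. out T t \<in> lists (out_alph T))"

definition ft2_transduction :: "('a, 'q, 'b) ft2 \<Rightarrow> ('a list \<times> 'b list) set" where
  "ft2_transduction T =
     {(u, concat (map (out T) ts)) | u ts.
        u \<in> lists (in_alph T) \<and> accepting_run T (bracket u) ts}"


section \<open>Streaming string transducers\<close>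

text \<open>
  A substitution on a set of variables \<open>V\<close> is a total function of which only the values on \<open>V\<close>
  are relevant.
\<close>

type_synonym ('x, 'b) subst = "'x \<Rightarrow> ('x + 'b) list"

definition substitutions :: "'x set \<Rightarrow> 'b set \<Rightarrow> ('x, 'b) subst set" where
  "substitutions V B = {\<sigma>. \<forall>x \<in> V. \<sigma> x \<in> lists (V <+> B)}"

definition subst_ext :: "('x, 'b) subst \<Rightarrow> ('x + 'b) list \<Rightarrow> ('x + 'b) list" where
  "subst_ext \<sigma> w = concat (map (case_sum \<sigma> (\<lambda>b. [Inr b])) w)"

definition subst_comp :: "('x, 'b) subst \<Rightarrow> ('x, 'b) subst \<Rightarrow> ('x, 'b) subst"
    (infixr "\<circ>\<^sub>s" 55) where
  "\<sigma>\<^sub>2 \<circ>\<^sub>s \<sigma>\<^sub>1 = subst_ext \<sigma>\<^sub>2 \<circ> \<sigma>\<^sub>1"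

definition subst_id :: "('x, 'b) subst" where
  "subst_id = (\<lambda>x. [Inl x])"

definition subst_empty :: "('x, 'b) subst" where
  "subst_empty = (\<lambda>x. [])"

definition copyless_subst :: "'x set \<Rightarrow> ('x, 'b) subst \<Rightarrow> bool" where
  "copyless_subst V \<sigma> \<longleftrightarrow>
     (\<forall>y \<in> V. \<forall>x \<in> V. count_list (\<sigma> x) (Inl y) \<le> 1) \<and>
     (\<forall>y \<in> V. \<forall>x \<in> V. \<forall>x' \<in> V.
        Inl y \<in> set (\<sigma> x) \<longrightarrow> Inl y \<in> set (\<sigma> x') \<longrightarrow> x = x')"

record ('a, 'q, 'b, 'x) sst = "('a, 'q) fa2" +
  sst_out_alph :: "'b set"
  vars :: "'x set"
  out_var :: 'x
  update :: "('a, 'q) trans \<Rightarrow> ('x, 'b) subst"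

definition is_sst :: "('a, 'q, 'b, 'x) sst \<Rightarrow> bool" where
  "is_sst Z \<longleftrightarrow>
     is_fa2 Z \<and> one_way Z \<and> deterministic Z \<and>
     finite (sst_out_alph Z) \<and> finite (vars Z) \<and> out_var Z \<in> vars Z \<and>
     (\<forall>t \<in> delta Z. update Z t \<in> substitutions (vars Z) (sst_out_alph Z))"

definition run_subst :: "('a, 'q, 'b, 'x) sst \<Rightarrow> ('a, 'q) trans list \<Rightarrow> ('x, 'b) subst" where
  "run_subst Z ts = foldr (\<lambda>t \<sigma>. update Z t \<circ>\<^sub>s \<sigma>) ts subst_id"

definition copyless :: "('a, 'q, 'b, 'x) sst \<Rightarrow> bool" where
  "copyless Z \<longleftrightarrow>
     (\<forall>w c ts c'. run Z w c ts c' \<longrightarrow> copyless_subst (vars Z) (run_subst Z ts))"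

text \<open>
  The graph of the transduction. Applying \<open>subst_empty\<close> leaves no variable, so the value is
  \<open>map Inr v\<close> for exactly one output word \<open>v\<close>.
\<close>

definition sst_transduction :: "('a, 'q, 'b, 'x) sst \<Rightarrow> ('a list \<times> 'b list) set" where
  "sst_transduction Z =
     {(u, v). u \<in> lists (in_alph Z) \<and>
        (\<exists>ts. accepting_run Z (bracket u) ts \<and>
              map Inr v = (subst_empty \<circ>\<^sub>s run_subst Z ts) (out_var Z))}"


section \<open>Effectiveness\<close>

text \<open>
  The total recursive functions of one argument: several arguments are packed with the Cantor
  pairing \<^const>\<open>prod_encode\<close>, and minimisation is restricted to the case where the search
  always succeeds.
\<close>

inductive recursive :: "(nat \<Rightarrow> nat) \<Rightarrow> bool" where
  rec_zero: "recursive (\<lambda>x. 0)"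
| rec_Suc: "recursive Suc"
| rec_fst: "recursive (\<lambda>x. fst (prod_decode x))"
| rec_snd: "recursive (\<lambda>x. snd (prod_decode x))"
| rec_pair: "recursive f \<Longrightarrow> recursive g \<Longrightarrow> recursive (\<lambda>x. prod_encode (f x, g x))"
| rec_comp: "recursive f \<Longrightarrow> recursive g \<Longrightarrow> recursive (\<lambda>x. f (g x))"
| rec_prim: "recursive f \<Longrightarrow> recursive g \<Longrightarrow>
    recursive (\<lambda>x. case prod_decode x of (y, n) \<Rightarrow>
      rec_nat (f y) (\<lambda>k r. g (prod_encode (prod_encode (y, k), r))) n)"
| rec_mu: "recursive f \<Longrightarrow> (\<And>x. \<exists>n. f (prod_encode (x, n)) = 0) \<Longrightarrow>
    recursive (\<lambda>x. LEAST n. f (prod_encode (x, n)) = 0)"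

text \<open>
  A machine is presented to an algorithm by naming its letters, states and variables injectively
  by natural numbers and listing its components. The same machine has many codes, according to
  the names and to the order of the lists.
\<close>

definition enumerates :: "'c list \<Rightarrow> 'c set \<Rightarrow> bool" where
  "enumerates xs S \<longleftrightarrow> distinct xs \<and> set xs = S"

definition code_list :: "('c \<Rightarrow> nat) \<Rightarrow> 'c list \<Rightarrow> nat" where
  "code_list f xs = list_encode (map f xs)"

fun code_sym :: "('a \<Rightarrow> nat) \<Rightarrow> 'a sym \<Rightarrow> nat" where
  "code_sym nA LEnd = 0"
| "code_sym nA REnd = 1"
| "code_sym nA (Letter a) = nA a + 2"

fun code_trans :: "('a \<Rightarrow> nat) \<Rightarrow> ('q \<Rightarrow> nat) \<Rightarrow> ('a, 'q) trans \<Rightarrow> nat" where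
  "code_trans nA nQ (p, a, q) = list_encode [nQ p, code_sym nA a, nQ q]"

definition code_subst ::
  "('b \<Rightarrow> nat) \<Rightarrow> ('x \<Rightarrow> nat) \<Rightarrow> 'x list \<Rightarrow> ('x, 'b) subst \<Rightarrow> nat" where
  "code_subst nB nX xs \<sigma> =
     code_list (\<lambda>x. prod_encode (nX x, code_list (\<lambda>s. sum_encode (map_sum nX nB s)) (\<sigma> x))) xs"

definition codes_ft2 ::
  "('a \<Rightarrow> nat) \<Rightarrow> ('b \<Rightarrow> nat) \<Rightarrow> ('q \<Rightarrow> nat) \<Rightarrow> ('a, 'q, 'b) ft2 \<Rightarrow> nat \<Rightarrow> bool" where
  "codes_ft2 nA nB nQ T z \<longleftrightarrow>
     inj_on nA (in_alph T) \<and> inj_on nB (out_alph T) \<and> inj_on nQ (states T) \<and>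
     (\<exists>as bs ps ns ts.
        enumerates as (in_alph T) \<and> enumerates bs (out_alph T) \<and>
        enumerates ps (fwd T) \<and> enumerates ns (bwd T) \<and> enumerates ts (delta T) \<and>
        z = list_encode
          [code_list nA as, code_list nB bs, code_list nQ ps, code_list nQ ns,
           nQ (q_init T), nQ (q_final T),
           code_list (\<lambda>t. prod_encode (code_trans nA nQ t, code_list nB (out T t))) ts])"

text \<open>An SST is one-way, so its code has no list of backward states.\<close>

definition codes_sst ::
  "('a \<Rightarrow> nat) \<Rightarrow> ('b \<Rightarrow> nat) \<Rightarrow> ('q \<Rightarrow> nat) \<Rightarrow> ('x \<Rightarrow> nat) \<Rightarrow>
   ('a, 'q, 'b, 'x) sst \<Rightarrow> nat \<Rightarrow> bool" where
  "codes_sst nA nB nQ nX Z z \<longleftrightarrow>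
     inj_on nA (in_alph Z) \<and> inj_on nB (sst_out_alph Z) \<and> inj_on nQ (states Z) \<and>
     inj_on nX (vars Z) \<and>
     (\<exists>as bs ps ts xs.
        enumerates as (in_alph Z) \<and> enumerates bs (sst_out_alph Z) \<and>
        enumerates ps (fwd Z) \<and> enumerates ts (delta Z) \<and> enumerates xs (vars Z) \<and>
        z = list_encode
          [code_list nA as, code_list nB bs, code_list nQ ps,
           nQ (q_init Z), nQ (q_final Z),
           code_list nX xs, nX (out_var Z),
           code_list (\<lambda>t. prod_encode (code_trans nA nQ t, code_subst nB nX xs (update Z t))) ts])"

text \<open>Every SST has a code, so quantifying over codes loses no SST.\<close>

lemma finite_delta:
  assumes "is_fa2 M"
  shows "finite (delta M)"
proof -
  have "finite (states M \<times> marked (in_alph M) \<times> states M)"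
    using assms by (auto simp: is_fa2_def states_def marked_def)
  then show ?thesis
    using assms by (auto simp: is_fa2_def intro: finite_subset)
qed

lemma ex_enumerates: "finite S \<Longrightarrow> \<exists>xs. enumerates xs S"
  unfolding enumerates_def by (metis finite_distinct_list)

lemma ex_name: "finite S \<Longrightarrow> \<exists>f :: 'c \<Rightarrow> nat. inj_on f S"
  by (metis finite_imp_inj_to_nat_seg)

lemma ex_codes_sst:
  assumes "is_sst Z"
  shows "\<exists>nA nB nQ nX z. codes_sst nA nB nQ nX Z z"
proof -
  have fin: "finite (in_alph Z)" "finite (sst_out_alph Z)" "finite (states Z)" "finite (vars Z)"
      "finite (fwd Z)" "finite (delta Z)"
    using assms finite_delta[of Z] by (auto simp: is_sst_def is_fa2_def states_def)
  then show ?thesis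
    unfolding codes_sst_def
    using ex_name[OF fin(1)] ex_name[OF fin(2)] ex_name[OF fin(3)] ex_name[OF fin(4)]
      ex_enumerates[OF fin(1)] ex_enumerates[OF fin(2)] ex_enumerates[OF fin(5)]
      ex_enumerates[OF fin(6)] ex_enumerates[OF fin(4)]
    by fast
qed

end

theory Submission
  imports Defs
begin

text \<open>
  Let \<open>\<delta>\<close> be the transition function of the SST. On a word \<open>w\<close>, the pairs \<open>(n, p)\<close> of a position
  and a state form a forest in which \<open>(n + 1, \<delta> p (w ! n))\<close> is the parent of \<open>(n, p)\<close>, and \<open>w\<close> is
  accepted if the leaf for the initial state lies in the tree whose root is the final state at the
  end of \<open>w\<close>. A reversible head cannot follow the path from this leaf to the root, but it can walk
  around the tree. Two tokens follow the outline of the tree, one on the left and one on the right of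
  the path, and they are kept at the same position: when one of them turns, the head is reversed,
  and the other one goes back along the outline. The tokens are on the same edge exactly when this
  edge belongs to the path. There the transducer makes one step of the recursive evaluation of
  the variables, going back in time into a variable of an update and forward in time out of it;
  reversing time means to flip the direction of the head. This takes two nodes, two sides,
  a direction and a variable, hence \<open>8 * m * n\<^sup>2\<close> states. Pairs of tokens on the same side of the
  same edge do not occur. They are used for an initial tour in which a single token walks from the
  leaf to the root; only accepted words get past it.

  The two tokens cannot get lost: a walk that is injective on a finite set and starts at a point
  without predecessor must leave the set, and the only way to leave the subtree below a node of the
  path is to reach this node with both tokens.
\<close>

section \<open>Recursive functions on encodable types\<close>

text \<open>The recursive evaluation needs no call stack. In a copyless update table a variable
  occurs in at most one word, and there at most once, so the variable just finished already tells
  where to resume; the same fact makes this part of a step injective. What remains is to return to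
  the right state of the path. Several states may merge on a letter, so the predecessor on the path
  is ambiguous, and a single token on the outline would not notice when it is on the path; the
  coincidence of the two tokens is the test for it. The left-to-right order of siblings is simply
  the order of the state codes. The endmarker conventions shape the boundary. Only the initial state
  may read the left endmarker forwards, so the pair of tokens lives at positions from 1 on. Only the
  final state may be entered forwards over the right endmarker, so the head may leave there only
  with the output variable finished. Evaluation should begin with a head moving left from behind the
  last symbol, where no run gets; the last step of the tour takes over the effect of that
  move.\<close>

class nameable =
  fixes enc :: "'a \<Rightarrow> nat"
  assumes enc_eq_iff: "enc x = enc y \<longleftrightarrow> x = y"

instantiation nat :: nameable
begin
definition "enc (n :: nat) = n"
instance by standard (simp add: enc_nat_def)
end

instantiation bool :: nameable
begin
definition "enc b = (if b then 1 else 0)"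
instance by standard (simp add: enc_bool_def)
end

text \<open>The instances use the same codings as \<open>codes_sst\<close> and
  \<open>codes_ft2\<close>, so the code of a table is literally a component of the code of a
  machine.\<close>

instantiation prod :: (nameable, nameable) nameable
begin
definition "enc p = prod_encode (enc (fst p), enc (snd p))"
instance by standard (simp add: enc_prod_def enc_eq_iff prod_eq_iff)
end

instantiation sum :: (nameable, nameable) nameable
begin
definition "enc s = sum_encode (map_sum enc enc s)"
instance
  by standard (auto simp: enc_sum_def enc_eq_iff sum_encode_eq map_sum_def split: sum.splits)
end

instantiation option :: (nameable) nameable
begin
definition "enc x = (case x of None \<Rightarrow> 0 | Some y \<Rightarrow> Suc (enc y))"
instance by standard (simp add: enc_option_def enc_eq_iff split: option.splits)
end

instantiation list :: (nameable) nameable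
begin
definition "enc xs = list_encode (map enc xs)"
instance
proof
  fix xs ys :: "'a list"
  have "inj (enc :: 'a \<Rightarrow> nat)" by (rule injI) (simp add: enc_eq_iff)
  then show "enc xs = enc ys \<longleftrightarrow> xs = ys"
    by (simp add: enc_list_def list_encode_eq inj_map_eq_map)
qed
end

lemma enc_Pair: "enc (x, y) = prod_encode (enc x, enc y)"
  by (simp add: enc_prod_def)

lemma enc_Inl: "enc (Inl x) = 2 * enc x" and enc_Inr: "enc (Inr y) = Suc (2 * enc y)"
  by (simp_all add: enc_sum_def sum_encode_def)

lemma enc_None: "enc None = 0" and enc_Some: "enc (Some x) = Suc (enc x)"
  by (simp_all add: enc_option_def)

lemma enc_Nil: "enc [] = 0" and enc_Cons: "enc (x # xs) = Suc (prod_encode (enc x, enc xs))"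
  by (simp_all add: enc_list_def)

lemmas enc_simps = enc_Pair enc_Inl enc_Inr enc_None enc_Some enc_Nil enc_Cons

lemma inj_enc: "inj_on enc A"
  by (rule inj_onI) (simp add: enc_eq_iff)

text \<open>Supplies the iteration count for loops over a list: its code is available as a number
  and is large enough.\<close>

lemma length_le_enc: "length xs \<le> enc xs"
proof (induction xs)
  case (Cons x xs)
  then show ?case using le_prod_encode_2[of "enc xs" "enc x"] by (simp add: enc_Cons)
qed simp

lemma recursive_id: "recursive (\<lambda>x. x)"
  using rec_pair[OF rec_fst rec_snd] by simp

lemma recursive_const: "recursive (\<lambda>x. n)"
proof (induction n)
  case (Suc n)
  show ?case using rec_comp[OF rec_Suc Suc] .
qed (rule rec_zero)

text \<open>Primitive recursion on \<open>h x\<close> with a step that ignores the previous value is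
  a case distinction.\<close>

lemma recursive_case:
  assumes "recursive h" "recursive f" "recursive g"
  shows "recursive (\<lambda>x. case h x of 0 \<Rightarrow> f x | Suc k \<Rightarrow> g (prod_encode (x, k)))"
proof -
  have "recursive (\<lambda>z. g (fst (prod_decode z)))"
    by (rule rec_comp[OF assms(3) rec_fst])
  from rec_comp[OF rec_prim[OF assms(2) this] rec_pair[OF recursive_id assms(1)]]
  have *: "recursive (\<lambda>x. rec_nat (f x) (\<lambda>k r. g (prod_encode (x, k))) (h x))" by simp
  moreover have "rec_nat (f x) (\<lambda>k r. g (prod_encode (x, k))) (h x) =
      (case h x of 0 \<Rightarrow> f x | Suc k \<Rightarrow> g (prod_encode (x, k)))" for x
    by (cases "h x") auto
  ultimately show ?thesis by simp
qed

text \<open>Parity separates the two summands of \<open>sum_encode\<close>. Both numbers are carried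
  through one recursion, since the parity tells when the half has to grow.\<close>

lemma recursive_parity_half: "recursive (\<lambda>n. prod_encode (n mod 2, n div 2))"
proof -
  let ?r = "\<lambda>z. snd (prod_decode z)"
  let ?g = "\<lambda>z. case fst (prod_decode (?r z)) of
      0 \<Rightarrow> prod_encode (1, snd (prod_decode (?r z)))
    | Suc k \<Rightarrow> (\<lambda>z. prod_encode (0, Suc (snd (prod_decode (?r (fst (prod_decode z)))))))
        (prod_encode (z, k))"
  have "recursive ?g"
    by (rule recursive_case)
      (intro rec_pair recursive_const rec_comp[OF rec_snd] rec_comp[OF rec_fst] rec_comp[OF rec_Suc]
        rec_snd rec_fst recursive_id)+
  from rec_comp[OF rec_prim[OF recursive_const[of "prod_encode (0, 0)"] this]
      rec_pair[OF recursive_const[of 0] recursive_id]]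
  have *: "recursive (\<lambda>n. rec_nat (prod_encode (0, 0)) (\<lambda>k r. ?g (prod_encode (prod_encode (0, k), r))) n)"
    by simp
  have "rec_nat (prod_encode (0, 0)) (\<lambda>k r. ?g (prod_encode (prod_encode (0, k), r))) n =
      prod_encode (n mod 2, n div 2)" for n
  proof (induction n)
    case (Suc n)
    show ?case
    proof (cases "even n")
      case True
      then show ?thesis using Suc by simp presburger
    next
      case False
      then have "n mod 2 = Suc 0" by presburger
      with False show ?thesis using Suc by simp
    qed
  qed simp
  with * show ?thesis by simp
qed

text \<open>\<open>F\<close> is total, but its values on numbers that are not codes are left
  open.\<close>

definition computable :: "('a :: nameable \<Rightarrow> 'b :: nameable) \<Rightarrow> bool" where
  "computable f \<longleftrightarrow> (\<exists>F. recursive F \<and> (\<forall>x. F (enc x) = enc (f x)))"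

lemma computableI: "recursive F \<Longrightarrow> (\<And>x. F (enc x) = enc (f x)) \<Longrightarrow> computable f"
  by (auto simp: computable_def)

section \<open>Closure properties of computable functions\<close>

lemma computable_id: "computable (\<lambda>x. x)"
  by (rule computableI[OF recursive_id]) simp

lemma computable_const: "computable (\<lambda>x. c)"
  by (rule computableI[OF recursive_const]) simp

lemma computable_comp: "computable f \<Longrightarrow> computable g \<Longrightarrow> computable (\<lambda>x. f (g x))"
  unfolding computable_def by (metis rec_comp)

lemma computable_Pair:
  assumes "computable f" "computable g" shows "computable (\<lambda>x. (f x, g x))"
proof -
  obtain F G where "recursive F" "\<And>x. F (enc x) = enc (f x)" "recursive G" "\<And>x. G (enc x) = enc (g x)"
    using assms unfolding computable_def by metis
  then show ?thesis by (intro computableI[OF rec_pair[of F G]]) (auto simp: enc_Pair)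
qed

lemma computable_fst: "computable f \<Longrightarrow> computable (\<lambda>x. fst (f x))"
  by (rule computable_comp[OF computableI[OF rec_fst]]) (simp add: enc_prod_def)

lemma computable_snd: "computable f \<Longrightarrow> computable (\<lambda>x. snd (f x))"
  by (rule computable_comp[OF computableI[OF rec_snd]]) (simp add: enc_prod_def)

lemma computable_comp2:
  assumes "computable (\<lambda>p. h (fst p) (snd p))" "computable f" "computable g"
  shows "computable (\<lambda>x. h (f x) (g x))"
  using computable_comp[OF assms(1) computable_Pair[OF assms(2,3)]] by simp

lemma computable_Let:
  assumes "computable f" "computable (\<lambda>p. g (fst p) (snd p))"
  shows "computable (\<lambda>x. let y = f x in g x y)"
  using computable_comp2[OF assms(2) computable_id assms(1)] by simp

lemma computable_case_prod:
  assumes "computable f" "computable (\<lambda>p. g (fst p) (fst (snd p)) (snd (snd p)))"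
  shows "computable (\<lambda>x. case f x of (a, b) \<Rightarrow> g x a b)"
  using computable_comp2[OF assms(2) computable_id assms(1)] by (simp add: case_prod_beta)

lemma computable_Suc: "computable f \<Longrightarrow> computable (\<lambda>x. Suc (f x))"
  by (rule computable_comp[OF computableI[OF rec_Suc]]) (simp add: enc_nat_def)

lemma computable_Some: "computable f \<Longrightarrow> computable (\<lambda>x. Some (f x))"
  by (rule computable_comp[OF computableI[OF rec_Suc]]) (simp add: enc_simps)

lemma computable_Cons:
  "computable f \<Longrightarrow> computable g \<Longrightarrow> computable (\<lambda>x. f x # g x)"
  by (rule computable_comp2[OF computableI[OF rec_Suc]]) (auto simp: enc_prod_def enc_Cons)

lemma computable_case_nat:
  assumes "computable h" "computable f" "computable (\<lambda>p. g (fst p) (snd p))"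
  shows "computable (\<lambda>x. case h x of 0 \<Rightarrow> f x | Suc k \<Rightarrow> g x k)"
proof -
  obtain H F G where *: "recursive H" "\<And>x. H (enc x) = enc (h x)"
      "recursive F" "\<And>x. F (enc x) = enc (f x)"
      "recursive G" "\<And>p. G (enc p) = enc (g (fst p) (snd p))"
    using assms unfolding computable_def by metis
  show ?thesis
    by (rule computableI[OF recursive_case[OF *(1,3,5)]])
      (use *(6)[of "(_, _)"] in \<open>simp add: * enc_simps enc_nat_def split: nat.split\<close>)
qed

lemma computable_case_option:
  assumes "computable h" "computable f" "computable (\<lambda>p. g (fst p) (snd p))"
  shows "computable (\<lambda>x. case h x of None \<Rightarrow> f x | Some y \<Rightarrow> g x y)"
proof -
  obtain H F G where *: "recursive H" "\<And>x. H (enc x) = enc (h x)"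
      "recursive F" "\<And>x. F (enc x) = enc (f x)"
      "recursive G" "\<And>p. G (enc p) = enc (g (fst p) (snd p))"
    using assms unfolding computable_def by metis
  show ?thesis
    by (rule computableI[OF recursive_case[OF *(1,3,5)]])
      (use *(6)[of "(_, _)"] in \<open>simp add: * enc_simps split: option.split\<close>)
qed

lemma computable_case_list:
  assumes "computable h" "computable f" "computable (\<lambda>p. g (fst p) (fst (snd p)) (snd (snd p)))"
  shows "computable (\<lambda>x. case h x of [] \<Rightarrow> f x | y # ys \<Rightarrow> g x y ys)"
proof -
  obtain H F G where *: "recursive H" "\<And>x. H (enc x) = enc (h x)"
      "recursive F" "\<And>x. F (enc x) = enc (f x)"
      "recursive G" "\<And>p. G (enc p) = enc (g (fst p) (fst (snd p)) (snd (snd p)))"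
    using assms unfolding computable_def by metis
  show ?thesis
    by (rule computableI[OF recursive_case[OF *(1,3,5)]])
      (use *(6)[of "(_, _, _)"] in \<open>simp add: * enc_simps split: list.split\<close>)
qed

lemma computable_if:
  assumes "computable b" "computable f" "computable g"
  shows "computable (\<lambda>x. if b x then f x else g x)"
proof -
  have "computable (\<lambda>x. case (if b x then 1 else 0 :: nat) of 0 \<Rightarrow> g x | Suc k \<Rightarrow> f x)"
  proof (rule computable_case_nat)
    show "computable (\<lambda>x. if b x then 1 else 0 :: nat)"
      using assms(1) by (simp add: computable_def enc_nat_def enc_bool_def)
    show "computable (\<lambda>p :: _ \<times> nat. f (fst p))"
      by (rule computable_comp[OF assms(2) computable_fst[OF computable_id]])
  qed (rule assms)
  moreover have "(case (if b then 1 else 0 :: nat) of 0 \<Rightarrow> z | Suc k \<Rightarrow> y) = (if b then y else z)"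
    for b and y z :: 'b by simp
  ultimately show ?thesis by (simp only:)
qed

lemma computable_not:
  assumes "computable b" shows "computable (\<lambda>x. \<not> b x)"
  by (rule back_subst[of computable, OF computable_if[OF assms computable_const[of False]
        computable_const[of True]]]) auto

lemma
  assumes "computable b" "computable c"
  shows computable_conj: "computable (\<lambda>x. b x \<and> c x)"
    and computable_disj: "computable (\<lambda>x. b x \<or> c x)"
    and computable_imp: "computable (\<lambda>x. b x \<longrightarrow> c x)"
proof -
  note if_rules = computable_if[OF assms computable_const[of False]]
    computable_if[OF assms(1) computable_const[of True] assms(2)]
    computable_if[OF assms computable_const[of True]]
  show "computable (\<lambda>x. b x \<and> c x)" by (rule back_subst[of computable, OF if_rules(1)]) auto
  show "computable (\<lambda>x. b x \<or> c x)" by (rule back_subst[of computable, OF if_rules(2)]) auto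
  show "computable (\<lambda>x. b x \<longrightarrow> c x)" by (rule back_subst[of computable, OF if_rules(3)]) auto
qed

lemma computable_case_sum:
  assumes "computable h" "computable (\<lambda>p. f (fst p) (snd p))" "computable (\<lambda>p. g (fst p) (snd p))"
  shows "computable (\<lambda>x. case h x of Inl a \<Rightarrow> f x a | Inr b \<Rightarrow> g x b)"
proof -
  obtain H F G where *: "recursive H" "\<And>x. H (enc x) = enc (h x)"
      "recursive F" "\<And>p. F (enc p) = enc (f (fst p) (snd p))"
      "recursive G" "\<And>p. G (enc p) = enc (g (fst p) (snd p))"
    using assms unfolding computable_def by metis
  let ?half = "\<lambda>x. H x div 2"
  have r: "recursive (\<lambda>x. H x mod 2)" "recursive ?half"
    using rec_comp[OF rec_fst rec_comp[OF recursive_parity_half *(1)]]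
      rec_comp[OF rec_snd rec_comp[OF recursive_parity_half *(1)]] by simp_all
  have "recursive (\<lambda>x. F (prod_encode (x, ?half x)))"
    by (intro rec_comp[OF *(3)] rec_pair recursive_id r)
  moreover have "recursive (\<lambda>z. G (prod_encode (fst (prod_decode z), ?half (fst (prod_decode z)))))"
    by (intro rec_comp[OF *(5)] rec_pair rec_comp[OF r(2)] rec_fst)
  ultimately have "recursive (\<lambda>x. case H x mod 2 of 0 \<Rightarrow> F (prod_encode (x, ?half x))
      | Suc k \<Rightarrow> (\<lambda>z. G (prod_encode (fst (prod_decode z), ?half (fst (prod_decode z)))))
          (prod_encode (x, k)))"
    by (rule recursive_case[OF r(1)])
  then show ?thesis
    by (rule computableI)
      (use *(4)[of "(_, _)"] *(6)[of "(_, _)"] in \<open>simp add: * enc_simps mod_Suc split: sum.split\<close>)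
qed

lemma computable_funpow:
  fixes s :: "'a :: nameable \<Rightarrow> 'b :: nameable \<Rightarrow> 'b"
  assumes "computable (\<lambda>p. s (fst p) (snd p))" "computable n" "computable a"
  shows "computable (\<lambda>x. (s x ^^ n x) (a x))"
proof -
  obtain S N A where *: "recursive S" "\<And>p. S (enc p) = enc (s (fst p) (snd p))"
      "recursive N" "\<And>x. N (enc x) = enc (n x)" "recursive A" "\<And>x. A (enc x) = enc (a x)"
    using assms unfolding computable_def by metis
  let ?g = "\<lambda>z. S (prod_encode (fst (prod_decode (fst (prod_decode z))), snd (prod_decode z)))"
  have "recursive ?g"
    by (intro rec_comp[OF *(1)] rec_pair rec_comp[OF rec_fst] rec_fst rec_snd)
  from rec_comp[OF rec_prim[OF *(5) this] rec_pair[OF recursive_id *(3)]]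
  have r: "recursive (\<lambda>x. rec_nat (A x) (\<lambda>k r. S (prod_encode (x, r))) (N x))" by simp
  have "rec_nat (A (enc x)) (\<lambda>k r. S (prod_encode (enc x, r))) m = enc ((s x ^^ m) (a x))" for x m
    by (induction m) (use *(2)[of "(_, _)"] in \<open>simp_all add: * enc_Pair\<close>)
  then show ?thesis by (intro computableI[OF r]) (simp add: * enc_nat_def)
qed

lemma computable_enc: "computable f \<Longrightarrow> computable (\<lambda>x. enc (f x))"
  by (rule computable_comp[OF computableI[OF recursive_id]]) (simp add: enc_nat_def)

text \<open>An iteration on the empty list changes nothing, so every count that is at least the
  length completes the fold.\<close>

lemma funpow_fold:
  "((\<lambda>(l, r). case l of [] \<Rightarrow> (l, r) | y # ys \<Rightarrow> (ys, g y r)) ^^ n) (xs, a) =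
    (drop n xs, fold g (take n xs) a)"
proof (induction n arbitrary: xs a)
  case (Suc n)
  show ?case by (cases xs) (simp_all add: funpow_Suc_right Suc del: funpow.simps)
qed simp

lemma computable_fold:
  assumes "computable (\<lambda>p. g (fst p) (fst (snd p)) (snd (snd p)))" "computable l" "computable a"
  shows "computable (\<lambda>x. fold (g x) (l x) (a x))"
proof -
  let ?s = "\<lambda>x p. case fst p of [] \<Rightarrow> p | y # ys \<Rightarrow> (ys, g x y (snd p))"
  have "computable (\<lambda>p. ?s (fst p) (snd p))"
    by (intro computable_case_list computable_Pair computable_fst computable_snd computable_id
        computable_comp2[OF assms(1), of _ "\<lambda>x. (_ x, _ x)", simplified])
  then have "computable (\<lambda>x. snd ((?s x ^^ enc (l x)) (l x, a x)))"
    by (intro computable_snd computable_funpow computable_enc computable_Pair assms)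
  moreover have "?s x = (\<lambda>(l, r). case l of [] \<Rightarrow> (l, r) | y # ys \<Rightarrow> (ys, g x y r))" for x
    by (auto simp: fun_eq_iff split: list.split)
  ultimately show ?thesis by (simp add: funpow_fold length_le_enc)
qed

lemma computable_rev: "computable l \<Longrightarrow> computable (\<lambda>x. rev (l x))"
  using computable_fold[of "\<lambda>_. (#)" l "\<lambda>_. []"]
  by (simp add: fold_Cons_rev computable_Cons computable_fst computable_snd computable_id
      computable_const)

lemma computable_foldr:
  assumes "computable (\<lambda>p. g (fst p) (fst (snd p)) (snd (snd p)))" "computable l" "computable a"
  shows "computable (\<lambda>x. foldr (g x) (l x) (a x))"
  unfolding foldr_conv_fold by (intro computable_fold computable_rev assms)

text \<open>A right fold does not see the tail, so the first component of the accumulator rebuilds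
  it.\<close>

lemma computable_rec_list:
  assumes "computable (\<lambda>p. g (fst p) (fst (snd p)) (fst (snd (snd p))) (snd (snd (snd p))))"
    "computable a" "computable l"
  shows "computable (\<lambda>x. rec_list (a x) (g x) (l x))"
proof -
  let ?f = "\<lambda>x y p. (y # fst p, g x y (fst p) (snd p))"
  have "computable (\<lambda>x. snd (foldr (?f x) (l x) ([], a x)))"
    by (intro computable_snd computable_foldr computable_Pair computable_Cons computable_const
        computable_comp[OF assms(1), of "\<lambda>x. (_ x, _ x, _ x, _ x)", simplified]
        computable_fst computable_snd computable_id assms)
  moreover have "foldr (?f x) xs ([], b) = (xs, rec_list b (g x) xs)" for x xs b
    by (induction xs) auto
  ultimately show ?thesis by simp
qed

lemma computable_rec_nat:
  fixes g :: "'a :: nameable \<Rightarrow> nat \<Rightarrow> 'b :: nameable \<Rightarrow> 'b"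
  assumes "computable (\<lambda>p. g (fst p) (fst (snd p)) (snd (snd p)))" "computable a" "computable n"
  shows "computable (\<lambda>x. rec_nat (a x) (g x) (n x))"
proof -
  let ?s = "\<lambda>x p. (Suc (fst p), g x (fst p) (snd p))"
  have "computable (\<lambda>x. snd ((?s x ^^ n x) (0, a x)))"
    by (intro computable_snd computable_funpow computable_Pair computable_Suc computable_const
        computable_comp[OF assms(1), of "\<lambda>x. (_ x, _ x, _ x)", simplified]
        computable_fst computable_id assms)
  moreover have "(?s x ^^ n) (0, b) = (n, rec_nat b (g x) n)" for x n b
    by (induction n) auto
  ultimately show ?thesis by simp
qed

lemma computable_minus:
  assumes "computable m" "computable n" shows "computable (\<lambda>x. m x - n x :: nat)"
proof -
  have "computable (\<lambda>x. rec_nat (m x) (\<lambda>_ r. case r of 0 \<Rightarrow> 0 | Suc k \<Rightarrow> k) (n x))"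
    by (intro computable_rec_nat computable_case_nat computable_const computable_snd computable_id assms)
  moreover have "rec_nat a (\<lambda>_ r. case r of 0 \<Rightarrow> 0 | Suc k \<Rightarrow> k) b = a - b" for a b :: nat
    by (induction b) (auto split: nat.split)
  ultimately show ?thesis by simp
qed

lemma computable_less:
  assumes "computable m" "computable n" shows "computable (\<lambda>x. m x < (n x :: nat))"
proof -
  have "computable (\<lambda>x. case n x - m x of 0 \<Rightarrow> False | Suc k \<Rightarrow> True)"
    by (intro computable_case_nat computable_minus computable_const assms)
  then show ?thesis
    by (rule back_subst[of computable]) (auto split: nat.split)
qed

text \<open>Injectivity of \<open>enc\<close> reduces equality at any type to two comparisons of
  numbers.\<close>

lemma computable_eq:
  assumes "computable f" "computable g" shows "computable (\<lambda>x. f x = g x)"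
proof -
  have "computable (\<lambda>x. \<not> enc (f x) < enc (g x) \<and> \<not> enc (g x) < enc (f x))"
    by (intro computable_conj computable_not computable_less computable_enc assms)
  moreover have "\<not> enc a < enc b \<and> \<not> enc b < enc a \<longleftrightarrow> a = b" for a b :: 'b
    by (metis enc_eq_iff linorder_neqE_nat less_irrefl)
  ultimately show ?thesis by (simp only:)
qed

lemma computable_map:
  assumes "computable (\<lambda>p. g (fst p) (snd p))" "computable l"
  shows "computable (\<lambda>x. map (g x) (l x))"
proof -
  have "computable (\<lambda>x. foldr (\<lambda>y r. g x y # r) (l x) [])"
    by (intro computable_foldr computable_Cons computable_comp2[OF assms(1)]
        computable_const computable_snd computable_fst computable_id assms)
  moreover have "foldr (\<lambda>y r. g x y # r) xs [] = map (g x) xs" for x xs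
    by (induction xs) auto
  ultimately show ?thesis by simp
qed

lemma computable_filter:
  assumes "computable (\<lambda>p. b (fst p) (snd p))" "computable l"
  shows "computable (\<lambda>x. filter (b x) (l x))"
proof -
  have "computable (\<lambda>x. foldr (\<lambda>y r. if b x y then y # r else r) (l x) [])"
    by (intro computable_foldr computable_Cons computable_if computable_comp2[OF assms(1)]
        computable_const computable_snd computable_fst computable_id assms)
  moreover have "foldr (\<lambda>y r. if b x y then y # r else r) xs [] = filter (b x) xs" for x xs
    by (induction xs) auto
  ultimately show ?thesis by simp
qed

lemma computable_append:
  assumes "computable f" "computable g" shows "computable (\<lambda>x. f x @ g x)"
proof -
  have "computable (\<lambda>x. foldr (#) (f x) (g x))"
    by (intro computable_foldr computable_Cons computable_snd computable_fst computable_id assms)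
  moreover have "foldr (#) xs ys = xs @ ys" for xs ys :: "'b list"
    by (induction xs) auto
  ultimately show ?thesis by simp
qed

lemma computable_concat:
  assumes "computable f" shows "computable (\<lambda>x. concat (f x))"
  unfolding concat_conv_foldr
  by (intro computable_foldr computable_append computable_const computable_snd computable_fst
      computable_id assms)

lemma computable_member:
  assumes "computable f" "computable g" shows "computable (\<lambda>x. f x \<in> set (g x))"
proof -
  have "computable (\<lambda>x. foldr (\<lambda>y r. y = f x \<or> r) (g x) False)"
    by (intro computable_foldr computable_disj computable_eq computable_comp[OF assms(1)]
        computable_const computable_snd computable_fst computable_id assms)
  moreover have "foldr (\<lambda>y r. y = a \<or> r) xs False \<longleftrightarrow> a \<in> set xs" for a :: 'b and xs
    by (induction xs) auto
  ultimately show ?thesis by simp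
qed

lemma computable_map_of:
  assumes "computable l" "computable k" shows "computable (\<lambda>x. map_of (l x) (k x))"
proof -
  have "computable (\<lambda>x. foldr (\<lambda>e r. if k x = fst e then Some (snd e) else r) (l x) None)"
    by (intro computable_foldr computable_if computable_eq computable_Some computable_comp[OF assms(2)]
        computable_const computable_snd computable_fst computable_id assms)
  moreover have "foldr (\<lambda>e r. if a = fst e then Some (snd e) else r) xs None = map_of xs a"
    for a :: 'b and xs :: "('b \<times> 'c) list"
    by (induction xs) auto
  ultimately show ?thesis by simp
qed

lemma computable_Inl:
  assumes "computable f" shows "computable (\<lambda>x. Inl (f x))"
proof -
  have "recursive (\<lambda>z. Suc (Suc (snd (prod_decode z))))"
    by (intro rec_comp[OF rec_Suc] rec_snd)
  from rec_comp[OF rec_prim[OF rec_zero this] rec_pair[OF recursive_id recursive_id]]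
  have *: "recursive (\<lambda>n. rec_nat 0 (\<lambda>_ r. Suc (Suc r)) n)" by simp
  have "rec_nat 0 (\<lambda>_ r. Suc (Suc r)) n = 2 * n" for n by (induction n) auto
  with * show ?thesis
    by (intro computable_comp[OF computableI[of "\<lambda>n. 2 * n"] assms]) (simp_all add: enc_Inl)
qed

lemma computable_Inr:
  assumes "computable f" shows "computable (\<lambda>x. Inr (f x))"
proof -
  from computable_Inl[OF assms] obtain F :: "nat \<Rightarrow> nat"
    where F: "recursive F" "\<And>x. F (enc x) = enc (Inl (f x) :: _ + nat)"
    unfolding computable_def by auto
  show ?thesis
    by (rule computableI[OF rec_comp[OF rec_Suc F(1)]]) (simp add: F enc_simps)
qed

lemma computable_product:
  assumes "computable f" "computable g" shows "computable (\<lambda>x. List.product (f x) (g x))"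
  unfolding product_concat_map
  by (intro computable_concat computable_map computable_Pair computable_comp[OF assms(2)]
      computable_snd computable_fst computable_id assms)

text \<open>On the level of numbers decoding is the identity, provided that every number is a code;
  this is why surjectivity of \<open>enc\<close> is tracked.\<close>

lemma computable_inv_enc:
  assumes "surj (enc :: 'b :: nameable \<Rightarrow> nat)" "computable f"
  shows "computable (\<lambda>x. inv (enc :: 'b \<Rightarrow> nat) (f x))"
  by (rule computable_comp[OF computableI[OF recursive_id] assms(2)])
    (simp add: surj_f_inv_f[OF assms(1)] enc_nat_def)

lemma surj_enc_nat: "surj (enc :: nat \<Rightarrow> nat)"
  by (simp add: surj_def enc_nat_def)

lemma
  assumes a: "surj (enc :: 'a :: nameable \<Rightarrow> nat)"
  shows surj_enc_list: "surj (enc :: 'a list \<Rightarrow> nat)"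
    and surj_enc_prod: "surj (enc :: 'b :: nameable \<Rightarrow> nat) \<Longrightarrow> surj (enc :: 'a \<times> 'b \<Rightarrow> nat)"
    and surj_enc_sum: "surj (enc :: 'b :: nameable \<Rightarrow> nat) \<Longrightarrow> surj (enc :: 'a + 'b \<Rightarrow> nat)"
proof -
  note [simp] = surj_f_inv_f a
  show "surj (enc :: 'a list \<Rightarrow> nat)"
    by (rule surjI[of _ "\<lambda>n. map (inv enc) (list_decode n)"]) (simp add: enc_list_def o_def)
  assume b: "surj (enc :: 'b \<Rightarrow> nat)"
  show "surj (enc :: 'a \<times> 'b \<Rightarrow> nat)"
    by (rule surjI[of _ "\<lambda>n. (inv enc (fst (prod_decode n)), inv enc (snd (prod_decode n)))"])
      (simp add: enc_Pair b)
  show "surj (enc :: 'a + 'b \<Rightarrow> nat)"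
    by (rule surjI[of _ "\<lambda>n. map_sum (inv enc) (inv enc) (sum_decode n)"])
      (simp add: enc_sum_def sum.map_comp o_def sum.map_ident b)
qed

lemma computable_recursive:
  assumes "computable (f :: nat \<Rightarrow> nat)" shows "recursive f"
proof -
  obtain F where "recursive F" "\<And>x. F x = f x"
    using assms by (auto simp: computable_def enc_nat_def)
  moreover from this(2) have "F = f" by (rule ext)
  ultimately show ?thesis by simp
qed

type_synonym subst_table = "(nat \<times> (nat + nat) list) list"

type_synonym edges = "(nat \<times> nat \<times> subst_table) list"

type_synonym pairing = "nat \<times> nat \<times> bool \<times> bool \<times> bool"

type_synonym track = "pairing \<times> nat"

section \<open>The construction on tables\<close>

text \<open>In a \<open>pairing\<close> \<open>(p, q, s, s', f)\<close> the tokens are on the edges from \<open>p\<close> and \<open>q\<close> to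
  their parents, \<open>s\<close> and \<open>s'\<close> tell whether they are on the left side of these edges, and \<open>f\<close>
  whether the head moves to the right. For a head moving to the right the edges are those over the
  next letter, for one moving to the left those that were crossed last.\<close>

definition beyond :: "bool \<Rightarrow> nat \<Rightarrow> nat \<Rightarrow> bool" where
  "beyond s p c = (if s then c < p else p < c)"

definition children :: "edges \<Rightarrow> nat \<Rightarrow> nat list" where
  "children E p = map fst (filter (\<lambda>e. fst (snd e) = p) E)"

text \<open>Used in two ways: among the siblings beyond a token on side \<open>s\<close> it picks
  the nearest one, and with \<open>\<not> s\<close> in place of \<open>s\<close> it picks the
  outermost child on side \<open>s\<close>.\<close>

definition extreme :: "bool \<Rightarrow> nat \<Rightarrow> nat list \<Rightarrow> nat" where
  "extreme s c cs = fold (\<lambda>d b. if beyond s d b then d else b) cs c"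

text \<open>\<open>Inl\<close>: the token turns and stays at the same position; \<open>Inr\<close>: it moves on with the head.\<close>

definition walk :: "edges \<Rightarrow> bool \<Rightarrow> bool \<Rightarrow> nat \<Rightarrow> (nat + nat) option" where
  "walk E f s p =
     (if f then
        case map_of E p of None \<Rightarrow> None | Some e \<Rightarrow>
          (case filter (beyond s p) (children E (fst e)) of
             [] \<Rightarrow> Some (Inr (fst e)) | c # cs \<Rightarrow> Some (Inl (extreme s c cs)))
      else
        case children E p of [] \<Rightarrow> Some (Inl p) | c # cs \<Rightarrow> Some (Inr (extreme (\<not> s) c cs)))"

text \<open>If the first token could move but the second one turns, the first keeps its node: the
  head has not changed its position, and with the flipped direction the first token retraces its
  outline.\<close>

definition climb :: "edges \<Rightarrow> pairing \<Rightarrow> pairing option" where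
  "climb E c = (case c of (p, q, s, s', f) \<Rightarrow>
     case walk E f s p of None \<Rightarrow> None | Some r \<Rightarrow>
       (case r of Inl p' \<Rightarrow> Some (p', q, \<not> s, s', \<not> f) | Inr p' \<Rightarrow>
          case walk E f s' q of None \<Rightarrow> None | Some r' \<Rightarrow>
            (case r' of Inl q' \<Rightarrow> Some (p, q', s, \<not> s', \<not> f) | Inr q' \<Rightarrow> Some (p', q', s, s', f))))"

definition reverse :: "pairing \<Rightarrow> pairing" where
  "reverse c = (case c of (p, q, s, s', f) \<Rightarrow> (p, q, s, s', \<not> f))"

text \<open>A shared edge is legal only with the path between the tokens. Among the excluded pairs
  are those left to the tour.\<close>

definition proper :: "pairing \<Rightarrow> bool" where
  "proper c = (case c of (p, q, s, s', f) \<Rightarrow> p = q \<longrightarrow> s \<and> \<not> s')"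

definition ahead :: "pairing \<Rightarrow> bool" where
  "ahead c = (case c of (p, q, s, s', f) \<Rightarrow> f)"

definition meet :: "pairing \<Rightarrow> bool" where
  "meet c = (case c of (p, q, s, s', f) \<Rightarrow> p = q)"

text \<open>In the pairs computed by \<open>scan\<close> and \<open>visit\<close>, \<open>(False, x)\<close> means that the value of \<open>x\<close> is
  still to be output and \<open>(True, x)\<close> that it has been output.\<close>

definition scan :: "nat \<Rightarrow> (nat + nat) list \<Rightarrow> (bool \<times> nat) \<times> nat list" where
  "scan y l = rec_list ((True, y), [])
     (\<lambda>h t r. case h of Inl z \<Rightarrow> ((False, z), []) | Inr b \<Rightarrow> (fst r, b # snd r)) l"

definition after :: "nat \<Rightarrow> (nat + nat) list \<Rightarrow> (nat + nat) list" where
  "after x l = rec_list [] (\<lambda>h t r. if h = Inl x then t else r) l"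

definition visit :: "subst_table \<Rightarrow> bool \<Rightarrow> nat \<Rightarrow> ((bool \<times> nat) \<times> nat list) option" where
  "visit S m x =
     (if m then
        case filter (\<lambda>e. Inl x \<in> set (snd e)) S of
          [] \<Rightarrow> None | e # es \<Rightarrow> Some (scan (fst e) (after x (snd e)))
      else case map_of S x of None \<Rightarrow> None | Some l \<Rightarrow> Some (scan x l))"

text \<open>The flags before and after the visit say whether a value is complete (the head should go
  up) or requested (it should go down). If they agree the head continues over the edge, otherwise it
  returns the way it came, which is \<open>reverse c\<close>.\<close>

definition cross ::
  "edges \<Rightarrow> nat \<Rightarrow> bool \<Rightarrow> pairing \<Rightarrow> pairing \<Rightarrow> nat \<Rightarrow> (track \<times> nat list) option" where
  "cross E p m c c' x =
     (case map_of E p of None \<Rightarrow> None | Some e \<Rightarrow>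
        (case visit (snd e) m x of None \<Rightarrow> None | Some r \<Rightarrow>
           Some ((if fst (fst r) = m then c' else reverse c, snd (fst r)), snd r)))"

definition pass :: "edges \<Rightarrow> track \<Rightarrow> (track \<times> nat list) option" where
  "pass E t = (case t of (c, x) \<Rightarrow>
     if \<not> proper c then None else
       case climb E c of None \<Rightarrow> None | Some c' \<Rightarrow>
         if \<not> proper c' then None
         else if meet c \<and> ahead c then cross E (fst c) True c c' x
         else if meet c' \<and> \<not> ahead c' then cross E (fst c') False c c' x
         else Some ((c', x), []))"

text \<open>A touring track has both tokens on the same side of one edge; such tracks are not \<open>proper\<close>, so
  the evaluation does not use them.\<close>

definition touring :: "nat \<Rightarrow> track \<Rightarrow> bool" where
  "touring z t = (case t of ((p, q, s, s', f), x) \<Rightarrow> p = q \<and> s = f \<and> s' = f \<and> x = z)"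

definition tour :: "nat \<Rightarrow> bool \<Rightarrow> nat \<Rightarrow> track" where
  "tour z f p = ((p, p, f, f, f), z)"

definition summit :: "nat \<Rightarrow> nat \<Rightarrow> bool \<Rightarrow> track" where
  "summit z r f = ((r, r, True, False, f), z)"

text \<open>Symbols are given by their codes: \<open>0\<close> and \<open>1\<close> are the endmarkers. When the tour reaches the
  root, the track is treated as the one that has the right endmarker on its left and is about to
  evaluate the final variable. Since the head never gets there, the only transition into its
  successor is the one from the end of the tour.\<close>

definition next_track ::
  "nat \<Rightarrow> nat \<Rightarrow> nat \<Rightarrow> edges \<Rightarrow> track \<Rightarrow> (track \<times> nat list) option" where
  "next_track z r k E t =
     (let c = fst t; f = ahead c in
      if touring z t then
        (if k = 1 \<and> \<not> f then None else
          case walk E f f (fst c) of None \<Rightarrow> None | Some o' \<Rightarrow>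
            (case o' of
               Inl p' \<Rightarrow> Some (tour z (\<not> f) p', [])
             | Inr p' \<Rightarrow> if k = 1 then pass E (summit z r False) else Some (tour z f p', [])))
      else if k = 0 \<and> f \<or> k = 1 \<and> \<not> f then None
      else case pass E t of None \<Rightarrow> None | Some u \<Rightarrow>
        if k = 1 \<and> ahead (fst (fst u)) \<and> snd (fst u) \<noteq> z then None else Some u)"

abbreviation is_letter :: "'a + 'b \<Rightarrow> bool" where
  "is_letter \<equiv> \<lambda>s. case s of Inl _ \<Rightarrow> False | Inr _ \<Rightarrow> True"

text \<open>Before the first letter all variables are empty, so they can be dropped from the updates on the
  left endmarker, and the evaluation never moves to the left of it.\<close>

definition erase :: "subst_table \<Rightarrow> subst_table" where
  "erase S = map (\<lambda>e. (fst e, filter is_letter (snd e))) S"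

type_synonym table = "(nat list \<times> subst_table) list"

text \<open>A coded transition \<open>[p, j, q]\<close> is matched one constructor at a time,
  because the computability rules handle no deeper patterns.\<close>

definition edges_of :: "table \<Rightarrow> nat \<Rightarrow> edges" where
  "edges_of D k = concat (map (\<lambda>d.
     case fst d of [] \<Rightarrow> [] | p # t \<Rightarrow>
       (case t of [] \<Rightarrow> [] | j # t' \<Rightarrow>
         (case t' of [] \<Rightarrow> [] | q # _ \<Rightarrow>
           if j = k then [(p, q, if k = 0 then erase (snd d) else snd d)] else []))) D)"

definition tracks :: "nat list \<Rightarrow> nat list \<Rightarrow> bool \<Rightarrow> track list" where
  "tracks ps xs f = map (\<lambda>y. case y of ((p, q), (s, s'), x) \<Rightarrow> ((p, q, s, s', f), x))
     (List.product (List.product ps ps)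
       (List.product (List.product [True, False] [True, False]) xs))"

definition table_out ::
  "nat \<Rightarrow> nat \<Rightarrow> table \<Rightarrow> nat list \<Rightarrow> track list \<Rightarrow> (nat list \<times> nat list) list" where
  "table_out z r D ks ts = concat (map (\<lambda>k. concat (map (\<lambda>t.
     case next_track z r k (edges_of D k) t of None \<Rightarrow> []
     | Some u \<Rightarrow> [([enc t, k, enc (fst u)], snd u)]) ts)) ks)"

text \<open>The pattern lists the eight components of \<open>codes_sst\<close> in their order.
  Tracks are generated separately for the two directions, as \<open>codes_ft2\<close> lists forward
  and backward states separately.\<close>

definition compile :: "nat \<Rightarrow> nat" where
  "compile n = (case list_decode n of
     [as, bs, ps', i, r, xs', z, d] \<Rightarrow>
       (let ps = inv enc ps'; xs = inv enc xs';
            fs = tracks ps xs True; gs = tracks ps xs False in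
        enc [as, bs, enc (map enc fs), enc (map enc gs), enc (tour z True i), enc (summit z r True),
          enc (table_out z r (inv enc d) (0 # 1 # map (\<lambda>a. Suc (Suc a)) (inv enc as)) (fs @ gs))])
   | _ \<Rightarrow> 0)"

text \<open>The functions of the construction are built from these constructs, so applying rules by
  the shape of the term proves computability. Under a binder the argument becomes a pair, and
  \<open>computable_comp\<close> lifts the assumptions to it.\<close>

lemmas computable_basic = computable_const computable_id computable_Pair computable_fst
  computable_snd computable_Let computable_case_prod computable_Suc computable_Some computable_Cons
  computable_case_nat computable_case_option computable_case_list computable_case_sum
  computable_if computable_not computable_conj computable_disj computable_imp computable_eq
  computable_less computable_map computable_filter computable_append computable_concat
  computable_member computable_map_of computable_Inl computable_Inr computable_product
  computable_fold computable_foldr computable_rec_list computable_enc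

section \<open>Computability of the construction\<close>

lemma computable_beyond:
  assumes "computable s" "computable p" "computable c"
  shows "computable (\<lambda>x. beyond (s x) (p x) (c x))"
  unfolding beyond_def by (rule computable_if computable_less assms)+

lemma computable_children:
  assumes "computable E" "computable p" shows "computable (\<lambda>x. children (E x) (p x))"
  unfolding children_def
  by (rule computable_basic computable_comp[OF assms(2)] assms)+

lemma computable_extreme:
  assumes "computable s" "computable c" "computable cs"
  shows "computable (\<lambda>x. extreme (s x) (c x) (cs x))"
  unfolding extreme_def
  by (rule computable_basic computable_beyond computable_comp[OF assms(1)] assms)+

lemma computable_walk:
  assumes "computable E" "computable f" "computable s" "computable p"
  shows "computable (\<lambda>x. walk (E x) (f x) (s x) (p x))"
  unfolding walk_def
  by (rule computable_basic computable_children computable_beyond computable_extreme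
      assms assms[THEN computable_comp])+

lemma computable_climb:
  assumes "computable E" "computable c" shows "computable (\<lambda>x. climb (E x) (c x))"
  unfolding climb_def
  by (rule computable_basic computable_walk assms assms[THEN computable_comp])+

lemma
  assumes "computable c"
  shows computable_reverse: "computable (\<lambda>x. reverse (c x))"
    and computable_proper: "computable (\<lambda>x. proper (c x))"
    and computable_ahead: "computable (\<lambda>x. ahead (c x))"
    and computable_meet: "computable (\<lambda>x. meet (c x))"
  unfolding reverse_def proper_def ahead_def meet_def by (rule computable_basic assms)+

lemma
  assumes "computable y" "computable l"
  shows computable_scan: "computable (\<lambda>x. scan (y x) (l x))"
    and computable_after: "computable (\<lambda>x. after (y x) (l x))"
  unfolding scan_def after_def by (rule computable_basic assms assms[THEN computable_comp])+

lemma computable_visit: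
  assumes "computable S" "computable m" "computable y"
  shows "computable (\<lambda>x. visit (S x) (m x) (y x))"
  unfolding visit_def
  by (rule computable_basic computable_scan computable_after assms assms[THEN computable_comp])+

lemma computable_cross:
  assumes "computable E" "computable p" "computable m" "computable c" "computable c'" "computable y"
  shows "computable (\<lambda>x. cross (E x) (p x) (m x) (c x) (c' x) (y x))"
  unfolding cross_def
  by (rule computable_basic computable_visit computable_reverse assms assms[THEN computable_comp])+

lemma computable_pass:
  assumes "computable E" "computable t" shows "computable (\<lambda>x. pass (E x) (t x))"
  unfolding pass_def
  by (rule computable_basic computable_cross computable_reverse computable_climb computable_proper
      computable_meet computable_ahead assms assms[THEN computable_comp])+

lemma computable_touring:
  assumes "computable z" "computable t" shows "computable (\<lambda>x. touring (z x) (t x))"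
  unfolding touring_def by (rule computable_basic assms assms[THEN computable_comp])+

lemma computable_tour:
  assumes "computable z" "computable f" "computable p"
  shows "computable (\<lambda>x. tour (z x) (f x) (p x))"
  unfolding tour_def by (rule computable_basic assms)+

lemma computable_summit:
  assumes "computable z" "computable r" "computable f"
  shows "computable (\<lambda>x. summit (z x) (r x) (f x))"
  unfolding summit_def by (rule computable_basic assms)+

lemma computable_next_track:
  assumes "computable z" "computable r" "computable k" "computable E" "computable t"
  shows "computable (\<lambda>x. next_track (z x) (r x) (k x) (E x) (t x))"
  unfolding next_track_def
  by (rule computable_basic computable_pass computable_walk computable_touring computable_ahead
      computable_tour computable_summit assms assms[THEN computable_comp])+

lemma computable_edges_of:
  assumes "computable D" "computable k" shows "computable (\<lambda>x. edges_of (D x) (k x))"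
  unfolding edges_of_def erase_def
  by (rule computable_basic assms assms[THEN computable_comp])+

lemma computable_tracks:
  assumes "computable ps" "computable xs" "computable f"
  shows "computable (\<lambda>x. tracks (ps x) (xs x) (f x))"
  unfolding tracks_def by (rule computable_basic assms assms[THEN computable_comp])+

lemma computable_table_out:
  assumes "computable z" "computable r" "computable D" "computable ks" "computable ts"
  shows "computable (\<lambda>x. table_out (z x) (r x) (D x) (ks x) (ts x))"
  unfolding table_out_def
  by (rule computable_basic computable_edges_of computable_next_track
      assms assms[THEN computable_comp])+

lemma enc_nat_list: "enc (ns :: nat list) = list_encode ns"
proof -
  have "map enc ns = ns" by (simp add: enc_nat_def map_idI)
  then show ?thesis by (simp add: enc_list_def)
qed

lemma computable_list_decode:
  assumes "computable f" shows "computable (\<lambda>x. list_decode (f x))"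
  by (rule computable_comp[OF computableI[OF recursive_id, of list_decode] assms])
    (simp add: enc_nat_list enc_nat_def)

lemma recursive_compile: "recursive compile"
  unfolding compile_def
  by (rule computable_recursive computable_basic computable_list_decode computable_tracks
      computable_table_out computable_tour computable_summit computable_inv_enc surj_enc_list
      surj_enc_prod surj_enc_sum surj_enc_nat)+

section \<open>Reversibility of the local rules\<close>

definition parent :: "edges \<Rightarrow> nat \<Rightarrow> nat option" where
  "parent E p = map_option fst (map_of E p)"

lemma children_iff:
  "distinct (map fst E) \<Longrightarrow> c \<in> set (children E p) \<longleftrightarrow> parent E c = Some p"
  by (force simp: children_def parent_def map_of_eq_Some_iff)

lemma beyond_irrefl [simp]: "\<not> beyond s p p"
  and beyond_not: "beyond (\<not> s) p c \<longleftrightarrow> beyond s c p"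
  and beyond_total: "c = p \<or> beyond s p c \<or> beyond s c p"
  and beyond_asym: "beyond s p c \<Longrightarrow> \<not> beyond s c p"
  and beyond_trans: "beyond s p c \<Longrightarrow> beyond s c d \<Longrightarrow> beyond s p d"
  by (auto simp: beyond_def)

definition closest :: "bool \<Rightarrow> nat set \<Rightarrow> nat \<Rightarrow> bool" where
  "closest s A e \<longleftrightarrow> e \<in> A \<and> (\<forall>c \<in> A. c = e \<or> beyond s e c)"

lemma closest_unique: "closest s A e \<Longrightarrow> closest s A e' \<Longrightarrow> e = e'"
  unfolding closest_def by (metis beyond_asym)

lemma closest_extreme: "closest s (insert c (set cs)) (extreme s c cs)"
proof (induction cs arbitrary: c)
  case (Cons d cs)
  define b where "b = (if beyond s d c then d else c)"
  have e: "extreme s c (d # cs) = extreme s b cs"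
    by (simp add: extreme_def b_def)
  have *: "x = b \<or> beyond s b x" if "x = c \<or> x = d" for x
    using that beyond_total[of c d s] by (auto simp: b_def)
  have ih: "closest s (insert b (set cs)) (extreme s b cs)" by (rule Cons)
  have "extreme s b cs \<in> insert c (set (d # cs))"
    using ih by (auto simp: closest_def b_def split: if_splits)
  moreover have "x = extreme s b cs \<or> beyond s (extreme s b cs) x"
    if x: "x \<in> insert c (set (d # cs))" for x
  proof (cases "x \<in> insert b (set cs)")
    case False
    then have "beyond s b x" using x *[of x] by auto
    then show ?thesis using ih beyond_trans[of s "extreme s b cs" b x] unfolding closest_def by auto
  qed (use ih in \<open>auto simp: closest_def\<close>)
  ultimately show ?case unfolding e closest_def by blast
qed (simp add: extreme_def closest_def)

lemma closest_extreme': "set xs = A \<Longrightarrow> xs = c # cs \<Longrightarrow> closest s A e \<longleftrightarrow> e = extreme s c cs"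
  using closest_extreme[of s c cs] closest_unique by auto

lemma climb_iff:
  "climb E (p, q, s, s', f) = Some c \<longleftrightarrow>
     (\<exists>p'. walk E f s p = Some (Inl p') \<and> c = (p', q, \<not> s, s', \<not> f)) \<or>
     (\<exists>p' q'. walk E f s p = Some (Inr p') \<and> walk E f s' q = Some (Inl q') \<and>
        c = (p, q', s, \<not> s', \<not> f)) \<or>
     (\<exists>p' q'. walk E f s p = Some (Inr p') \<and> walk E f s' q = Some (Inr q') \<and>
        c = (p', q', s, s', f))"
  by (auto simp: climb_def split: option.splits sum.splits)

context
  fixes E :: edges
  assumes dist: "distinct (map fst E)"
begin

text \<open>Characterised by \<open>parent\<close> and \<open>closest\<close>, the walk no longer
  depends on the order of the list \<open>E\<close>, and going up and going down become
  comparable.\<close>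

lemma walk_up_turn:
  "walk E True s p = Some (Inl c) \<longleftrightarrow>
     (\<exists>p'. parent E p = Some p' \<and> closest s {d. parent E d = Some p' \<and> beyond s p d} c)"
  and walk_up_move:
  "walk E True s p = Some (Inr q) \<longleftrightarrow>
     parent E p = Some q \<and> (\<forall>d. parent E d = Some q \<longrightarrow> \<not> beyond s p d)"
proof -
  have "(walk E True s p = Some (Inl c) \<longleftrightarrow>
       (\<exists>p'. parent E p = Some p' \<and> closest s {d. parent E d = Some p' \<and> beyond s p d} c)) \<and>
     (walk E True s p = Some (Inr q) \<longleftrightarrow>
       parent E p = Some q \<and> (\<forall>d. parent E d = Some q \<longrightarrow> \<not> beyond s p d))"
  proof (cases "parent E p")
    case (Some p')
    let ?l = "filter (beyond s p) (children E p')"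
    have l: "set ?l = {d. parent E d = Some p' \<and> beyond s p d}"
      by (auto simp: children_iff[OF dist])
    have w: "walk E True s p = (case ?l of [] \<Rightarrow> Some (Inr p') | c # cs \<Rightarrow> Some (Inl (extreme s c cs)))"
      using Some by (auto simp: walk_def parent_def split: list.split)
    show ?thesis
    proof (cases ?l)
      case Nil
      then have "{d. parent E d = Some p' \<and> beyond s p d} = {}" using l by simp
      then show ?thesis using Some w Nil by (auto simp: closest_def)
    next
      case (Cons a as)
      then have "a \<in> {d. parent E d = Some p' \<and> beyond s p d}" using l by auto
      then show ?thesis using Some w Cons closest_extreme'[OF l Cons] by auto
    qed
  qed (auto simp: walk_def parent_def)
  then show "walk E True s p = Some (Inl c) \<longleftrightarrow>
       (\<exists>p'. parent E p = Some p' \<and> closest s {d. parent E d = Some p' \<and> beyond s p d} c)"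
    and "walk E True s p = Some (Inr q) \<longleftrightarrow>
       parent E p = Some q \<and> (\<forall>d. parent E d = Some q \<longrightarrow> \<not> beyond s p d)" by simp_all
qed

lemma walk_down_turn:
  "walk E False s p = Some (Inl c) \<longleftrightarrow> c = p \<and> (\<forall>d. parent E d \<noteq> Some p)"
  by (cases "children E p") (auto simp: walk_def simp flip: children_iff[OF dist])

lemma walk_down_move:
  "walk E False s p = Some (Inr c) \<longleftrightarrow> closest (\<not> s) {d. parent E d = Some p} c"
proof -
  have s: "set (children E p) = {d. parent E d = Some p}"
    by (auto simp: children_iff[OF dist])
  show ?thesis
  proof (cases "children E p")
    case Nil
    then have "{d. parent E d = Some p} = {}" using s by simp
    then show ?thesis using Nil by (simp add: closest_def walk_def)
  next
    case (Cons a as)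
    then show ?thesis using closest_extreme'[OF s Cons] by (auto simp: walk_def)
  qed
qed

text \<open>Nearest siblings are mutual: if \<open>c\<close> is nearest to \<open>p\<close> on side
  \<open>s\<close>, then \<open>p\<close> is nearest to \<open>c\<close> on the other side. At a
  node without children the token only rounds the tip and changes sides.\<close>

lemma walk_turn_back:
  assumes "walk E f s p = Some (Inl c)" shows "walk E f (\<not> s) c = Some (Inl p)"
proof (cases f)
  case True
  with assms obtain p' where p: "parent E p = Some p'"
      "closest s {d. parent E d = Some p' \<and> beyond s p d} c"
    by (auto simp: walk_up_turn)
  then have "parent E c = Some p'" "closest (\<not> s) {d. parent E d = Some p' \<and> beyond (\<not> s) c d} p"
    by (auto simp: closest_def beyond_not dest: beyond_asym)
      (metis beyond_asym beyond_total)
  then show ?thesis using True by (auto simp: walk_up_turn)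
next
  case False
  with assms have "c = p" and nc: "\<forall>d. parent E d \<noteq> Some p" by (auto simp: walk_down_turn)
  then show ?thesis using False by (auto simp: walk_down_turn)
qed

text \<open>A token gets up on side \<open>s\<close> only from the outermost child on that side, and
  this is the child that a descent on side \<open>s\<close> enters.\<close>

lemma walk_move_back:
  assumes "walk E f s p = Some (Inr c)" shows "walk E (\<not> f) s c = Some (Inr p)"
proof (cases f)
  case True
  then have "closest (\<not> s) {d. parent E d = Some c} p"
    using assms by (auto simp: walk_up_move closest_def beyond_not) (metis beyond_total)
  then show ?thesis using True by (auto simp: walk_down_move)
next
  case False
  then have "closest (\<not> s) {d. parent E d = Some p} c"
    using assms by (auto simp: walk_down_move)
  then show ?thesis using False
    by (auto simp: walk_up_move closest_def beyond_not dest: beyond_asym)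
qed

lemma walk_turn_ne: "walk E True s p = Some (Inl c) \<Longrightarrow> c \<noteq> p"
  by (auto simp: walk_up_turn closest_def)

text \<open>When only the second token turned, the first is still on its old edge and would move
  again, so that after \<open>reverse\<close> it is again the second token that turns, back to its
  old node.\<close>

lemma climb_back:
  assumes "climb E c = Some c'" shows "climb E (reverse c') = Some (reverse c)"
proof -
  obtain p q s s' f where c: "c = (p, q, s, s', f)" by (cases c)
  from assms[unfolded c climb_iff] show ?thesis
  proof (elim disjE exE conjE)
    fix p' assume "walk E f s p = Some (Inl p')" "c' = (p', q, \<not> s, s', \<not> f)"
    then show ?thesis using walk_turn_back[of f s p p'] by (auto simp: c reverse_def climb_iff)
  next
    fix p' q'
    assume "walk E f s p = Some (Inr p')" "walk E f s' q = Some (Inl q')" "c' = (p, q', s, \<not> s', \<not> f)"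
    then show ?thesis using walk_turn_back[of f s' q q'] by (auto simp: c reverse_def climb_iff)
  next
    fix p' q'
    assume "walk E f s p = Some (Inr p')" "walk E f s' q = Some (Inr q')" "c' = (p', q', s, s', f)"
    then show ?thesis using walk_move_back[of f s p p'] walk_move_back[of f s' q q']
      by (auto simp: c reverse_def climb_iff)
  qed
qed

end

section \<open>Visits of update words and their injectivity\<close>

lemma scan_simps [simp]:
  "scan y [] = ((True, y), [])"
  "scan y (Inl z # l) = ((False, z), [])"
  "scan y (Inr b # l) = (fst (scan y l), b # snd (scan y l))"
  by (simp_all add: scan_def)

lemma after_simps [simp]:
  "after x [] = []"
  "after x (h # l) = (if h = Inl x then l else after x l)"
  by (simp_all add: after_def)

lemma after_append: "Inl x \<notin> set l \<Longrightarrow> after x (l @ Inl x # r) = r"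
  by (induction l) auto

lemma after_split: "Inl x \<in> set l \<Longrightarrow> \<exists>l0. l = l0 @ Inl x # after x l"
  by (metis after_append split_list_first)

lemma scan_split:
  "\<exists>l'. l = map Inr (snd (scan y l)) @ l' \<and>
     (fst (scan y l) = (True, y) \<and> l' = [] \<or>
      (\<exists>z l''. fst (scan y l) = (False, z) \<and> l' = Inl z # l''))"
proof (induction l)
  case (Cons h l)
  then show ?case by (cases h) auto
qed simp

definition copyless_table :: "subst_table \<Rightarrow> bool" where
  "copyless_table S \<longleftrightarrow> distinct (map fst S) \<and>
     (\<forall>e \<in> set S. \<forall>x. count_list (snd e) (Inl x) \<le> 1) \<and>
     (\<forall>e \<in> set S. \<forall>e' \<in> set S. \<forall>x. Inl x \<in> set (snd e) \<longrightarrow> Inl x \<in> set (snd e') \<longrightarrow> e = e')"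

text \<open>\<open>a\<close> is the part of the word already treated, up to and including the
  variable just finished; \<open>w\<close> is output now; \<open>l\<close> is the rest, which begins
  with the variable requested next.\<close>

lemma visit_split:
  assumes "visit S m x = Some (t, w)"
  obtains y a l where "(y, a @ map Inr w @ l) \<in> set S"
    "if m then \<exists>a0. a = a0 @ [Inl x] else a = [] \<and> x = y"
    "t = (True, y) \<and> l = [] \<or> (\<exists>z l'. t = (False, z) \<and> l = Inl z # l')"
proof (cases m)
  case True
  then obtain e es where f: "filter (\<lambda>e. Inl x \<in> set (snd e)) S = e # es"
      and t: "scan (fst e) (after x (snd e)) = (t, w)"
    using assms by (auto simp: visit_def split: list.splits)
  have e: "e \<in> set S" "Inl x \<in> set (snd e)"
    using f[THEN arg_cong[of _ _ set]] by auto
  obtain l0 where l0: "snd e = l0 @ Inl x # after x (snd e)" using after_split[OF e(2)] by auto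
  obtain l where l: "after x (snd e) = map Inr w @ l"
      "t = (True, fst e) \<and> l = [] \<or> (\<exists>z l'. t = (False, z) \<and> l = Inl z # l')"
    using scan_split[of "after x (snd e)" "fst e"] t by auto
  have "e = (fst e, (l0 @ [Inl x]) @ map Inr w @ l)" using l0 l(1) by (simp add: prod_eq_iff)
  with e(1) have "(fst e, (l0 @ [Inl x]) @ map Inr w @ l) \<in> set S" by simp
  from that[OF this] show ?thesis using True l(2) by auto
next
  case False
  then obtain r where m: "map_of S x = Some r" and t: "scan x r = (t, w)"
    using assms by (auto simp: visit_def split: option.splits)
  obtain l where l: "r = map Inr w @ l"
      "t = (True, x) \<and> l = [] \<or> (\<exists>z l'. t = (False, z) \<and> l = Inl z # l')"
    using scan_split[of r x] t by auto
  from that[of x "[]" l] show ?thesis using False map_of_SomeD[OF m] l by auto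
qed

text \<open>Since \<open>a\<close> is empty or ends in a variable, it is recovered by stripping the
  trailing letters.\<close>

lemma append_map_Inr_eq:
  assumes "a @ map Inr w = a' @ map Inr w'"
    and "a = [] \<or> (\<exists>a0 x. a = a0 @ [Inl x])" "a' = [] \<or> (\<exists>a0 x. a' = a0 @ [Inl x])"
  shows "a = a'"
proof -
  have *: "b = rev (dropWhile is_letter (rev (b @ map Inr v)))"
    if "b = [] \<or> (\<exists>a0 x. b = a0 @ [Inl x])" for b and v
    using that by (induction v rule: rev_induct) (auto simp: dropWhile_append)
  show ?thesis using *[OF assms(2), of w] *[OF assms(3), of w'] assms(1) by simp
qed

lemma append_eq_count_1:
  assumes "a @ z # l = a' @ z # l'" "count_list (a @ z # l) z \<le> 1"
  shows "a = a'"
proof -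
  have "z \<notin> set a" "z \<notin> set a'"
    using assms(2) assms(2)[unfolded assms(1)] by (auto simp: count_list_0_iff)
  then have "a = takeWhile (\<lambda>s. s \<noteq> z) (a @ z # l)" "a' = takeWhile (\<lambda>s. s \<noteq> z) (a' @ z # l')"
    by (auto simp: takeWhile_append)
  then show ?thesis using assms(1) by simp
qed

text \<open>The target determines an entry and the prefix read so far: the whole word if the value
  is complete, otherwise everything before the only occurrence of the requested variable. Without
  its trailing letters this prefix shows the source: it ends in the finished variable, or it is
  empty.\<close>

lemma visit_inject:
  assumes S: "copyless_table S" and "visit S m x = Some (t, w)" "visit S m' x' = Some (t, w')"
  shows "m = m' \<and> x = x'"
proof -
  from assms(2) obtain y a l where 1: "(y, a @ map Inr w @ l) \<in> set S"
    "if m then \<exists>a0. a = a0 @ [Inl x] else a = [] \<and> x = y"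
    "t = (True, y) \<and> l = [] \<or> (\<exists>z l'. t = (False, z) \<and> l = Inl z # l')" by (rule visit_split)
  from assms(3) obtain y' a' l' where 2: "(y', a' @ map Inr w' @ l') \<in> set S"
    "if m' then \<exists>a0. a' = a0 @ [Inl x'] else a' = [] \<and> x' = y'"
    "t = (True, y') \<and> l' = [] \<or> (\<exists>z l''. t = (False, z) \<and> l' = Inl z # l'')" by (rule visit_split)
  have "y = y' \<and> a @ map Inr w = a' @ map Inr w'"
  proof (cases "fst t")
    case True
    then have "y = y'" "l = []" "l' = []" using 1(3) 2(3) by auto
    moreover from this have "a @ map Inr w = a' @ map Inr w'"
      using S 1(1) 2(1) by (auto simp: copyless_table_def dest: eq_key_imp_eq_value)
    ultimately show ?thesis by simp
  next
    case False
    then obtain z r r' where z: "l = Inl z # r" "l' = Inl z # r'" using 1(3) 2(3) by auto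
    then have "Inl z \<in> set (snd (y, a @ map Inr w @ l))" "Inl z \<in> set (snd (y', a' @ map Inr w' @ l'))"
      by auto
    then have eq: "(y, a @ map Inr w @ l) = (y', a' @ map Inr w' @ l')"
      using S 1(1) 2(1) unfolding copyless_table_def by metis
    moreover have "count_list (a @ map Inr w @ l) (Inl z) \<le> 1"
      using S 1(1) unfolding copyless_table_def by fastforce
    ultimately show ?thesis using append_eq_count_1[of "a @ map Inr w" "Inl z" r "a' @ map Inr w'" r']
      by (simp add: z)
  qed
  moreover have "a = [] \<or> (\<exists>a0 x. a = a0 @ [Inl x])" "a' = [] \<or> (\<exists>a0 x. a' = a0 @ [Inl x])"
    using 1(2) 2(2) by (metis (full_types))+
  ultimately have "y = y'" "a = a'" using append_map_Inr_eq[of a w a' w'] by blast+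
  then show ?thesis using 1(2) 2(2) by (auto split: if_splits)
qed

section \<open>Injectivity of the transition function\<close>

lemma reverse_reverse [simp]: "reverse (reverse c) = c"
  and reverse_inject [simp]: "reverse c = reverse d \<longleftrightarrow> c = d"
  and proper_reverse [simp]: "proper (reverse c) = proper c"
  and meet_reverse [simp]: "meet (reverse c) = meet c"
  and ahead_reverse [simp]: "ahead (reverse c) \<longleftrightarrow> \<not> ahead c"
  and fst_reverse [simp]: "fst (reverse c) = fst c"
  by (auto simp: reverse_def proper_def meet_def ahead_def split: prod.splits)

definition edges_ok :: "edges \<Rightarrow> bool" where
  "edges_ok E \<longleftrightarrow> distinct (map fst E) \<and> (\<forall>e \<in> set E. copyless_table (snd (snd e)))"

lemma cross_cases:
  assumes "cross E p m c c' x = Some ((c2, y), w)"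
  obtains p' S m' where "map_of E p = Some (p', S)" "visit S m x = Some ((m', y), w)"
    "c2 = (if m' = m then c' else reverse c)"
  using assms by (auto simp: cross_def split: option.splits)

text \<open>Such a step would be an upward turn, which takes one token to a different sibling and
  leaves the other where it is.\<close>

lemma climb_meet:
  assumes "distinct (map fst E)" "climb E c = Some c'" "ahead c" "\<not> ahead c'" "meet c" "meet c'"
  shows False
proof -
  obtain p q s s' f where c: "c = (p, q, s, s', f)" by (cases c)
  from assms(2)[unfolded c climb_iff] show False
    using assms(3-6) walk_turn_ne[OF assms(1)] by (auto simp: c ahead_def meet_def)
qed

text \<open>A turn changes a side and a joint move keeps the direction. Hence a reflection ordered
  by an update can be told apart from every step of the tokens.\<close>

lemma climb_ne_reverse: "climb E c \<noteq> Some (reverse c)"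
  by (cases c) (auto simp: climb_iff reverse_def)

text \<open>\<open>m\<close> is the flag handed to \<open>visit\<close>: going up from a shared edge
  means that a value is complete, coming down onto one that a value is requested.\<close>

definition apex :: "bool \<Rightarrow> pairing \<Rightarrow> pairing \<Rightarrow> nat \<Rightarrow> bool" where
  "apex m c c' p \<longleftrightarrow>
     (if m then meet c \<and> ahead c \<and> p = fst c else meet c' \<and> \<not> ahead c' \<and> p = fst c')"

lemma pass_cases:
  assumes "pass E (c, x) = Some ((c2, y), w)"
  obtains "climb E c = Some c2" "proper c" "proper c2" "\<And>m p. \<not> apex m c c2 p" "y = x" "w = []"
  | c' m p p' S m' where "climb E c = Some c'" "proper c" "proper c'" "apex m c c' p"
      "map_of E p = Some (p', S)" "visit S m x = Some ((m', y), w)"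
      "c2 = (if m' = m then c' else reverse c)"
proof -
  from assms obtain c' where c: "climb E c = Some c'" "proper c" "proper c'"
    by (auto simp: pass_def split: option.splits if_splits)
  consider (A) "meet c" "ahead c" "cross E (fst c) True c c' x = Some ((c2, y), w)"
    | (B) "\<not> (meet c \<and> ahead c)" "meet c'" "\<not> ahead c'"
      "cross E (fst c') False c c' x = Some ((c2, y), w)"
    | (C) "\<not> (meet c \<and> ahead c)" "\<not> (meet c' \<and> \<not> ahead c')" "c' = c2" "y = x" "w = []"
    using assms c by (auto simp: pass_def split: if_splits)
  then show ?thesis
  proof cases
    case A
    from cross_cases[OF A(3)] that(2)[OF c, of True "fst c"] A(1,2) show ?thesis
      by (auto simp: apex_def)
  next
    case B
    from cross_cases[OF B(4)] that(2)[OF c, of False "fst c'"] B(2,3) show ?thesis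
      by (auto simp: apex_def)
  next
    case C
    then show ?thesis using that(1) c by (auto simp: apex_def)
  qed
qed

lemma apex_unique:
  assumes "distinct (map fst E)" "climb E c = Some c'" "apex m c c' p" "apex n c c' q"
  shows "m = n \<and> p = q"
  using assms climb_meet[OF assms(1,2)] by (auto simp: apex_def split: if_splits)

lemma apex_reverse: "apex m (reverse c') (reverse c) p \<longleftrightarrow> apex (\<not> m) c c' p"
  by (auto simp: apex_def)

text \<open>A step either continues or is reflected. Two preimages of the same kind have equal
  pairings, by \<open>climb_back\<close> or by injectivity of \<open>reverse\<close>, and
  \<open>visit_inject\<close> gives the variable. Preimages of different kinds take the same climb
  step from opposite ends, so their flags differ, although a common target of \<open>visit\<close>
  forces a common flag.\<close>

lemma pass_inject:
  assumes E: "edges_ok E" and 1: "pass E (c, x) = Some ((c2, y), w)"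
    and 2: "pass E (d, x') = Some ((c2, y), w')"
  shows "c = d \<and> x = x'"
proof -
  have dist: "distinct (map fst E)" using E by (simp add: edges_ok_def)
  note undo = climb_back[OF dist]
  have vis: "m = n \<and> u = u'"
    if "map_of E p = Some (p', S)" "visit S m u = Some (t, v)" "map_of E p = Some (q', S')"
      "visit S' n u' = Some (t, v')"
    for p p' q' S S' m n u u' t v v'
    using visit_inject[of S m u t v n u' v'] that map_of_SomeD[OF that(1)] E
    by (auto simp: edges_ok_def)
  define K where "K c c' x w \<longleftrightarrow> climb E c = Some c' \<and>
      ((\<forall>m p. \<not> apex m c c' p) \<and> y = x \<and> c2 = c' \<or>
       (\<exists>m p p' S m'. apex m c c' p \<and> map_of E p = Some (p', S) \<and>
          visit S m x = Some ((m', y), w) \<and> c2 = (if m' = m then c' else reverse c)))"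
    for c c' x and w :: "nat list"
  have norm: "\<exists>c'. K c c' x w" if "pass E (c, x) = Some ((c2, y), w)" for c x w
    using that unfolding K_def by (elim pass_cases) blast+
  have same: "x = x'" if k: "K c c' x w" "K c c' x' w'" for c c' x x' w w'
  proof (cases "\<exists>m p. apex m c c' p")
    case True
    then obtain m p p' S m' n q q' S' n' where *: "climb E c = Some c'"
      "apex m c c' p" "map_of E p = Some (p', S)" "visit S m x = Some ((m', y), w)"
      "c2 = (if m' = m then c' else reverse c)"
      "apex n c c' q" "map_of E q = Some (q', S')" "visit S' n x' = Some ((n', y), w')"
      "c2 = (if n' = n then c' else reverse c)"
      using k unfolding K_def by blast
    then have "m = n" "p = q" using apex_unique[OF dist *(1,2,6)] by auto
    moreover have "m' = n'"
      using *(1,5,9) climb_ne_reverse[of E c] \<open>m = n\<close> by (auto split: if_splits)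
    ultimately show ?thesis using vis *(3,4,7,8) by blast
  qed (use k in \<open>auto simp: K_def\<close>)
  have opposite: False if k: "K c c2 x w" "K (reverse c2) (reverse c) x' w'" for c x x' w w'
  proof -
    have cl: "climb E c = Some c2" using k by (simp add: K_def)
    then have ne: "c2 \<noteq> reverse c" using climb_ne_reverse[of E c] by auto
    from k(2) ne obtain n q q' S' n' where n: "apex (\<not> n) c c2 q" "map_of E q = Some (q', S')"
      "visit S' n x' = Some ((n', y), w')" "n' \<noteq> n"
      by (auto simp: K_def apex_reverse split: if_splits)
    with k(1) ne obtain m p p' S where m: "apex m c c2 p" "map_of E p = Some (p', S)"
      "visit S m x = Some ((m, y), w)"
      by (auto simp: K_def split: if_splits)
    have "m = (\<not> n)" "p = q" using apex_unique[OF dist cl m(1) n(1)] by auto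
    with m n vis[of p p' S m x "(m, y)" w q' S' n x' w'] show False by auto
  qed
  obtain c' d' where c: "K c c' x w" and d: "K d d' x' w'" using norm 1 2 by blast
  then have cl: "climb E c = Some c'" "climb E d = Some d'"
    and "c2 = c' \<or> c2 = reverse c" "c2 = d' \<or> c2 = reverse d"
    by (auto simp: K_def split: if_splits)
  then consider "c2 = c'" "c2 = d'" | "c2 = reverse c" "c2 = reverse d"
    | "c2 = c'" "c2 = reverse d" | "c2 = reverse c" "c2 = d'" by blast
  then show ?thesis
  proof cases
    case 1
    then have "c = d" using undo[OF cl(1)] undo[OF cl(2)] by simp
    then show ?thesis using same c d cl by auto
  next
    case 2
    then have "c = d" by simp
    then show ?thesis using same c d cl by auto
  next
    case 3
    then have "d = reverse c'" "d' = reverse c" using undo[OF cl(1)] cl(2) by auto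
    then show ?thesis using opposite[of c x w x' w'] c d 3 by auto
  next
    case 4
    then have "c = reverse d'" "c' = reverse d" using undo[OF cl(2)] cl(1) by auto
    then show ?thesis using opposite[of d x' w' x w] c d 4 by auto
  qed
qed

lemma touring_iff: "touring z t \<longleftrightarrow> (\<exists>f p. t = tour z f p)"
  by (auto simp: touring_def tour_def split: prod.splits)

lemma tour_inject: "tour z f p = tour z f' p' \<longleftrightarrow> f = f' \<and> p = p'"
  by (auto simp: tour_def)

lemma not_proper_tour: "\<not> proper (fst (tour z f p))"
  by (auto simp: tour_def proper_def)

lemma next_track_tour:
  "next_track z r k E (tour z f p) = (if k = 1 \<and> \<not> f then None else
     case walk E f f p of None \<Rightarrow> None
     | Some (Inl p') \<Rightarrow> Some (tour z (\<not> f) p', [])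
     | Some (Inr p') \<Rightarrow> if k = 1 then pass E (summit z r False) else Some (tour z f p', []))"
proof -
  have "touring z (tour z f p)" "ahead (fst (tour z f p)) = f" "fst (fst (tour z f p)) = p"
    by (auto simp: touring_iff ahead_def tour_def)
  then show ?thesis by (simp add: next_track_def Let_def split: option.split sum.split)
qed

text \<open>The guards serve the endmarkers: a forward track on the left one would violate the
  uniqueness of the initial state, a backward track on the right one could share its successor with
  the end of the tour, and the last guard admits only the final state as a forward target on the
  right one.\<close>

lemma next_track_other:
  "\<not> touring z t \<Longrightarrow> next_track z r k E t =
     (if k = 0 \<and> ahead (fst t) \<or> k = 1 \<and> \<not> ahead (fst t) then None
      else case pass E t of None \<Rightarrow> None | Some u \<Rightarrow>
        if k = 1 \<and> ahead (fst (fst u)) \<and> snd (fst u) \<noteq> z then None else Some u)"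
  by (simp add: next_track_def Let_def)

lemma pass_proper: "pass E t = Some (u, w) \<Longrightarrow> proper (fst u)"
  by (cases t; cases u) (auto elim!: pass_cases)

lemma proper_summit [simp]: "proper (fst (summit z r f))" and ahead_summit [simp]: "ahead (fst (summit z r f)) = f"
  by (auto simp: summit_def proper_def ahead_def)

lemma next_track_cases:
  assumes "next_track z r k E t = Some (u, w)"
  obtains f p p' where "t = tour z f p" "u = tour z (\<not> f) p'" "w = []" "walk E f f p = Some (Inl p')"
      "k = 1 \<longrightarrow> f"
  | f p p' where "t = tour z f p" "u = tour z f p'" "w = []" "walk E f f p = Some (Inr p')" "k \<noteq> 1"
  | p p' where "k = 1" "t = tour z True p" "walk E True True p = Some (Inr p')"
      "pass E (summit z r False) = Some (u, w)"
  | "\<not> touring z t" "pass E t = Some (u, w)" "\<not> (k = 0 \<and> ahead (fst t))"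
      "\<not> (k = 1 \<and> \<not> ahead (fst t))" "\<not> (k = 1 \<and> ahead (fst u) \<and> snd u \<noteq> z)"
proof (cases "touring z t")
  case True
  then obtain f p where t: "t = tour z f p" by (auto simp: touring_iff)
  with assms show ?thesis using that(1)[of f p] that(2)[of f p] that(3)[of p]
    by (auto simp: next_track_tour split: option.splits sum.splits if_splits)
next
  case False
  with assms show ?thesis using that(4)
    by (auto simp: next_track_other split: option.splits if_splits)
qed

text \<open>Results of \<open>pass\<close> are proper and touring tracks are not, so the two kinds
  of targets never mix. A tour step is undone by walking on the same side in the opposite direction.
  At its end the node is recovered as the outermost left child of \<open>r\<close>.\<close>

lemma next_track_inject:
  assumes E: "edges_ok E" and r: "k = 1 \<Longrightarrow> (\<And>p p'. parent E p = Some p' \<Longrightarrow> p' = r)"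
    and 1: "next_track z r k E t = Some (u, w)" and 2: "next_track z r k E t' = Some (u, w')"
  shows "t = t'"
proof -
  have dist: "distinct (map fst E)" using E by (simp add: edges_ok_def)
  have inj: "pass E t = Some (u, w) \<Longrightarrow> pass E t' = Some (u, w') \<Longrightarrow> t = t'" for t t' w w'
    using pass_inject[OF E] by (cases t; cases t'; cases u) auto
  have tour_pass: False if "pass E t = Some (tour z f p, w)" for t f p w
    using pass_proper[OF that] not_proper_tour by blast
  have last: "walk E False True r = Some (Inr p)" if "walk E True True p = Some (Inr p')" "k = 1" for p p'
    using walk_move_back[OF dist that(1)] that r by (auto simp: walk_up_move[OF dist])
  define A where "A t \<longleftrightarrow> (\<exists>f p p'. u = tour z f p \<and>
    (walk E (\<not> f) f p = Some (Inl p') \<and> t = tour z (\<not> f) p' \<or>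
     walk E (\<not> f) f p = Some (Inr p') \<and> t = tour z f p'))" for t
  have A: "A t \<or> (\<exists>w s. pass E s = Some (u, w) \<and>
      (k = 1 \<and> (\<exists>p p'. t = tour z True p \<and> walk E True True p = Some (Inr p')) \<and> s = summit z r False \<or>
       \<not> (k = 1 \<and> \<not> ahead (fst t)) \<and> s = t))"
    if "next_track z r k E t = Some (u, w)" for t w
    using that
  proof (cases rule: next_track_cases)
    case (1 f p p')
    then show ?thesis using walk_turn_back[OF dist 1(4)] unfolding A_def
      by (intro disjI1 exI[of _ "\<not> f"] exI[of _ p'] exI[of _ p]) auto
  next
    case (2 f p p')
    then show ?thesis using walk_move_back[OF dist 2(4)] unfolding A_def
      by (intro disjI1 exI[of _ f] exI[of _ p'] exI[of _ p]) auto
  qed blast+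
  have AA: "t = t'" if "A t" "A t'" for t t'
    using that by (auto simp: A_def tour_inject)
  have AP: False if "A t" "pass E s = Some (u, w)" for t s w
    using that tour_pass[of s] unfolding A_def by blast
  show ?thesis
  proof (cases "A t \<or> A t'")
    case True
    then show ?thesis using A[OF 1] A[OF 2] AA AP by blast
  next
    case False
    with A[OF 1] A[OF 2] obtain w1 s1 w2 s2 where s: "pass E s1 = Some (u, w1)" "pass E s2 = Some (u, w2)"
      "k = 1 \<and> (\<exists>p p'. t = tour z True p \<and> walk E True True p = Some (Inr p')) \<and> s1 = summit z r False \<or>
       \<not> (k = 1 \<and> \<not> ahead (fst t)) \<and> s1 = t"
      "k = 1 \<and> (\<exists>p p'. t' = tour z True p \<and> walk E True True p = Some (Inr p')) \<and> s2 = summit z r False \<or>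
       \<not> (k = 1 \<and> \<not> ahead (fst t')) \<and> s2 = t'"
      by blast
    have eq: "s1 = s2" using inj[OF s(1,2)] .
    from s(3) show ?thesis
    proof (elim disjE conjE exE)
      fix p p' assume a: "k = 1" "t = tour z True p" "walk E True True p = Some (Inr p')"
        "s1 = summit z r False"
      from s(4) show ?thesis
      proof (elim disjE conjE exE)
        fix q q' assume "t' = tour z True q" "walk E True True q = Some (Inr q')"
        then show ?thesis using last[OF a(3,1)] last[of q q', OF _ a(1)] a(2) by simp
      next
        assume "\<not> (k = 1 \<and> \<not> ahead (fst t'))" "s2 = t'"
        then show ?thesis using a eq by auto
      qed
    next
      assume a: "\<not> (k = 1 \<and> \<not> ahead (fst t))" "s1 = t"
      from s(4) show ?thesis
      proof (elim disjE conjE exE)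
        assume "k = 1" "s2 = summit z r False"
        then show ?thesis using a eq by auto
      next
        assume "s2 = t'"
        then show ?thesis using a eq by simp
      qed
    qed
  qed
qed

section \<open>The transducer\<close>

lemma step_deterministic:
  assumes "is_fa2 M" "deterministic M" "step M c t c'" "step M c t' c''"
  shows "t = t' \<and> c' = c''"
proof -
  have d: "fwd M \<inter> bwd M = {}" using assms(1) by (simp add: is_fa2_def)
  have e: "q = q'" if "(p, a, q) \<in> delta M" "(p, a, q') \<in> delta M" for p a q q'
    using that assms(2) unfolding deterministic_def by blast
  show ?thesis
    using assms(3,4) d by (auto elim!: step.cases dest: e)
qed

lemma run_deterministic:
  assumes M: "is_fa2 M" "deterministic M" and "run M w c ts d" "run M w c ts' d"
    and "\<And>t c'. \<not> step M d t c'"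
  shows "ts = ts'"
  using assms(3,4,5)
proof (induction arbitrary: ts')
  case (run_refl u u' p)
  from run_refl.prems(1) show ?case
  proof cases
    case (run_step t c' ts)
    then show ?thesis using run_refl.prems(2) by blast
  qed simp
next
  case (run_step c t c' ts c'')
  note hyp = run_step.hyps(1) and IH = run_step.IH and prems = run_step.prems
  from run_step.prems(1) show ?case
  proof cases
    case run_refl
    then show ?thesis using prems(2) hyp by blast
  next
    case (run_step t' c2 ts2)
    then have "t = t'" "c' = c2" using step_deterministic[OF M hyp] by auto
    then show ?thesis using run_step(1,3) IH prems(2) by blast
  qed
qed

text \<open>The final state is a forward state with nothing to its right, so no accepting run is a
  proper prefix of another.\<close>

lemma accepting_run_unique:
  assumes "is_fa2 M" "deterministic M" "accepting_run M w ts" "accepting_run M w ts'"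
  shows "ts = ts'"
proof (rule run_deterministic[OF assms(1,2)])
  show "\<not> step M (w, q_final M, []) t c'" for t c'
    using assms(1) by (auto simp: is_fa2_def elim!: step.cases)
qed (use assms in \<open>auto simp: accepting_run_def\<close>)

text \<open>A repetition could be pulled back along the injective \<open>f\<close> to a return to
  \<open>a\<close>, which has no preimage in \<open>S\<close>. So the orbit is injective while it
  stays in \<open>S\<close>, and finiteness forces it out.\<close>

lemma orbit_exit:
  assumes "finite S" "inj_on f S" "a \<in> S" "a \<notin> f ` S"
  obtains m where "(f ^^ m) a \<notin> S" "\<And>l. l < m \<Longrightarrow> (f ^^ l) a \<in> S"
    "inj_on (\<lambda>l. (f ^^ l) a) {..m}"
proof -
  have inj: "inj_on (\<lambda>l. (f ^^ l) a) {..m}" if S: "\<And>l. l < m \<Longrightarrow> (f ^^ l) a \<in> S" for m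
  proof -
    have "(f ^^ l) a \<noteq> (f ^^ (l + d)) a" if "0 < d" "l + d \<le> m" for l d
      using that
    proof (induction l)
      case 0
      then obtain d' where "d = Suc d'" by (cases d) auto
      then show ?case using S[of d'] 0 assms(4) by auto
    next
      case (Suc l)
      then have "(f ^^ l) a \<in> S" "(f ^^ (l + d)) a \<in> S" using S by auto
      then show ?case using Suc inj_onD[OF assms(2)] by fastforce
    qed
    then show ?thesis
      by (intro linorder_inj_onI) (auto, metis add_diff_inverse_nat less_imp_not_less zero_less_diff)
  qed
  have "\<exists>m. (f ^^ m) a \<notin> S"
  proof (rule ccontr)
    assume "\<not> ?thesis"
    then have S: "(f ^^ l) a \<in> S" for l by blast
    have "card {..card S} \<le> card S"
      using card_inj_on_le[OF inj[OF S, of "card S"] _ assms(1)] S by auto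
    then show False by simp
  qed
  then have "(f ^^ (LEAST m. (f ^^ m) a \<notin> S)) a \<notin> S" by (rule LeastI_ex)
  moreover have "(f ^^ l) a \<in> S" if "l < (LEAST m. (f ^^ m) a \<notin> S)" for l
    using not_less_Least[OF that] by simp
  ultimately show thesis using that inj by blast
qed

text \<open>What the construction needs to know of a coded SST. \<open>Q\<close> and
  \<open>X\<close> are the codes of states and variables, \<open>C\<close> those of the output
  letters, which \<open>dB\<close> decodes; \<open>E_LEnd\<close> and \<open>E_REnd\<close> are the
  endmarker conventions.\<close>

locale machine =
  fixes A :: "'a set" and E :: "'a sym \<Rightarrow> edges" and k :: "'a sym \<Rightarrow> nat" and Q X :: "nat set"
    and i r z :: nat and dB :: "nat \<Rightarrow> 'b" and B :: "'b set" and C :: "nat set"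
  assumes fin: "finite A" "finite Q" "finite X" "finite B"
    and kind: "k LEnd = 0" "k REnd = 1" "\<And>a. k (Letter a) \<noteq> 0" "\<And>a. k (Letter a) \<noteq> 1"
    and E_ok: "\<And>a. a \<in> marked A \<Longrightarrow> edges_ok (E a)"
    and E_states: "\<And>a p p' S. a \<in> marked A \<Longrightarrow> (p, p', S) \<in> set (E a) \<Longrightarrow> p \<in> Q \<and> p' \<in> Q"
    and E_vars: "\<And>a p p' S. a \<in> marked A \<Longrightarrow> (p, p', S) \<in> set (E a) \<Longrightarrow> fst ` set S = X"
    and E_subst: "\<And>a p p' S y l. a \<in> marked A \<Longrightarrow> (p, p', S) \<in> set (E a) \<Longrightarrow> (y, l) \<in> set S \<Longrightarrow>
      set l \<subseteq> X <+> C"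
    and E_LEnd: "\<And>p p' S. (p, p', S) \<in> set (E LEnd) \<Longrightarrow> p = i"
    and E_REnd: "\<And>p p' S. (p, p', S) \<in> set (E REnd) \<Longrightarrow> p' = r"
    and E_erased: "\<And>p p' S y l x. (p, p', S) \<in> set (E LEnd) \<Longrightarrow> (y, l) \<in> set S \<Longrightarrow> Inl x \<notin> set l"
    and letters: "dB ` C \<subseteq> B"
    and distinguished: "i \<in> Q" "r \<in> Q" "z \<in> X"
begin

definition Tr :: "track set" where
  "Tr = {((p, q, s, s', f), x) | p q s s' f x. p \<in> Q \<and> q \<in> Q \<and> x \<in> X}"

definition nt :: "'a sym \<Rightarrow> track \<Rightarrow> (track \<times> nat list) option" where
  "nt a = next_track z r (k a) (E a)"

text \<open>The states are the codes of tracks, so \<open>id\<close> can name them; the output is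
  found from the source state and the symbol alone.\<close>

definition T :: "('a, nat, 'b) ft2" where
  "T = \<lparr> in_alph = A, fwd = enc ` {t \<in> Tr. ahead (fst t)}, bwd = enc ` {t \<in> Tr. \<not> ahead (fst t)},
     q_init = enc (tour z True i), q_final = enc (summit z r True),
     delta = {(enc t, a, enc u) | t a u. a \<in> marked A \<and> t \<in> Tr \<and> (\<exists>v. nt a t = Some (u, v))},
     out_alph = B,
     out = (\<lambda>(p, a, q). map dB (snd (the (nt a (inv enc p))))) \<rparr>"

lemma inv_enc [simp]: "inv enc (enc t) = t"
  by (simp add: inv_f_f inj_enc)

lemma dist: "a \<in> marked A \<Longrightarrow> distinct (map fst (E a))"
  using E_ok by (auto simp: edges_ok_def)

lemma parentE:
  assumes "a \<in> marked A" "parent (E a) p = Some p'"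
  obtains S where "map_of (E a) p = Some (p', S)" "(p, p', S) \<in> set (E a)" "p \<in> Q" "p' \<in> Q"
  using assms E_states map_of_SomeD by (fastforce simp: parent_def)

lemma parent_states: "a \<in> marked A \<Longrightarrow> parent (E a) p = Some p' \<Longrightarrow> p \<in> Q \<and> p' \<in> Q"
  by (auto elim: parentE)

lemma parent_LEnd: "parent (E LEnd) p = Some p' \<Longrightarrow> p = i"
  and parent_REnd: "parent (E REnd) p = Some p' \<Longrightarrow> p' = r"
  using E_LEnd E_REnd by (auto simp: parent_def dest!: map_of_SomeD)

lemma LEnd_marked: "LEnd \<in> marked A" and REnd_marked: "REnd \<in> marked A"
  by (auto simp: marked_def)

lemma kind_iff: "k a = 0 \<longleftrightarrow> a = LEnd" "k a = Suc 0 \<longleftrightarrow> a = REnd"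
  using kind by (cases a; auto)+

lemma walk_states:
  assumes "a \<in> marked A" "p \<in> Q" "walk (E a) f s p = Some u"
  shows "case u of Inl c \<Rightarrow> c \<in> Q | Inr c \<Rightarrow> c \<in> Q"
proof (cases u)
  case (Inl c)
  then show ?thesis using assms
    by (cases f) (auto simp: walk_up_turn[OF dist] walk_down_turn[OF dist] closest_def dest: parent_states[OF assms(1)])
next
  case (Inr c)
  then show ?thesis using assms
    by (cases f) (auto simp: walk_up_move[OF dist] walk_down_move[OF dist] closest_def dest: parent_states[OF assms(1)])
qed

lemma climb_states:
  assumes "a \<in> marked A" "climb (E a) c = Some c'" "(c, x) \<in> Tr"
  shows "(c', x) \<in> Tr"
proof -
  obtain p q s s' f where c: "c = (p, q, s, s', f)" by (cases c)
  then show ?thesis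
    using assms walk_states[OF assms(1)] unfolding c climb_iff by (fastforce simp: Tr_def)
qed

lemma reverse_Tr [simp]: "(reverse c, x) \<in> Tr \<longleftrightarrow> (c, x) \<in> Tr"
  by (auto simp: reverse_def Tr_def split: prod.splits)

lemma visit_vars:
  assumes "a \<in> marked A" "map_of (E a) p = Some (p', S)" "visit S m x = Some ((m', y), v)"
  shows "y \<in> X \<and> set v \<subseteq> C"
proof -
  have S: "(p, p', S) \<in> set (E a)" using assms(2) by (rule map_of_SomeD)
  from assms(3) obtain u b l where *: "(u, b @ map Inr v @ l) \<in> set S"
    "(m', y) = (True, u) \<and> l = [] \<or> (\<exists>z l'. (m', y) = (False, z) \<and> l = Inl z # l')"
    by (rule visit_split)
  then have "u \<in> X" using E_vars[OF assms(1) S] by force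
  with * E_subst[OF assms(1) S *(1)] show ?thesis by auto
qed

lemma pass_states:
  assumes "a \<in> marked A" "pass (E a) t = Some (u, v)" "t \<in> Tr"
  shows "u \<in> Tr \<and> set v \<subseteq> C"
proof -
  have *: "(d, y) \<in> Tr" if "(d, x) \<in> Tr" "y \<in> X" for d x y using that by (auto simp: Tr_def)
  obtain c x c2 y where t: "t = (c, x)" "u = (c2, y)" by (cases t, cases u)
  from assms(2)[unfolded t] show ?thesis
  proof (cases rule: pass_cases)
    case 1
    then show ?thesis using climb_states[OF assms(1)] assms(3) t by auto
  next
    case (2 c' m p p' S m')
    have "(c', x) \<in> Tr" using climb_states[OF assms(1) 2(1)] assms(3) t by auto
    then show ?thesis using 2 visit_vars[OF assms(1) 2(5,6)] assms(3) t by (auto intro: *)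
  qed
qed

lemma tour_Tr [simp]: "tour z f p \<in> Tr \<longleftrightarrow> p \<in> Q"
  using distinguished by (auto simp: Tr_def tour_def)

lemma summit_Tr [simp]: "summit z r f \<in> Tr"
  using distinguished by (auto simp: Tr_def summit_def)

lemma nt_states:
  assumes "a \<in> marked A" "nt a t = Some (u, v)" "t \<in> Tr"
  shows "u \<in> Tr \<and> set v \<subseteq> C"
  using assms(2) unfolding nt_def
proof (cases rule: next_track_cases)
  case (1 f p p')
  then show ?thesis using walk_states[OF assms(1) _ 1(4)] assms(3) by auto
next
  case (2 f p p')
  then show ?thesis using walk_states[OF assms(1) _ 2(4)] assms(3) by auto
qed (use pass_states[OF assms(1)] assms(3) in auto)

lemma finite_Tr: "finite Tr"
proof (rule finite_subset)
  show "Tr \<subseteq> (Q \<times> Q \<times> UNIV \<times> UNIV \<times> UNIV) \<times> X" by (auto simp: Tr_def)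
qed (use fin in \<open>intro finite_cartesian_product finite\<close>)

lemma states_T: "states T = enc ` Tr"
  by (auto simp: states_def T_def)

lemma card_states_T: "card (states T) = 8 * card X * (card Q)\<^sup>2"
proof -
  have "Tr = (Q \<times> Q \<times> UNIV \<times> UNIV \<times> UNIV) \<times> X" by (auto simp: Tr_def)
  then have "card Tr = 8 * card X * (card Q)\<^sup>2"
    by (simp add: card_cartesian_product power2_eq_square del: UNIV_Times_UNIV)
  then show ?thesis by (simp add: states_T card_image inj_enc)
qed

lemma delta_T: "(p, a, q) \<in> delta T \<longleftrightarrow>
    a \<in> marked A \<and> (\<exists>t u v. p = enc t \<and> q = enc u \<and> t \<in> Tr \<and> nt a t = Some (u, v))"
  by (simp add: T_def) blast

lemma fwd_T: "enc t \<in> fwd T \<longleftrightarrow> t \<in> Tr \<and> ahead (fst t)"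
  and bwd_T: "enc t \<in> bwd T \<longleftrightarrow> t \<in> Tr \<and> \<not> ahead (fst t)"
  by (auto simp: T_def enc_eq_iff)

lemma ahead_tour [simp]: "ahead (fst (tour z f p)) = f"
  by (simp add: ahead_def tour_def)

lemma nt_LEnd:
  assumes "nt LEnd t = Some (u, v)" "ahead (fst t)" shows "t = tour z True i"
  using assms(1) unfolding nt_def
proof (cases rule: next_track_cases)
  case (1 f p p')
  then show ?thesis using assms(2) parent_LEnd
    by (auto simp: walk_up_turn[OF dist[OF LEnd_marked]])
next
  case (2 f p p')
  then show ?thesis using assms(2) parent_LEnd
    by (auto simp: walk_up_move[OF dist[OF LEnd_marked]])
qed (use assms(2) kind in auto)

text \<open>Both tokens move to \<open>r\<close>, the only parent on the right endmarker, and
  properness then fixes their sides.\<close>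

lemma pass_REnd:
  assumes "pass (E REnd) t = Some (u, v)" "ahead (fst t)" "ahead (fst u)"
  shows "fst u = (r, r, True, False, True)"
proof -
  obtain c x c2 y where t: "t = (c, x)" "u = (c2, y)" by (cases t, cases u)
  obtain p q s s' f where c: "c = (p, q, s, s', f)" by (cases c)
  have f: f using assms(2) t c by (simp add: ahead_def)
  have c2: "climb (E REnd) c = Some c2" "proper c2"
    using assms(1) unfolding t
    by (elim pass_cases; use assms(2,3) t in \<open>auto split: if_splits\<close>)+
  obtain p' q' where *: "walk (E REnd) True s p = Some (Inr p')" "walk (E REnd) True s' q = Some (Inr q')"
      "c2 = (p', q', s, s', True)"
    using c2(1) f assms(3) unfolding t c climb_iff by (auto simp: ahead_def)
  then have "p' = r" "q' = r"
    using parent_REnd unfolding walk_up_move[OF dist[OF REnd_marked]] by blast+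
  then show ?thesis using c2(2) * t by (simp add: proper_def)
qed

text \<open>The head could go forward only after a turn, and a downward turn changes the side but
  not the node: both tokens would share \<open>r\<close> on improper sides.\<close>

lemma climb_summit:
  assumes "climb (E REnd) (r, r, True, False, False) = Some c" "proper c" shows "\<not> ahead c"
  using assms by (auto simp: climb_iff walk_down_turn[OF dist[OF REnd_marked]] proper_def ahead_def)

lemma nt_REnd:
  assumes "nt REnd t = Some (u, v)" "ahead (fst u)" shows "u = summit z r True"
  using assms(1) unfolding nt_def
proof (cases rule: next_track_cases)
  case (3 p p')
  obtain c2 y where u: "u = (c2, y)" by (cases u)
  let ?c = "(r, r, True, False, False)"
  have "k REnd = 1" using kind by simp
  with 3(4) have "pass (E REnd) (?c, z) = Some ((c2, y), v)"
    by (simp add: u summit_def)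
  then show ?thesis
  proof (cases rule: pass_cases)
    case 1
    then show ?thesis using climb_summit assms(2) u by auto
  next
    case (2 c' m p p' S m')
    have m: "\<not> m" using 2(4) by (auto simp: apex_def ahead_def)
    \<comment> \<open>Only reflection leads forward here; it happens when the update word of
      \<open>z\<close> contains no variable.\<close>
    have "c2 = reverse ?c" "m'"
      using 2(1,3,7) m climb_summit[of c'] assms(2) u by (auto split: if_splits)
    moreover from this have "y = z"
      using visit_split[OF 2(6)] m by (metis Pair_inject)
    ultimately show ?thesis by (simp add: u summit_def reverse_def)
  qed
next
  case 4
  then show ?thesis using pass_REnd[OF 4(2)] assms(2) kind by (auto simp: summit_def prod_eq_iff)
qed (use assms(2) kind in auto)

lemma is_fa2_T: "is_fa2 T"
  unfolding is_fa2_def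
proof (intro conjI allI impI)
  show "delta T \<subseteq> states T \<times> marked (in_alph T) \<times> states T"
    using nt_states by (auto simp: delta_T states_T) (auto simp: T_def)
  show "p = q_init T" if "(p, LEnd, q) \<in> delta T" "p \<in> fwd T" for p q
    using that nt_LEnd by (auto simp: delta_T fwd_T) (auto simp: T_def)
  show "p = q_final T" if "(q, REnd, p) \<in> delta T" "p \<in> fwd T" for p q
    using that nt_REnd by (auto simp: delta_T fwd_T) (auto simp: T_def)
qed (use fin finite_Tr distinguished in \<open>auto simp: T_def enc_eq_iff\<close>)

lemma out_T: "nt a t = Some (u, v) \<Longrightarrow> out T (enc t, a, q) = map dB v"
  by (simp add: T_def)

lemma is_ft2_T: "is_ft2 T"
  unfolding is_ft2_def
proof (intro conjI ballI)
  show "out T t \<in> lists (out_alph T)" if "t \<in> delta T" for t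
  proof -
    obtain p a q where t: "t = (p, a, q)" by (cases t)
    have "(p, a, q) \<in> delta T" using that t by simp
    then obtain t' u v where *: "a \<in> marked A" "p = enc t'" "t' \<in> Tr" "nt a t' = Some (u, v)"
      unfolding delta_T by blast
    then have "set v \<subseteq> C" using nt_states by blast
    then have "dB b \<in> B" if "b \<in> set v" for b using that letters by blast
    then show ?thesis using * out_T[OF *(4)] t by (auto simp: T_def)
  qed
qed (use is_fa2_T fin in \<open>auto simp: T_def\<close>)

lemma reversible_T: "reversible T"
  unfolding reversible_def deterministic_def codeterministic_def
proof (intro conjI allI impI)
  show "q = q'" if "(p, a, q) \<in> delta T" "(p, a, q') \<in> delta T" for p a q q'
    using that by (auto simp: delta_T enc_eq_iff)
  show "p = p'" if "(p, a, q) \<in> delta T" "(p', a, q) \<in> delta T" for p p' a q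
  proof -
    from that obtain t t' u v v' where *: "a \<in> marked A" "p = enc t" "p' = enc t'"
      "nt a t = Some (u, v)" "nt a t' = Some (u, v')"
      by (auto simp: delta_T enc_eq_iff)
    have "q' = r" if "k a = 1" "parent (E a) q = Some q'" for q q'
      using that kind_iff parent_REnd by auto
    then show ?thesis
      using next_track_inject[OF E_ok[OF *(1)] _ *(4,5)[unfolded nt_def]] *(2,3) by blast
  qed
qed

end

section \<open>Moves of the head and runs of the transducer\<close>

definition cell :: "bool \<Rightarrow> nat \<Rightarrow> nat" where
  "cell f j = (if f then j else Suc j)"

lemma cell_simps [simp]: "cell True j = j" "cell False j = Suc j"
  by (simp_all add: cell_def)

lemma cell_inject [simp]: "cell f j = cell f j' \<longleftrightarrow> j = j'"
  by (simp add: cell_def)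

inductive reaches :: "('c \<Rightarrow> 'd list \<Rightarrow> 'c \<Rightarrow> bool) \<Rightarrow> 'c \<Rightarrow> 'd list \<Rightarrow> 'c \<Rightarrow> bool" for R where
  refl: "reaches R b [] b"
| step: "R b v b' \<Longrightarrow> reaches R b' v' b'' \<Longrightarrow> reaches R b (v @ v') b''"

lemma reaches_trans: "reaches R b v b' \<Longrightarrow> reaches R b' v' b'' \<Longrightarrow> reaches R b (v @ v') b''"
  by (induction rule: reaches.induct) (auto intro: reaches.intros)

lemma reaches_single: "R b v b' \<Longrightarrow> reaches R b v b'"
  using reaches.step[OF _ reaches.refl] by fastforce

fun follow :: "(nat \<Rightarrow> 'a \<Rightarrow> nat option) \<Rightarrow> 'a list \<Rightarrow> nat \<Rightarrow> nat option" where
  "follow d [] p = Some p"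
| "follow d (a # w) p = Option.bind (d p a) (follow d w)"

lemma follow_path:
  assumes "follow d w p = Some q"
  shows "\<exists>\<rho>. \<rho> 0 = p \<and> \<rho> (length w) = q \<and> (\<forall>n < length w. d (\<rho> n) (w ! n) = Some (\<rho> (Suc n)))"
  using assms
proof (induction w arbitrary: p)
  case (Cons a w)
  then obtain p' where p': "d p a = Some p'" "follow d w p' = Some q"
    by (auto simp: bind_eq_Some_conv)
  then obtain \<rho> where "\<rho> 0 = p'" "\<rho> (length w) = q"
    "\<forall>n < length w. d (\<rho> n) (w ! n) = Some (\<rho> (Suc n))" using Cons.IH by blast
  with p' show ?case
    by (intro exI[of _ "case_nat p \<rho>"]) (auto simp: less_Suc_eq_0_disj)
qed auto

context machine
begin

text \<open>A head position \<open>n\<close> counts the letters to the left of the head. A head moving in direction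
  \<open>f\<close> that reads the letter of index \<open>j\<close> is at position \<open>cell f j\<close>, and it leaves that
  letter in direction \<open>f'\<close> at position \<open>cell (\<not> f') j\<close>.\<close>

definition move :: "'a sym list \<Rightarrow> nat \<times> track \<Rightarrow> nat list \<Rightarrow> nat \<times> track \<Rightarrow> bool" where
  "move w b v b' \<longleftrightarrow> (\<exists>j < length w. fst b = cell (ahead (fst (snd b))) j \<and>
     fst b' = cell (\<not> ahead (fst (snd b'))) j \<and> snd b \<in> Tr \<and> nt (w ! j) (snd b) = Some (snd b', v))"

definition conf :: "'a sym list \<Rightarrow> nat \<times> track \<Rightarrow> ('a, nat) config" where
  "conf w b = (take (fst b) w, enc (snd b), drop (fst b) w)"

lemma move_step:
  assumes w: "set w \<subseteq> marked A" and "move w b v b'"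
  obtains a where "step T (conf w b) (enc (snd b), a, enc (snd b')) (conf w b')"
    "out T (enc (snd b), a, enc (snd b')) = map dB v" "a \<in> marked A"
proof -
  obtain n t n' u where b: "b = (n, t)" "b' = (n', u)" by (cases b, cases b')
  obtain j where j: "j < length w" "n = cell (ahead (fst t)) j" "n' = cell (\<not> ahead (fst u)) j"
    "t \<in> Tr" "nt (w ! j) t = Some (u, v)"
    using assms(2) by (auto simp: move_def b)
  have a: "w ! j \<in> marked A" using w j(1) by auto
  have u: "u \<in> Tr" using nt_states[OF a j(5,4)] by simp
  have d: "(enc t, w ! j, enc u) \<in> delta T" using a j unfolding delta_T by blast
  have w_j: "take (Suc j) w = take j w @ [w ! j]" "drop j w = w ! j # drop (Suc j) w"
    using j(1) by (auto simp: take_Suc_conv_app_nth Cons_nth_drop_Suc)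
  have "step T (conf w b) (enc t, w ! j, enc u) (conf w b')"
    by (cases "ahead (fst t)"; cases "ahead (fst u)")
      (use d j(2-4) u in \<open>auto simp: conf_def b w_j fwd_T bwd_T intro!: step.intros\<close>)
  then show thesis using that out_T[OF j(5)] a b by simp
qed

lemma step_move:
  assumes "step T (conf w (n, t)) tr c'" "n \<le> length w"
  obtains v n' u where "move w (n, t) v (n', u)" "c' = conf w (n', u)" "n' \<le> length w"
proof -
  have ends: "\<exists>j < length w. n = j \<and> w ! j = a \<and> v' = drop (Suc j) w \<and> take n w @ [a] = take (Suc j) w"
    if "drop n w = a # v'" for a v'
  proof -
    have "n < length w" using that by (metis drop_all linorder_not_less list.distinct(1))
    then show ?thesis using that by (auto simp: take_Suc_conv_app_nth simp flip: Cons_nth_drop_Suc)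
  qed
  have begs: "\<exists>j < length w. n = Suc j \<and> w ! j = a \<and> v' = take j w \<and> a # drop n w = drop j w"
    if t: "take n w = v' @ [a]" for a v'
  proof -
    obtain j where n: "n = Suc j" using t by (cases n) auto
    then have j: "j < length w" using assms(2) by simp
    then show ?thesis using t n by (auto simp: take_Suc_conv_app_nth simp flip: Cons_nth_drop_Suc)
  qed
  have "\<exists>j < length w. \<exists>q. (enc t, w ! j, q) \<in> delta T \<and>
      (enc t \<in> fwd T \<and> n = j \<or> enc t \<in> bwd T \<and> n = Suc j) \<and>
      (q \<in> fwd T \<and> c' = (take (Suc j) w, q, drop (Suc j) w) \<or>
       q \<in> bwd T \<and> c' = (take j w, q, drop j w))"
    using assms(1) unfolding conf_def fst_conv snd_conv
  proof (cases rule: step.cases)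
    case (fwd_fwd a q v)
    then show ?thesis using ends[of a v] by auto
  next
    case (fwd_bwd a q v)
    then show ?thesis using ends[of a v] by auto
  next
    case (bwd_fwd a q v)
    then show ?thesis using begs[of v a] by auto
  next
    case (bwd_bwd a q v)
    then show ?thesis using begs[of v a] by auto
  qed
  then obtain j q where j: "j < length w" "(enc t, w ! j, q) \<in> delta T"
      "enc t \<in> fwd T \<and> n = j \<or> enc t \<in> bwd T \<and> n = Suc j"
      "q \<in> fwd T \<and> c' = (take (Suc j) w, q, drop (Suc j) w) \<or>
       q \<in> bwd T \<and> c' = (take j w, q, drop j w)"
    by blast
  then obtain u v where u: "q = enc u" "t \<in> Tr" "nt (w ! j) t = Some (u, v)"
    unfolding delta_T by (auto simp: enc_eq_iff)
  let ?n' = "cell (\<not> ahead (fst u)) j"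
  have "move w (n, t) v (?n', u)" "c' = conf w (?n', u)" "?n' \<le> length w"
    using j u by (auto simp: move_def conf_def fwd_T bwd_T cell_def)
  then show thesis using that by blast
qed

abbreviation "moves w \<equiv> reaches (move w)"

lemma moves_run:
  assumes "moves w b v b'" "set w \<subseteq> marked A" "snd b' \<in> Tr"
  shows "\<exists>ts. run T w (conf w b) ts (conf w b') \<and> concat (map (out T) ts) = map dB v"
  using assms
proof (induction)
  case (refl b)
  have "run T w (conf w b) [] (conf w b)"
    unfolding conf_def by (rule run_refl) (use refl states_T in \<open>auto simp: T_def\<close>)
  then show ?case by force
next
  case (step b v b' v' b'')
  then obtain ts where "run T w (conf w b') ts (conf w b'')" "concat (map (out T) ts) = map dB v'"
    by auto
  moreover obtain a where "step T (conf w b) (enc (snd b), a, enc (snd b')) (conf w b')"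
    "out T (enc (snd b), a, enc (snd b')) = map dB v"
    using move_step[OF step.prems(1) step.hyps(1)] .
  ultimately show ?case
    by (intro exI[of _ "(enc (snd b), a, enc (snd b')) # ts"]) (auto intro: run_step)
qed

abbreviation \<Delta> :: "nat \<Rightarrow> 'a sym \<Rightarrow> nat option" where
  "\<Delta> p a \<equiv> parent (E a) p"

text \<open>While the automaton is touring, the node it visits has the same root as the initial node, so
  if that root is not the accepting one the tour never ends.\<close>

lemma move_tour:
  assumes w: "set w \<subseteq> marked A" "\<And>j. j < length w \<Longrightarrow> w ! j = REnd \<Longrightarrow> Suc j = length w"
    and m: "move w (n, tour z f p) v (n', u)"
    and no: "follow \<Delta> (drop n w) p \<noteq> Some r"
  shows "\<exists>f' p'. u = tour z f' p' \<and> follow \<Delta> (drop n' w) p' = follow \<Delta> (drop n w) p"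
proof -
  obtain j where j: "j < length w" "n = cell f j" "n' = cell (\<not> ahead (fst u)) j"
    "nt (w ! j) (tour z f p) = Some (u, v)"
    using m by (auto simp: move_def)
  have a: "w ! j \<in> marked A" using w j(1) by auto
  note d = dist[OF a]
  have dr: "drop j w = w ! j # drop (Suc j) w" using j(1) by (simp add: Cons_nth_drop_Suc)
  from j(4) show ?thesis unfolding nt_def
  proof (cases rule: next_track_cases)
    case (1 f' q p')
    then have "f' = f" "q = p" by (auto simp: tour_inject)
    with 1 j have "follow \<Delta> (drop n' w) p' = follow \<Delta> (drop n w) p"
      by (cases f) (auto simp: dr walk_up_turn[OF d] walk_down_turn[OF d] closest_def)
    with 1 show ?thesis by blast
  next
    case (2 f' q p')
    then have "f' = f" "q = p" by (auto simp: tour_inject)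
    with 2 j have "follow \<Delta> (drop n' w) p' = follow \<Delta> (drop n w) p"
      by (cases f) (auto simp: dr walk_up_move[OF d] walk_down_move[OF d] closest_def)
    with 2 show ?thesis by blast
  next
    case (3 q p')
    then have "f" "q = p" by (auto simp: tour_inject)
    moreover have "w ! j = REnd" using 3(1) kind_iff by simp
    moreover from this have "Suc j = length w" using w(2) j(1) by blast
    ultimately have "follow \<Delta> (drop n w) p = Some p'"
      using 3(3) j(2) by (simp add: dr walk_up_move[OF dist[OF REnd_marked]])
    moreover have "p' = r" using 3(3) \<open>w ! j = REnd\<close> parent_REnd
      by (auto simp: walk_up_move[OF dist[OF REnd_marked]])
    ultimately show ?thesis using no by simp
  next
    case 4
    then show ?thesis by (auto simp: touring_iff)
  qed
qed

lemma run_tour: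
  assumes w: "set w \<subseteq> marked A" "\<And>j. j < length w \<Longrightarrow> w ! j = REnd \<Longrightarrow> Suc j = length w"
    and "run T w (conf w (n, tour z f p)) ts c" "n \<le> length w"
    and "follow \<Delta> (drop n w) p \<noteq> Some r"
  shows "\<exists>n' f' p'. c = conf w (n', tour z f' p')"
  using assms(3-5)
proof (induction "conf w (n, tour z f p)" ts c arbitrary: n f p rule: run.induct)
  case (run_refl u u' q)
  then show ?case by blast
next
  case (run_step t c' ts c'')
  obtain v n' u where m: "move w (n, tour z f p) v (n', u)" "c' = conf w (n', u)" "n' \<le> length w"
    using step_move[OF run_step.hyps(1) run_step.prems(1)] .
  then show ?case using run_step.hyps(3) run_step.prems(2) move_tour[OF w m(1)] by auto
qed

text \<open>With another root the run would never leave the touring tracks, and the summit is not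
  one of them.\<close>

lemma accepting_run_path:
  assumes w: "set w \<subseteq> marked A" "\<And>j. j < length w \<Longrightarrow> w ! j = REnd \<Longrightarrow> Suc j = length w"
    and acc: "accepting_run T w ts"
  shows "follow \<Delta> w i = Some r"
proof (rule ccontr)
  assume no: "follow \<Delta> w i \<noteq> Some r"
  have "run T w (conf w (0, tour z True i)) ts (w, enc (summit z r True), [])"
    using acc by (simp add: accepting_run_def conf_def T_def)
  from run_tour[OF w this] no obtain f p where "summit z r True = tour z f p"
    by (auto simp: conf_def enc_eq_iff)
  then show False by (auto simp: summit_def tour_def)
qed

end

section \<open>Runs along an accepting path\<close>

locale accepted = machine A E k Q X i r z dB B C
  for A :: "'a set" and E :: "'a sym \<Rightarrow> edges" and k :: "'a sym \<Rightarrow> nat" and Q X :: "nat set"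
    and i r z :: nat and dB :: "nat \<Rightarrow> 'b" and B :: "'b set" and C :: "nat set" +
  fixes w :: "'a sym list" and \<rho> :: "nat \<Rightarrow> nat"
  assumes w: "set w \<subseteq> marked A" "2 \<le> length w"
    and LEnd_iff: "\<And>j. j < length w \<Longrightarrow> w ! j = LEnd \<longleftrightarrow> j = 0"
    and REnd_iff: "\<And>j. j < length w \<Longrightarrow> w ! j = REnd \<longleftrightarrow> Suc j = length w"
    and path_ends: "\<rho> 0 = i" "\<rho> (length w) = r"
    and path_step: "\<And>n. n < length w \<Longrightarrow> parent (E (w ! n)) (\<rho> n) = Some (\<rho> (Suc n))"
begin

lemma letter: "j < length w \<Longrightarrow> w ! j \<in> marked A"
  using w by auto

lemma dist_w: "j < length w \<Longrightarrow> distinct (map fst (E (w ! j)))"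
  using dist letter by blast

lemma first_letter: "w ! 0 = LEnd"
  using LEnd_iff[of 0] w(2) by fastforce

lemma parent_first: "parent (E (w ! 0)) p = Some p' \<Longrightarrow> p = i"
  using parent_LEnd first_letter by simp

text \<open>\<open>off J s n p\<close>: following the transitions from \<open>p\<close> at position \<open>n\<close>, one joins the accepting
  path at a position at most \<open>J\<close>, and one joins it on the side \<open>s\<close>.\<close>

inductive off :: "nat \<Rightarrow> bool \<Rightarrow> nat \<Rightarrow> nat \<Rightarrow> bool" for J s where
  join: "n < J \<Longrightarrow> parent (E (w ! n)) p = Some (\<rho> (Suc n)) \<Longrightarrow> beyond s (\<rho> n) p \<Longrightarrow> off J s n p"
| follow: "n < J \<Longrightarrow> parent (E (w ! n)) p = Some p' \<Longrightarrow> off J s (Suc n) p' \<Longrightarrow> off J s n p"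

lemma off_less: "off J s n p \<Longrightarrow> n < J"
  by (erule off.cases) auto

text \<open>Joining happens at a sibling strictly beside the path, whereas parents of path nodes are
  path nodes.\<close>

lemma off_ne:
  assumes "off J s n p" "J \<le> length w" shows "p \<noteq> \<rho> n"
  using assms by induction (use path_step in fastforce)+

lemma off_side:
  assumes "off J True n p" "J \<le> length w" "off J False n p" shows False
  using assms
proof (induction)
  case (join n p)
  from join(5) show ?case
  proof cases
    case join
    then show ?thesis using \<open>beyond True (\<rho> n) p\<close> by (auto simp: beyond_def)
  next
    case (follow p')
    then show ?thesis using join(2) off_ne[OF follow(3) join(4)] by simp
  qed
next
  case outer: (follow n p p')
  from outer.prems(2) show ?case
  proof cases
    case join
    then show ?thesis using outer.hyps(2) off_ne[OF outer.hyps(3) outer.prems(1)] by simp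
  next
    case (follow p'')
    then show ?thesis using outer.hyps(2) outer.IH[OF outer.prems(1)] by simp
  qed
qed

text \<open>The outline of the part of the tree below level \<open>J\<close> on side
  \<open>b\<close> of the path. The path itself bounds this region and contributes only the
  \<open>b\<close> side of its edges.\<close>

definition inn :: "nat \<Rightarrow> bool \<Rightarrow> nat \<Rightarrow> nat \<Rightarrow> bool \<Rightarrow> bool" where
  "inn J b n p s \<longleftrightarrow> n \<le> J \<and> (off J b n p \<or> p = \<rho> n \<and> s = b)"

text \<open>A token cannot get across the path: turning towards it, it meets the path edge before
  any sibling behind it and stops on the \<open>b\<close> side.\<close>

lemma inn_walk:
  assumes J: "J \<le> length w" and j: "j < J" and p: "inn J b (cell f j) p s"
  obtains (turn) c where "walk (E (w ! j)) f s p = Some (Inl c)" "inn J b (cell f j) c (\<not> s)"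
  | (go) c where "walk (E (w ! j)) f s p = Some (Inr c)" "inn J b (cell (\<not> f) j) c s"
proof -
  have jw: "j < length w" using j J by simp
  note d = dist_w[OF jw]
  note up = walk_up_turn[OF d] walk_up_move[OF d]
  note down = walk_down_turn[OF d] walk_down_move[OF d]
  show thesis
  proof (cases f)
    case True
    have "\<exists>p'. parent (E (w ! j)) p = Some p'"
      using p True path_step[OF jw] by (auto simp: inn_def elim: off.cases)
    then have "walk (E (w ! j)) True s p \<noteq> None"
      by (auto simp: walk_def parent_def split: list.split option.split)
    then consider (T) c where "walk (E (w ! j)) True s p = Some (Inl c)"
      | (M) c where "walk (E (w ! j)) True s p = Some (Inr c)"
      by (metis not_Some_eq old.sum.exhaust)
    then show thesis
    proof cases
      case T
      then obtain p' where p': "parent (E (w ! j)) p = Some p'" "parent (E (w ! j)) c = Some p'"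
        "beyond s p c" "\<And>d. parent (E (w ! j)) d = Some p' \<Longrightarrow> beyond s p d \<Longrightarrow> d = c \<or> beyond s c d"
        by (auto simp: up closest_def)
      have "inn J b j c (\<not> s)"
      proof (cases "p = \<rho> j \<and> s = b")
        case True
        then show ?thesis using p' path_step[OF jw] j by (auto simp: inn_def intro: off.join)
      next
        case False
        then have "off J b j p" using p \<open>f\<close> by (auto simp: inn_def)
        then show ?thesis
        proof cases
          case join
          then have p'_eq: "p' = \<rho> (Suc j)" using p'(1) by simp
          show ?thesis
          proof (cases "s = b")
            case True
            then show ?thesis using join p' p'_eq j
              by (auto simp: inn_def intro!: off.join dest: beyond_trans)
          next
            case False
            then have s: "s = (\<not> b)" by simp
            \<comment> \<open>The path edge is itself a candidate for the turn, so the token stops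
              there or earlier.\<close>
            have "beyond s p (\<rho> j)" using join(3) by (simp add: s beyond_not)
            then have "\<rho> j = c \<or> beyond s c (\<rho> j)" using p'(4) path_step[OF jw] p'_eq by simp
            then show ?thesis using p' p'_eq j s by (auto simp: inn_def beyond_not intro: off.join)
          qed
        next
          case (follow p'')
          then show ?thesis using p' j by (auto simp: inn_def intro: off.follow)
        qed
      qed
      then show thesis using turn T True by simp
    next
      case M
      then have c: "parent (E (w ! j)) p = Some c"
        "\<And>d. parent (E (w ! j)) d = Some c \<Longrightarrow> \<not> beyond s p d"
        by (auto simp: up)
      have "inn J b (Suc j) c s"
      proof (cases "p = \<rho> j \<and> s = b")
        case True
        then show ?thesis using c path_step[OF jw] j by (auto simp: inn_def)
      next
        case False
        then have "off J b j p" using p \<open>f\<close> by (auto simp: inn_def)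
        then show ?thesis
        proof cases
          case join
          then have c_eq: "c = \<rho> (Suc j)" using c(1) by simp
          have "\<not> beyond s p (\<rho> j)" using c(2) path_step[OF jw] c_eq by simp
          then have "s = b" using join(3) beyond_not by (cases "s = b") auto
          then show ?thesis using c_eq j by (simp add: inn_def)
        next
          case (follow p'')
          then show ?thesis using c j by (auto simp: inn_def)
        qed
      qed
      then show thesis using go M True by simp
    qed
  next
    case False
    have "walk (E (w ! j)) False s p \<noteq> None"
      by (auto simp: walk_def split: list.split)
    then consider (T) c where "walk (E (w ! j)) False s p = Some (Inl c)"
      | (M) c where "walk (E (w ! j)) False s p = Some (Inr c)"
      by (metis not_Some_eq old.sum.exhaust)
    then show thesis
    proof cases
      case T
      then have "c = p" "p \<noteq> \<rho> (Suc j)" using path_step[OF jw] by (auto simp: down)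
      then have "inn J b (Suc j) c (\<not> s)" using p False by (auto simp: inn_def)
      then show thesis using turn T False by simp
    next
      case M
      then have c: "parent (E (w ! j)) c = Some p"
        "\<And>d. parent (E (w ! j)) d = Some p \<Longrightarrow> d = c \<or> beyond (\<not> s) c d"
        by (auto simp: down closest_def)
      have "inn J b j c s"
      proof (cases "off J b (Suc j) p")
        case True
        then show ?thesis using c j by (auto simp: inn_def intro: off.follow)
      next
        case F: False
        then have p_eq: "p = \<rho> (Suc j)" "s = b" using p False by (auto simp: inn_def)
        then have "\<rho> j = c \<or> beyond s (\<rho> j) c"
          using c(2)[of "\<rho> j"] path_step[OF jw] by (auto simp: beyond_not)
        then show ?thesis using c(1) p_eq j by (auto simp: inn_def intro: off.join)
      qed
      then show thesis using go M False by simp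
    qed
  qed
qed

end

section \<open>The tour to the left of the path\<close>

context accepted
begin

abbreviation "L \<equiv> length w"

lemma path_states: "n \<le> L \<Longrightarrow> \<rho> n \<in> Q"
  using path_step[of n] parent_states[OF letter, of n "\<rho> n"] path_ends distinguished
  by (cases "n = L") auto

lemma off_states: "off J b n p \<Longrightarrow> J \<le> L \<Longrightarrow> p \<in> Q"
  using parent_states[OF letter, of n p] by (auto elim: off.cases)

lemma inn_states: "inn J b n p s \<Longrightarrow> J \<le> L \<Longrightarrow> p \<in> Q"
  using path_states[of n] off_states by (auto simp: inn_def)

definition touring_at :: "nat \<times> nat \<times> bool \<Rightarrow> bool" where
  "touring_at b \<longleftrightarrow> (case b of (n, p, f) \<Rightarrow> inn L True n p f \<and> n < L \<and> (f \<or> 1 \<le> n))"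

definition tour_step :: "nat \<times> nat \<times> bool \<Rightarrow> nat \<times> nat \<times> bool" where
  "tour_step b = (case b of (n, p, f) \<Rightarrow> let j = if f then n else n - 1 in
     case walk (E (w ! j)) f f p of None \<Rightarrow> b
     | Some (Inl c) \<Rightarrow> (n, c, \<not> f) | Some (Inr c) \<Rightarrow> (cell (\<not> f) j, c, f))"

definition tour_conf :: "nat \<times> nat \<times> bool \<Rightarrow> nat \<times> track" where
  "tour_conf b = (case b of (n, p, f) \<Rightarrow> (n, tour z f p))"

lemma cell_cases:
  assumes "n < L" "f \<or> 1 \<le> n" obtains j where "n = cell f j" "j < L" "j = (if f then n else n - 1)"
  using assms by (cases f) (auto intro: that[of "n - 1"] that[of n])

lemma tour_step_cases:
  assumes "touring_at b"
  obtains (stay) "touring_at (tour_step b)" "move w (tour_conf b) [] (tour_conf (tour_step b))"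
  | (exit) p p' where "b = (L - 1, p, True)" "walk (E REnd) True True p = Some (Inr p')"
      "\<not> touring_at (tour_step b)"
proof -
  obtain n p f where b: "b = (n, p, f)" by (cases b)
  with assms have S: "inn L True n p f" "n < L" "f \<or> 1 \<le> n" by (auto simp: touring_at_def)
  then obtain j where n: "n = cell f j" and j: "j < L" "j = (if f then n else n - 1)"
    using cell_cases[OF S(2,3)] by blast
  have pQ: "p \<in> Q" using inn_states[OF S(1)] by simp
  have kj: "\<not> (k (w ! j) = Suc 0 \<and> \<not> f)"
    using S(2) n REnd_iff[OF j(1)] by (cases f) (auto simp: kind_iff)
  show thesis
  proof (cases rule: inn_walk[OF order_refl j(1) S(1)[unfolded n]])
    case (1 c)
    have ts: "tour_step b = (n, c, \<not> f)" using 1(1) j(2) by (simp add: tour_step_def b)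
    \<comment> \<open>On the left endmarker only \<open>i\<close> has a parent, so there is no
      sibling to turn to.\<close>
    have "\<not> (f \<and> n = 0)"
    proof
      assume "f \<and> n = 0"
      then have "walk (E LEnd) True True p = Some (Inl c)" using 1(1) n first_letter by auto
      then show False
        by (auto simp: walk_up_turn[OF dist[OF LEnd_marked]] closest_def dest!: parent_LEnd)
    qed
    then have "touring_at (tour_step b)" using 1(2) S n by (auto simp: touring_at_def ts)
    moreover have "move w (tour_conf b) [] (tour_conf (tour_step b))"
      unfolding ts unfolding move_def tour_conf_def b
      by (rule exI[of _ j]) (use j(1) n 1(1) pQ kj in \<open>auto simp: nt_def next_track_tour\<close>)
    ultimately show thesis by (rule stay)
  next
    case (2 c)
    have ts: "tour_step b = (cell (\<not> f) j, c, f)" using 2(1) j(2) by (simp add: tour_step_def b)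
    show thesis
    proof (cases "f \<and> Suc j = L")
      case True
      then have "w ! j = REnd" using REnd_iff[OF j(1)] by simp
      moreover have "\<not> touring_at (tour_step b)" using True unfolding ts by (simp add: touring_at_def)
      moreover have "b = (L - 1, p, True)" using True n b by auto
      ultimately show thesis using exit[of p c] True 2(1) by simp
    next
      case False
      have "w ! j \<noteq> REnd" using False S(2) n REnd_iff[OF j(1)] by (cases f) auto
      then have kj: "k (w ! j) \<noteq> Suc 0" by (simp add: kind_iff)
      \<comment> \<open>A descending token is on the right side of its edge, so on the left of the
        path it is off the path; but at position 0 only the path node \<open>i\<close> has a
        parent.\<close>
      have "\<not> (\<not> f \<and> j = 0)"
      proof
        assume a: "\<not> f \<and> j = 0"
        then have "off L True 0 c" using 2(2) by (auto simp: inn_def)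
        moreover from this have "c = i"
          using parent_first by (auto elim: off.cases)
        ultimately show False using off_ne path_ends by fastforce
      qed
      then have "touring_at (tour_step b)" using 2(2) S n j False by (auto simp: touring_at_def ts)
      moreover have "move w (tour_conf b) [] (tour_conf (tour_step b))"
        unfolding ts unfolding move_def tour_conf_def b
        by (rule exI[of _ j]) (use j(1) n 2(1) pQ kj in \<open>auto simp: nt_def next_track_tour\<close>)
      ultimately show thesis by (rule stay)
    qed
  qed
qed

text \<open>Yields both injectivity and the absence of a predecessor of the start: a result that
  heads forward is at position \<open>Suc j\<close>.\<close>

lemma tour_step_undo:
  assumes "touring_at b" "tour_step b = (n', p', f')"
  shows "\<exists>j f c. j < L \<and> n' = cell (\<not> f') j \<and> b = (cell f j, c, f) \<and>
    walk (E (w ! j)) (\<not> f') f' p' = Some (if f = f' then Inr c else Inl c)"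
proof -
  obtain n p f where b: "b = (n, p, f)" by (cases b)
  with assms have S: "inn L True n p f" "n < L" "f \<or> 1 \<le> n" by (auto simp: touring_at_def)
  then obtain j where n: "n = cell f j" and j: "j < L" "j = (if f then n else n - 1)"
    using cell_cases[OF S(2,3)] by blast
  show ?thesis
  proof (cases rule: inn_walk[OF order_refl j(1) S(1)[unfolded n]])
    case (1 c)
    then have "f' = (\<not> f)" "p' = c" "n' = n" using assms(2) j(2) by (auto simp: tour_step_def b)
    then show ?thesis using walk_turn_back[OF dist_w[OF j(1)] 1(1)] b n j(1)
      by (intro exI[of _ j] exI[of _ f] exI[of _ p]) auto
  next
    case (2 c)
    then have "f' = f" "p' = c" "n' = cell (\<not> f) j" using assms(2) j(2) by (auto simp: tour_step_def b)
    then show ?thesis using walk_move_back[OF dist_w[OF j(1)] 2(1)] b n j(1)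
      by (intro exI[of _ j] exI[of _ f] exI[of _ p]) auto
  qed
qed

lemma tour_step_inj: "inj_on tour_step (Collect touring_at)"
proof (rule inj_onI; unfold mem_Collect_eq)
  fix b1 b2 assume S: "touring_at b1" "touring_at b2" and eq: "tour_step b1 = tour_step b2"
  obtain n p f where b: "tour_step b1 = (n, p, f)" by (metis prod_cases3)
  from tour_step_undo[OF S(1) b] tour_step_undo[OF S(2) b[unfolded eq]] show "b1 = b2"
    by (auto split: if_splits)
qed

lemma tour_moves:
  obtains p p' where "moves w (0, tour z True i) [] (L - 1, tour z True p)"
    "walk (E REnd) True True p = Some (Inr p')"
proof -
  let ?a = "(0, i, True)"
  have "finite (Collect touring_at)"
    by (rule finite_subset[of _ "{..L} \<times> Q \<times> UNIV"])
      (use fin inn_states in \<open>auto simp: touring_at_def\<close>)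
  moreover have a: "?a \<in> Collect touring_at" using w(2) path_ends by (auto simp: touring_at_def inn_def)
  moreover have "?a \<notin> tour_step ` Collect touring_at"
  proof
    assume "?a \<in> tour_step ` Collect touring_at"
    then obtain b where "touring_at b" "tour_step b = ?a" by auto
    from tour_step_undo[OF this] show False by auto
  qed
  ultimately obtain m where m: "(tour_step ^^ m) ?a \<notin> Collect touring_at"
      "\<And>l. l < m \<Longrightarrow> (tour_step ^^ l) ?a \<in> Collect touring_at"
    using orbit_exit[OF _ tour_step_inj] by metis
  then obtain m' where m': "m = Suc m'" using a by (cases m) auto
  have "moves w (tour_conf ((tour_step ^^ l) ?a)) [] (tour_conf ((tour_step ^^ m') ?a))" if "l \<le> m'" for l
    using that
  proof (induction rule: inc_induct)
    case (step l)
    have "touring_at ((tour_step ^^ l) ?a)" "touring_at ((tour_step ^^ Suc l) ?a)"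
      using m(2)[of l] m(2)[of "Suc l"] step(2) m' by auto
    then have "move w (tour_conf ((tour_step ^^ l) ?a)) [] (tour_conf ((tour_step ^^ Suc l) ?a))"
      by (auto elim: tour_step_cases)
    from reaches.step[OF this step.IH] show ?case by simp
  qed (rule reaches.refl)
  from this[of 0] have "moves w (tour_conf ?a) [] (tour_conf ((tour_step ^^ m') ?a))" by simp
  moreover have "touring_at ((tour_step ^^ m') ?a)" "\<not> touring_at (tour_step ((tour_step ^^ m') ?a))"
    using m m' by auto
  ultimately show thesis using that
    by (auto simp: tour_conf_def elim!: tour_step_cases)
qed

end

lemma pass_plain:
  assumes "proper c" "climb E c = Some c'" "proper c'" "\<And>m p. \<not> apex m c c' p"
  shows "pass E (c, x) = Some ((c', x), [])"
proof -
  have "\<not> (meet c \<and> ahead c)" "\<not> (meet c' \<and> \<not> ahead c')"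
    using assms(4)[of True "fst c"] assms(4)[of False "fst c'"] by (auto simp: apex_def)
  then show ?thesis using assms(1-3) by (auto simp: pass_def)
qed

lemma pass_apex:
  assumes "distinct (map fst E)" "proper c" "climb E c = Some c'" "proper c'" "apex m c c' p"
    "map_of E p = Some (p', S)" "visit S m x = Some ((m', y), v)"
  shows "pass E (c, x) = Some ((if m' = m then c' else reverse c, y), v)"
proof (cases m)
  case True
  then show ?thesis using assms by (simp add: pass_def apex_def cross_def)
next
  case False
  then have "\<not> (meet c \<and> ahead c)"
    using apex_unique[OF assms(1,3,5), of True "fst c"] by (auto simp: apex_def)
  then show ?thesis using False assms by (auto simp: pass_def apex_def cross_def)
qed

text \<open>Copylessness leaves one entry and one occurrence, so the first match found by
  \<open>visit\<close> is the intended one.\<close>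

lemma visit_next:
  assumes "copyless_table S" "(y, a @ Inl x # l) \<in> set S"
  shows "visit S True x = Some (scan y l)"
proof -
  let ?e = "(y, a @ Inl x # l)"
  have x: "Inl x \<in> set (snd ?e)" by simp
  have "\<forall>e \<in> set S. \<forall>e' \<in> set S. \<forall>x. Inl x \<in> set (snd e) \<longrightarrow> Inl x \<in> set (snd e') \<longrightarrow> e = e'"
    using assms(1) by (simp add: copyless_table_def)
  then have u: "e = ?e" if "e \<in> set S" "Inl x \<in> set (snd e)" for e
    using that assms(2) x by blast
  define F where "F = filter (\<lambda>e. Inl x \<in> set (snd e)) S"
  have "set F = {?e}"
  proof (rule equalityI; rule subsetI)
    fix e assume "e \<in> set F"
    then have "e \<in> set S" "Inl x \<in> set (snd e)" unfolding F_def by simp_all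
    then show "e \<in> {?e}" using u by simp
  next
    fix e assume "e \<in> {?e}"
    then show "e \<in> set F" unfolding F_def using assms(2) by simp
  qed
  then obtain e es where F: "F = e # es" by (metis empty_set insert_not_empty list.exhaust)
  then have e: "e = ?e" using \<open>set F = {?e}\<close> by (metis list.set_intros(1) singletonD)
  have "\<forall>e \<in> set S. \<forall>x. count_list (snd e) (Inl x) \<le> 1"
    using assms(1) by (simp add: copyless_table_def)
  then have "count_list (snd ?e) (Inl x) \<le> 1" using assms(2) by blast
  then have "Inl x \<notin> set a" by (simp add: count_list_0_iff)
  then show ?thesis using F[unfolded F_def] by (simp add: visit_def after_append e)
qed

definition subst_word :: "(nat \<Rightarrow> nat list) \<Rightarrow> (nat + nat) list \<Rightarrow> nat list" where
  "subst_word f l = concat (map (case_sum f (\<lambda>b. [b])) l)"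

lemma subst_word_simps [simp]:
  "subst_word f [] = []" "subst_word f (Inl x # l) = f x @ subst_word f l"
  "subst_word f (Inr b # l) = b # subst_word f l"
  "subst_word f (l @ l') = subst_word f l @ subst_word f l'"
  "subst_word f (map Inr bs) = bs"
  by (induction bs) (simp_all add: subst_word_def)

section \<open>Two tokens on the two sides of the path\<close>

context accepted
begin

definition corner :: "nat \<Rightarrow> pairing" where
  "corner n = (\<rho> n, \<rho> n, True, False, True)"

lemma corner_simps [simp]: "proper (corner n)" "meet (corner n)" "ahead (corner n)" "fst (corner n) = \<rho> n"
  by (simp_all add: corner_def proper_def meet_def ahead_def)

lemma summit_corner: "summit z r True = (corner L, z)" "summit z r False = (reverse (corner L), z)"
  using path_ends by (simp_all add: summit_def corner_def reverse_def)

text \<open>A turn flips one side together with the direction, so the last equation is a parity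
  invariant. The bound \<open>1 \<le> n\<close> excludes the position before the left
  endmarker.\<close>

definition K :: "nat \<Rightarrow> nat \<times> pairing \<Rightarrow> bool" where
  "K J b = (case b of (n, p, q, s, s', f) \<Rightarrow>
     1 \<le> n \<and> inn J True n p s \<and> inn J False n q s' \<and> f = (s \<noteq> s'))"

text \<open>A node off the path lies on one side of it only, so a shared node is on the path; there
  the two sides, and by parity the direction, are fixed.\<close>

lemma K_meet:
  assumes "K J (n, c)" "J \<le> L" "meet c" shows "c = corner n"
proof -
  have "\<not> off J s n (\<rho> n)" for s using off_ne[OF _ assms(2)] by blast
  then show ?thesis using assms(1,3) off_side[OF _ assms(2)]
    by (cases c) (auto simp: K_def inn_def meet_def corner_def)
qed

lemma K_proper: "K J (n, c) \<Longrightarrow> J \<le> L \<Longrightarrow> proper c"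
  using K_meet[of J n c] corner_simps(1)[of n] by (cases "meet c") (auto simp: proper_def meet_def split: prod.splits)

text \<open>A node that joins the path at level \<open>J\<close> or earlier is itself below level
  \<open>J\<close>.\<close>

lemma K_last: "K J (J, c) \<Longrightarrow> c = corner J"
  using off_less[of J _ J] by (cases c) (auto simp: K_def inn_def corner_def)

lemma K_pos: "K J (n, c) \<Longrightarrow> 1 \<le> n \<and> n \<le> J"
  by (auto simp: K_def inn_def split: prod.splits)

lemma K_states: "K J (n, c) \<Longrightarrow> J \<le> L \<Longrightarrow> x \<in> X \<Longrightarrow> (c, x) \<in> Tr"
  using inn_states by (cases c) (auto simp: K_def Tr_def)

lemma K_corner: "1 \<le> n \<Longrightarrow> n \<le> J \<Longrightarrow> K J (n, corner n)"
  by (auto simp: K_def corner_def inn_def)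

definition pair_step :: "nat \<times> pairing \<Rightarrow> nat \<times> pairing" where
  "pair_step b = (let j = (if ahead (snd b) then fst b else fst b - 1) in
     case climb (E (w ! j)) (snd b) of None \<Rightarrow> b | Some c \<Rightarrow> (cell (\<not> ahead c) j, c))"

lemma K_step:
  assumes K: "K J (n, c)" and n: "n < J" and J: "J \<le> L"
  obtains j c' where "j < J" "n = cell (ahead c) j" "climb (E (w ! j)) c = Some c'"
    "pair_step (n, c) = (cell (\<not> ahead c') j, c')" "K J (cell (\<not> ahead c') j, c')"
proof -
  obtain p q s s' f where c: "c = (p, q, s, s', f)" by (cases c)
  have f: "ahead c = f" by (simp add: c ahead_def)
  from K have K': "1 \<le> n" "inn J True n p s" "inn J False n q s'" "f = (s \<noteq> s')"
    by (auto simp: K_def c)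
  define j where "j = (if f then n else n - 1)"
  have j: "j < J" "n = cell f j" using K'(1) n by (auto simp: j_def)
  have jL: "j < L" using j J by simp
  have "\<exists>c'. climb (E (w ! j)) c = Some c' \<and> K J (cell (\<not> ahead c') j, c')"
  proof (cases rule: inn_walk[OF J j(1) K'(2)[unfolded j(2)]])
    case (1 p')
    then have "climb (E (w ! j)) c = Some (p', q, \<not> s, s', \<not> f)" by (simp add: c climb_iff)
    moreover have "K J (cell f j, p', q, \<not> s, s', \<not> f)" using 1(2) K' j by (simp add: K_def)
    ultimately show ?thesis by (intro exI[of _ "(p', q, \<not> s, s', \<not> f)"]) (simp add: ahead_def)
  next
    case p: (2 p')
    show ?thesis
    proof (cases rule: inn_walk[OF J j(1) K'(3)[unfolded j(2)]])
      case (1 q')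
      then have "climb (E (w ! j)) c = Some (p, q', s, \<not> s', \<not> f)" using p by (simp add: c climb_iff)
      moreover have "K J (cell f j, p, q', s, \<not> s', \<not> f)" using 1(2) K' j by (auto simp: K_def)
      ultimately show ?thesis by (intro exI[of _ "(p, q', s, \<not> s', \<not> f)"]) (simp add: ahead_def)
    next
      case q: (2 q')
      \<comment> \<open>Descending to position 0 takes both tokens to \<open>i\<close>, so they came
        from one node; but a meeting pair is a corner and heads up.\<close>
      have "\<not> (\<not> f \<and> j = 0)"
      proof
        assume a: "\<not> f \<and> j = 0"
        have d: "distinct (map fst (E (w ! j)))" using dist_w[OF jL] .
        have "parent (E (w ! 0)) p' = Some p" "parent (E (w ! 0)) q' = Some q"
          using p(1) q(1) a walk_down_move[OF d] by (auto simp: closest_def)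
        then have "p = q" using parent_first by (metis option.inject)
        then have "meet c" by (simp add: c meet_def)
        then have "f" using K_meet[OF K J] f by simp
        with a show False by simp
      qed
      then have "1 \<le> cell (\<not> f) j" by (cases f) auto
      then have "K J (cell (\<not> f) j, p', q', s, s', f)" using p(2) q(2) K'(4) by (simp add: K_def)
      moreover have "climb (E (w ! j)) c = Some (p', q', s, s', f)" using p q by (simp add: c climb_iff)
      ultimately show ?thesis by (intro exI[of _ "(p', q', s, s', f)"]) (simp add: ahead_def)
    qed
  qed
  then obtain c' where "climb (E (w ! j)) c = Some c'" "K J (cell (\<not> ahead c') j, c')" by blast
  moreover from this have "pair_step (n, c) = (cell (\<not> ahead c') j, c')"
    unfolding pair_step_def fst_conv snd_conv f j_def[symmetric] Let_def by simp
  ultimately show thesis using that j f by simp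
qed

lemma pair_step_inj: "J \<le> L \<Longrightarrow> inj_on pair_step {b. K J b \<and> fst b < J}"
proof (rule inj_onI)
  fix b1 b2 assume J: "J \<le> L" and S: "b1 \<in> {b. K J b \<and> fst b < J}" "b2 \<in> {b. K J b \<and> fst b < J}"
    and eq: "pair_step b1 = pair_step b2"
  obtain n1 c1 n2 c2 where b: "b1 = (n1, c1)" "b2 = (n2, c2)" by (cases b1, cases b2)
  obtain j1 d1 where 1: "j1 < J" "n1 = cell (ahead c1) j1" "climb (E (w ! j1)) c1 = Some d1"
    "pair_step (n1, c1) = (cell (\<not> ahead d1) j1, d1)"
    by (rule K_step[of J n1 c1]) (use S J b in auto)
  obtain j2 d2 where 2: "j2 < J" "n2 = cell (ahead c2) j2" "climb (E (w ! j2)) c2 = Some d2"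
    "pair_step (n2, c2) = (cell (\<not> ahead d2) j2, d2)"
    by (rule K_step[of J n2 c2]) (use S J b in auto)
  have "d1 = d2" "j1 = j2" using eq 1(4) 2(4) b by auto
  then show "b1 = b2"
    using climb_back[OF dist_w 1(3)] climb_back[OF dist_w 2(3)] 1(1,2) 2(2) J b by auto
qed

text \<open>On the left endmarker nothing stops the tokens. By \<open>climb_back\<close> this
  identifies the only candidate for a predecessor of \<open>corner 1\<close>; it is at position 0,
  which \<open>K\<close> excludes.\<close>

lemma climb_first: "climb (E (w ! 0)) (corner 0) = Some (corner 1)"
proof -
  have nonempty: "w \<noteq> []" using w(2) by auto
  have p: "parent (E (w ! 0)) i = Some (\<rho> 1)" using path_step[of 0] nonempty path_ends by simp
  have "walk (E (w ! 0)) True s i = Some (Inr (\<rho> 1))" for s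
    using p nonempty by (auto simp: walk_up_move[OF dist_w] dest!: parent_first)
  then show ?thesis using path_ends by (simp add: corner_def climb_iff)
qed

definition orbit :: "nat \<Rightarrow> nat \<times> pairing" where
  "orbit m = (pair_step ^^ m) (1, corner 1)"

lemma orbit_level:
  assumes "1 \<le> J" "J \<le> L"
  obtains m where "orbit m = (J, corner J)" "\<And>l. l < m \<Longrightarrow> K J (orbit l) \<and> fst (orbit l) < J"
    "inj_on orbit {..m}"
proof (cases "J = 1")
  case True
  then show thesis using that[of 0] by (simp add: orbit_def)
next
  case False
  let ?S = "{b. K J b \<and> fst b < J}" and ?a = "(1, corner 1)"
  have finS: "finite ?S"
  proof (rule finite_subset)
    show "?S \<subseteq> {..J} \<times> Q \<times> Q \<times> UNIV"
      using inn_states assms by (auto simp: K_def)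
  qed (use fin in simp)
  have a: "?a \<in> ?S" using assms False by (auto intro: K_corner)
  have na: "?a \<notin> pair_step ` ?S"
  proof
    assume "?a \<in> pair_step ` ?S"
    then obtain n c where b: "K J (n, c)" "n < J" "pair_step (n, c) = ?a" by force
    obtain j c' where j': "j < J" "n = cell (ahead c) j" "climb (E (w ! j)) c = Some c'"
      "pair_step (n, c) = (cell (\<not> ahead c') j, c')"
      using K_step[OF b(1,2) assms(2)] .
    have c': "c' = corner 1" "cell (\<not> ahead c') j = 1" using b(3) j'(4) by auto
    have "j = 0" using c'(2) unfolding c'(1) by simp
    with j' c'(1) have j: "n = cell (ahead c) j" "climb (E (w ! j)) c = Some (corner 1)" "j = 0" by auto
    have "L > 0" using w(2) by linarith
    then have "reverse c = reverse (corner 0)"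
      using climb_back[OF dist_w j(2)] climb_back[OF dist_w climb_first] j(3) by simp
    then have "n = 0" using j by simp
    then show False using K_pos[OF b(1)] by simp
  qed
  obtain m where m: "orbit m \<notin> ?S" "\<And>l. l < m \<Longrightarrow> orbit l \<in> ?S" "inj_on orbit {..m}"
    using orbit_exit[OF finS pair_step_inj[OF assms(2)] a na, folded orbit_def] by blast
  have "m \<noteq> 0"
  proof
    assume "m = 0"
    then have "orbit m = ?a" by (simp add: orbit_def)
    with m(1) a show False by metis
  qed
  then obtain l where l: "m = Suc l" by (cases m) auto
  obtain n c where o: "orbit l = (n, c)" by (cases "orbit l")
  then have "K J (n, c)" "n < J" using m(2)[of l] l by auto
  moreover have "orbit m = pair_step (n, c)" using o by (simp add: l orbit_def)
  ultimately have "K J (orbit m)" using K_step[OF _ _ assms(2)] by metis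
  moreover obtain n' d where o': "orbit m = (n', d)" by (cases "orbit m")
  ultimately have "K J (n', d)" "\<not> n' < J" using m(1) by auto
  then have "n' = J" using K_pos[of J n' d] by simp
  then have "orbit m = (J, corner J)" using K_last \<open>K J (n', d)\<close> o' by simp
  then show thesis using that m by auto
qed

text \<open>A meeting in between would be at a corner of level at most \<open>J\<close>. That corner
  was already visited by time \<open>a\<close>, and the orbit is injective up to
  \<open>b\<close>.\<close>

lemma orbit_segment:
  assumes "1 \<le> J" "J < L"
  obtains a b where "a < b" "orbit a = (J, corner J)" "orbit b = (Suc J, corner (Suc J))"
    "\<And>l. l \<le> b \<Longrightarrow> K (Suc J) (orbit l)"
    "\<And>l. a < l \<Longrightarrow> l < b \<Longrightarrow> fst (orbit l) \<le> J \<and> \<not> meet (snd (orbit l))"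
proof -
  obtain b where b: "orbit b = (Suc J, corner (Suc J))"
    "\<And>l. l < b \<Longrightarrow> K (Suc J) (orbit l) \<and> fst (orbit l) < Suc J" "inj_on orbit {..b}"
    using orbit_level[of "Suc J"] assms by auto
  obtain a where a: "orbit a = (J, corner J)" "\<And>l. l < a \<Longrightarrow> K J (orbit l) \<and> fst (orbit l) < J"
    using orbit_level[of J] assms by auto
  have "a < b"
  proof (rule ccontr)
    assume "\<not> a < b"
    then consider "a = b" | "b < a" by linarith
    then show False using a(1) a(2)[of b] b(1) by cases auto
  qed
  moreover have "K (Suc J) (orbit l)" if "l \<le> b" for l
    using b(1) b(2)[of l] that K_corner[of "Suc J" "Suc J"] by (cases "l = b") auto
  moreover have "fst (orbit l) \<le> J \<and> \<not> meet (snd (orbit l))" if "a < l" "l < b" for l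
  proof -
    obtain n c where o: "orbit l = (n, c)" by (cases "orbit l")
    then have n: "K (Suc J) (n, c)" "n \<le> J" using b(2)[OF that(2)] by auto
    have "\<not> meet c"
    proof
      assume "meet c"
      then have "c = corner n" using K_meet[OF n(1)] assms by simp
      moreover obtain m where m: "orbit m = (n, corner n)" "\<And>l. l < m \<Longrightarrow> fst (orbit l) < n"
        by (rule orbit_level[of n]) (use n assms K_pos[OF n(1)] in auto)
      have "m \<le> a" using m(2)[of a] a(1) n(2) by (cases "a < m") auto
      ultimately have "l = m" using inj_onD[OF b(3), of l m] o m(1) that by auto
      then show False using \<open>m \<le> a\<close> that by simp
    qed
    with o n show ?thesis by simp
  qed
  ultimately show thesis using that a(1) b(1) by blast
qed

end

section \<open>Evaluation of the variables along the path\<close>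

context accepted
begin

text \<open>\<open>vmove\<close> adds to the moves those from the virtual configuration behind the right endmarker,
  which the end of the tour stands for.\<close>

definition vmove :: "nat \<times> track \<Rightarrow> nat list \<Rightarrow> nat \<times> track \<Rightarrow> bool" where
  "vmove b v b' \<longleftrightarrow> move w b v b' \<or>
     b = (L, summit z r False) \<and> pass (E REnd) (summit z r False) = Some (snd b', v) \<and>
     fst b' = cell (\<not> ahead (fst (snd b'))) (L - 1)"

abbreviation "vmoves \<equiv> reaches vmove"

lemma vmove_target: "vmove b v b' \<Longrightarrow> b' \<noteq> (L, summit z r False)"
  using w(2) by (auto simp: vmove_def move_def)

text \<open>The virtual configuration is never a target, so at most the first move is
  virtual.\<close>

lemma vmoves_moves:
  assumes "vmoves b v b'" "b \<noteq> (L, summit z r False)" shows "moves w b v b'"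
  using assms
proof induction
  case (step b v b' v' b'')
  then have "move w b v b'" by (simp add: vmove_def)
  moreover have "moves w b' v' b''" using step.IH vmove_target[OF step.hyps(1)] by simp
  ultimately show ?case by (rule reaches.step)
qed (rule reaches.refl)

text \<open>On the right endmarker the last step of the tour has, by definition, the same result as
  the virtual move.\<close>

lemma vmoves_start:
  assumes "vmoves (L, summit z r False) v b'" "b' \<noteq> (L, summit z r False)"
    and p: "walk (E REnd) True True p = Some (Inr p')"
  shows "moves w (L - 1, tour z True p) v b'"
  using assms(1)
proof cases
  case refl
  then show ?thesis using assms(2) by simp
next
  case (step v1 b1 v2)
  have L: "L - 1 < L" using w(2) by simp
  have R: "w ! (L - 1) = REnd" using REnd_iff[OF L] w(2) by simp
  have pQ: "p \<in> Q" using p parent_states[OF REnd_marked] by (auto simp: walk_up_move[OF dist[OF REnd_marked]])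
  have "\<not> move w (L, summit z r False) v1 b1"
  proof
    assume "move w (L, summit z r False) v1 b1"
    then obtain j where "j < L" "Suc j = L" "nt (w ! j) (summit z r False) = Some (snd b1, v1)"
      by (auto simp: move_def)
    then have "nt REnd (summit z r False) = Some (snd b1, v1)" using REnd_iff by metis
    moreover have "\<not> touring z (summit z r False)" by (auto simp: touring_def summit_def)
    ultimately show False using kind by (simp add: nt_def next_track_other)
  qed
  then have "pass (E REnd) (summit z r False) = Some (snd b1, v1)"
    "fst b1 = cell (\<not> ahead (fst (snd b1))) (L - 1)"
    using step(2) by (auto simp: vmove_def)
  moreover have "nt REnd (tour z True p) = pass (E REnd) (summit z r False)"
    using p kind by (simp add: nt_def next_track_tour)
  ultimately have "move w (L - 1, tour z True p) v1 b1"
    unfolding move_def by (intro exI[of _ "L - 1"] conjI) (simp_all only: L R snd_conv fst_conv tour_Tr pQ ahead_tour cell_simps)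
  then show ?thesis using vmoves_moves[OF step(3) vmove_target[OF step(2)]] step(1)
    by (auto intro: reaches.step)
qed

lemma not_touring: "proper c \<Longrightarrow> \<not> touring z (c, x)"
  by (auto simp: touring_def proper_def)

lemma move_pass:
  assumes j: "j < L" and n: "n = cell (ahead c) j" "n' = cell (\<not> ahead c') j"
    and c: "proper c" "(c, x) \<in> Tr" and p: "pass (E (w ! j)) (c, x) = Some ((c', y), v)"
    and "\<not> (j = 0 \<and> ahead c)" "\<not> (Suc j = L \<and> \<not> ahead c)" "Suc j = L \<Longrightarrow> ahead c' \<Longrightarrow> y = z"
  shows "move w (n, (c, x)) v (n', (c', y))"
proof -
  have "nt (w ! j) (c, x) = Some ((c', y), v)"
    using assms not_touring[OF c(1), of x] LEnd_iff[OF j] REnd_iff[OF j]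
    by (auto simp: nt_def next_track_other kind_iff)
  then show ?thesis using j n c(2) by (auto simp: move_def)
qed

lemma pass_last_vmove:
  assumes "pass (E REnd) (reverse (corner L), z) = Some ((c', y), v)"
  shows "vmove (L, (reverse (corner L), z)) v (cell (\<not> ahead c') (L - 1), (c', y))"
  using assms by (simp add: vmove_def summit_corner)

text \<open>Away from an apex the variable is carried along unchanged, forwards as well as backwards
  in time. Backwards from the end of the word the step is virtual, hence
  \<open>vmove\<close>.\<close>

lemma plain_move:
  assumes K: "K J (n, c)" and n: "n < J" and J: "J \<le> L" and "\<not> meet c" and x: "x \<in> X"
    and ps: "pair_step (n, c) = (n', c')" and z: "n' = L \<Longrightarrow> x = z"
  shows "move w (n, (c, x)) [] (n', (c', x))" and "vmove (n', (reverse c', x)) [] (n, (reverse c, x))"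
proof -
  obtain j c1 where j: "j < J" "n = cell (ahead c) j" "climb (E (w ! j)) c = Some c1"
    "pair_step (n, c) = (cell (\<not> ahead c1) j, c1)" "K J (cell (\<not> ahead c1) j, c1)"
    using K_step[OF K n J] .
  then have c1: "c1 = c'" "n' = cell (\<not> ahead c') j" using ps by auto
  have j': "climb (E (w ! j)) c = Some c'" "K J (n', c')" using j(3,5) c1 by auto
  have jL: "j < L" using j(1) J by simp
  have pr: "proper c" "proper c'" using K_proper[OF K J] K_proper[OF j'(2) J] by auto
  have m: "ahead c'" if "meet c'" using K_meet[OF j'(2) J that] by simp
  have apex: "\<not> apex b c c' p" for b p using \<open>\<not> meet c\<close> m by (auto simp: apex_def)
  have pos: "1 \<le> n" "1 \<le> n'" using K_pos[OF K] K_pos[OF j'(2)] by auto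
  have Tr: "(c, x) \<in> Tr" "(c', x) \<in> Tr" using K_states[OF K J x] K_states[OF j'(2) J x] by auto
  have nL: "n < L" using n J by simp
  show "move w (n, (c, x)) [] (n', (c', x))"
  proof (rule move_pass[OF jL j(2) c1(2) pr(1) Tr(1) pass_plain[OF pr(1) j'(1) pr(2) apex]])
    show "\<not> (j = 0 \<and> ahead c)" using pos(1) j(2) by auto
    show "\<not> (Suc j = L \<and> \<not> ahead c)" using nL j(2) by (cases "ahead c") auto
    show "x = z" if "Suc j = L" "ahead c'" using z c1(2) that by simp
  qed
  have bk: "pass (E (w ! j)) (reverse c', x) = Some ((reverse c, x), [])"
    by (rule pass_plain) (use pr apex climb_back[OF dist_w[OF jL] j'(1)] in \<open>auto simp: apex_reverse\<close>)
  show "vmove (n', (reverse c', x)) [] (n, (reverse c, x))"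
  proof (cases "n' = L")
    case True
    have a: "ahead c'" "Suc j = L" using True c1(2) jL by (cases "ahead c'"; simp)+
    have "L \<le> J" using K_pos[OF j'(2)] True by simp
    then have "c' = corner L" using K_last[of L c'] j'(2) J True by simp
    moreover have "w ! j = REnd" using REnd_iff[OF jL] a by simp
    moreover have "n = cell (\<not> ahead (reverse c)) (L - 1)" using j(2) a by auto
    ultimately show ?thesis using pass_last_vmove[of "reverse c" x] bk z[OF True] True by simp
  next
    case False
    have "move w (n', (reverse c', x)) [] (n, (reverse c, x))"
    proof (rule move_pass[OF jL _ _ _ _ bk])
      show "\<not> (j = 0 \<and> ahead (reverse c'))" using pos(2) c1(2) by auto
      show "\<not> (Suc j = L \<and> \<not> ahead (reverse c'))" using False c1(2) by auto
      show "x = z" if "Suc j = L" "ahead (reverse c)" using nL j(2) that by (cases "ahead c") auto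
    qed (use j(2) c1(2) pr Tr in auto)
    then show ?thesis by (simp add: vmove_def)
  qed
qed

text \<open>The first step from the corner is split off because the update is evaluated there. The
  rest of the segment contains no apex and can be traversed both ways.\<close>

lemma segment_moves:
  assumes J: "1 \<le> J" "J < L" and x: "x \<in> X" and z: "Suc J = L \<Longrightarrow> x = z"
  obtains nB cB where "pair_step (J, corner J) = (nB, cB)" "K (Suc J) (nB, cB)"
    "nB = L \<Longrightarrow> Suc J = L"
    "vmoves (nB, (cB, x)) [] (Suc J, (corner (Suc J), x))"
    "vmoves (Suc J, (reverse (corner (Suc J)), x)) [] (nB, (reverse cB, x))"
proof -
  obtain a b where s: "a < b" "orbit a = (J, corner J)" "orbit b = (Suc J, corner (Suc J))"
    "\<And>l. l \<le> b \<Longrightarrow> K (Suc J) (orbit l)"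
    "\<And>l. a < l \<Longrightarrow> l < b \<Longrightarrow> fst (orbit l) \<le> J \<and> \<not> meet (snd (orbit l))"
    using orbit_segment[OF J] by metis
  let ?f = "\<lambda>l. (fst (orbit l), (snd (orbit l), x))" and ?g = "\<lambda>l. (fst (orbit l), (reverse (snd (orbit l)), x))"
  have one: "vmove (?f l) [] (?f (Suc l)) \<and> vmove (?g (Suc l)) [] (?g l)" if "a < l" "l < b" for l
  proof -
    obtain n c n' c' where o: "orbit l = (n, c)" "orbit (Suc l) = (n', c')"
      by (cases "orbit l", cases "orbit (Suc l)")
    then have "pair_step (n, c) = (n', c')" by (simp add: orbit_def)
    moreover have "K (Suc J) (n, c)" "n < Suc J" "\<not> meet c" using s(4)[of l] s(5)[OF that] that o by auto
    moreover have "x = z" if "n' = L"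
      using s(4)[of "Suc l"] K_pos[of "Suc J" n' c'] o \<open>l < b\<close> that J z by simp
    ultimately show ?thesis using plain_move[of "Suc J" n c x n' c'] J x o by (simp add: vmove_def)
  qed
  have "vmoves (?f l) [] (?f b) \<and> vmoves (?g b) [] (?g l)" if "l \<le> b" "a < l" for l
    using that
  proof (induction rule: inc_induct)
    case (step l)
    then show ?case
      using one[of l] reaches.step[of vmove "?f l" "[]" "?f (Suc l)" "[]" "?f b"]
        reaches_trans[OF _ reaches_single, of vmove "?g b" "[]" "?g (Suc l)" "[]" "?g l"] by simp
  qed (auto intro: reaches.refl)
  from this[of "Suc a"] s have v: "vmoves (?f (Suc a)) [] (?f b)" "vmoves (?g b) [] (?g (Suc a))" by auto
  obtain nB cB where B: "orbit (Suc a) = (nB, cB)" by (cases "orbit (Suc a)")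
  have KB: "K (Suc J) (nB, cB)" using s(4)[of "Suc a"] s(1) B by simp
  show thesis
  proof (rule that)
    show "pair_step (J, corner J) = (nB, cB)" using s(2) B by (simp add: orbit_def)
    show "Suc J = L" if "nB = L" using K_pos[OF KB] that J by simp
  qed (use v B s(3) KB in auto)
qed

end

context accepted
begin

definition tab :: "nat \<Rightarrow> subst_table" where
  "tab n = snd (the (map_of (E (w ! n)) (\<rho> n)))"

primrec val :: "nat \<Rightarrow> nat \<Rightarrow> nat list" where
  "val 0 = (\<lambda>x. [])"
| "val (Suc n) = (\<lambda>x. subst_word (val n) (the (map_of (tab n) x)))"

lemma tab:
  assumes "n < L"
  shows "map_of (E (w ! n)) (\<rho> n) = Some (\<rho> (Suc n), tab n)"
    and "copyless_table (tab n)" and "fst ` set (tab n) = X"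
    and "(y, l) \<in> set (tab n) \<Longrightarrow> set l \<subseteq> X <+> C"
    and "n = 0 \<Longrightarrow> (y, l) \<in> set (tab n) \<Longrightarrow> Inl x \<notin> set l"
    and "x \<in> X \<Longrightarrow> map_of (tab n) x = Some (the (map_of (tab n) x))"
proof -
  show m: "map_of (E (w ! n)) (\<rho> n) = Some (\<rho> (Suc n), tab n)"
    using path_step[OF assms] by (auto simp: tab_def parent_def)
  then have e: "(\<rho> n, \<rho> (Suc n), tab n) \<in> set (E (w ! n))" by (rule map_of_SomeD)
  then show "copyless_table (tab n)" using E_ok[OF letter[OF assms]] by (auto simp: edges_ok_def)
  show f: "fst ` set (tab n) = X" using E_vars[OF letter[OF assms] e] .
  show "(y, l) \<in> set (tab n) \<Longrightarrow> set l \<subseteq> X <+> C"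
    using E_subst[OF letter[OF assms] e] .
  show "n = 0 \<Longrightarrow> (y, l) \<in> set (tab n) \<Longrightarrow> Inl x \<notin> set l"
    using E_erased e first_letter by metis
  show "x \<in> X \<Longrightarrow> map_of (tab n) x = Some (the (map_of (tab n) x))"
    using f by (metis map_of_eq_None_iff option.collapse)
qed

context
  fixes J nB and cB :: pairing
  assumes J: "J < L" and cB: "climb (E (w ! J)) (corner J) = Some cB" "nB = cell (\<not> ahead cB) J"
    "K (Suc J) (nB, cB)"
begin

text \<open>Where the head is after a visit with result \<open>t\<close>: past the climb step from
  the corner if a value is complete, at the reversed corner if a variable is requested.\<close>

definition side_of :: "bool \<times> nat \<Rightarrow> nat \<times> track" where
  "side_of t = (if fst t then (nB, (cB, snd t)) else (J, (reverse (corner J), snd t)))"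

lemma proper_cB: "proper cB"
  using K_proper[OF cB(3)] J by simp

lemma corner_Tr: "x \<in> X \<Longrightarrow> (corner J, x) \<in> Tr"
  using path_states[of J] J by (auto simp: corner_def Tr_def)

lemma cross_out:
  assumes "1 \<le> J" "visit (tab J) True x = Some (t, v)" "x \<in> X" "fst t \<Longrightarrow> nB = L \<Longrightarrow> snd t = z"
  shows "move w (J, (corner J, x)) v (side_of t)"
proof -
  obtain m y where t: "t = (m, y)" by (cases t)
  let ?c = "if m then cB else reverse (corner J)"
  have "apex True (corner J) cB (\<rho> J)" by (simp add: apex_def)
  from pass_apex[OF dist_w[OF J] _ cB(1) proper_cB this tab(1)[OF J] assms(2)[unfolded t]]
  have p: "pass (E (w ! J)) (corner J, x) = Some ((?c, y), v)" by simp
  have "move w (J, (corner J, x)) v (cell (\<not> ahead ?c) J, (?c, y))"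
    by (rule move_pass[OF J _ HOL.refl _ corner_Tr[OF assms(3)] p])
      (use assms(1,4) cB(2) in \<open>auto simp: t split: if_splits\<close>)
  then show ?thesis by (cases m) (simp_all add: side_of_def t cB(2)[symmetric])
qed

lemma cross_in:
  assumes "visit (tab J) False x = Some (t, v)" "x \<in> X" "nB = L \<Longrightarrow> x = z"
  shows "vmove (nB, (reverse cB, x)) v (side_of t)"
proof -
  obtain m y where t: "t = (m, y)" by (cases t)
  let ?c = "if m then cB else reverse (corner J)"
  have "apex False (reverse cB) (reverse (corner J)) (\<rho> J)" by (simp add: apex_def)
  from pass_apex[OF dist_w[OF J] _ climb_back[OF dist_w[OF J] cB(1)] _ this tab(1)[OF J] assms(1)[unfolded t]]
  have p: "pass (E (w ! J)) (reverse cB, x) = Some ((?c, y), v)" using proper_cB by simp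
  have so: "side_of t = (cell (\<not> ahead ?c) J, (?c, y))"
    by (simp add: side_of_def t cB(2)[symmetric])
  show ?thesis
  proof (cases "nB = L")
    case True
    have a: "ahead cB" "Suc J = L" using True cB(2) J by (cases "ahead cB"; simp)+
    then have "cB = corner L" using K_last[of L cB] cB(3) True by simp
    moreover have "w ! J = REnd" using REnd_iff[OF J] a by simp
    moreover have "J = L - 1" using a by simp
    ultimately show ?thesis using pass_last_vmove[of ?c y v] p assms(3)[OF True] True so by simp
  next
    case False
    have "move w (nB, (reverse cB, x)) v (cell (\<not> ahead ?c) J, (?c, y))"
    proof (rule move_pass[OF J _ HOL.refl _ _ p])
      show "\<not> (J = 0 \<and> ahead (reverse cB))" using K_pos[OF cB(3)] cB(2) by auto
      show "\<not> (Suc J = L \<and> \<not> ahead (reverse cB))" using False cB(2) by auto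
      show "y = z" if "Suc J = L" "ahead ?c"
        using that False cB(2) by (cases m) auto
      show "(reverse cB, x) \<in> Tr" using K_states[OF cB(3) _ assms(2)] J by simp
    qed (use cB(2) proper_cB in auto)
    then show ?thesis by (simp add: vmove_def so)
  qed
qed

text \<open>Induction on the rest \<open>l\<close> of the word of \<open>Y\<close>: a requested
  variable is evaluated below, the head returns to the corner, and the next visit resumes in the
  same word behind that variable.\<close>

lemma scan_moves:
  assumes below: "\<And>x. x \<in> X \<Longrightarrow> 1 \<le> J \<Longrightarrow> vmoves (J, (reverse (corner J), x)) (val J x) (J, (corner J, x))"
    and Y: "(Y, b @ l) \<in> set (tab J)" "nB = L \<Longrightarrow> Y = z"
  shows "\<exists>v. vmoves (side_of (fst (scan Y l))) v (nB, (cB, Y)) \<and>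
    snd (scan Y l) @ v = subst_word (val J) l"
  using Y(1)
proof (induction "length l" arbitrary: b l rule: less_induct)
  case less
  obtain l' where l: "l = map Inr (snd (scan Y l)) @ l'"
    "fst (scan Y l) = (True, Y) \<and> l' = [] \<or> (\<exists>z l''. fst (scan Y l) = (False, z) \<and> l' = Inl z # l'')"
    using scan_split[of l Y] by blast
  from l(2) show ?case
  proof (elim disjE exE conjE)
    assume "fst (scan Y l) = (True, Y)" "l' = []"
    moreover from this have "subst_word (val J) l = snd (scan Y l)"
      using l(1) by (metis append_Nil2 subst_word_simps(5))
    ultimately show ?thesis by (auto simp: side_of_def intro: reaches.refl)
  next
    fix x l'' assume x: "fst (scan Y l) = (False, x)" and l': "l' = Inl x # l''"
    let ?b = "b @ map Inr (snd (scan Y l))"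
    have mem: "(Y, ?b @ Inl x # l'') \<in> set (tab J)" using less.prems l(1) l' by simp
    have xX: "x \<in> X" using tab(4)[OF J mem] by auto
    \<comment> \<open>Erased words on the left endmarker request no variable.\<close>
    have pos: "1 \<le> J" using tab(5)[OF J _ mem, of x] by (cases J) auto
    have len: "length l'' < length l" using l(1) l' by (metis length_append length_Cons less_add_Suc2 add_Suc_right)
    obtain v where v: "vmoves (side_of (fst (scan Y l''))) v (nB, (cB, Y))"
      "snd (scan Y l'') @ v = subst_word (val J) l''"
      using less.hyps[OF len, of "?b @ [Inl x]"] mem by auto
    have "visit (tab J) True x = Some (fst (scan Y l''), snd (scan Y l''))"
      using visit_next[OF tab(2)[OF J] mem] by simp
    moreover have "snd (fst (scan Y l'')) = z" if "fst (fst (scan Y l''))" "nB = L"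
      using scan_split[of l'' Y] that Y(2) by auto
    ultimately have "move w (J, (corner J, x)) (snd (scan Y l'')) (side_of (fst (scan Y l'')))"
      using cross_out[OF pos _ xX] by blast
    then have "vmoves (J, (corner J, x)) (subst_word (val J) l'') (nB, (cB, Y))"
      using reaches.step[OF _ v(1)] v(2) by (metis vmove_def)
    then have "vmoves (side_of (fst (scan Y l))) (val J x @ subst_word (val J) l'') (nB, (cB, Y))"
      using reaches_trans[OF below[OF xX pos]] x by (simp add: side_of_def)
    moreover have "snd (scan Y l) @ val J x @ subst_word (val J) l'' = subst_word (val J) l"
      using arg_cong[OF l(1), of "subst_word (val J)"] by (simp add: l')
    ultimately show ?thesis by blast
  qed
qed

lemma evaluate:
  assumes below: "\<And>x. x \<in> X \<Longrightarrow> 1 \<le> J \<Longrightarrow> vmoves (J, (reverse (corner J), x)) (val J x) (J, (corner J, x))"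
    and Y: "Y \<in> X" "nB = L \<Longrightarrow> Y = z"
  shows "vmoves (nB, (reverse cB, Y)) (val (Suc J) Y) (nB, (cB, Y))"
proof -
  obtain l where m: "map_of (tab J) Y = Some l" using tab(6)[OF J Y(1)] by blast
  then have "visit (tab J) False Y = Some (fst (scan Y l), snd (scan Y l))" by (simp add: visit_def)
  then have "vmove (nB, (reverse cB, Y)) (snd (scan Y l)) (side_of (fst (scan Y l)))"
    using cross_in[OF _ Y] by blast
  moreover obtain v where "vmoves (side_of (fst (scan Y l))) v (nB, (cB, Y))"
    "snd (scan Y l) @ v = subst_word (val J) l"
    using scan_moves[OF below, of Y "[]" l] Y(2) map_of_SomeD[OF m] by auto
  moreover have "val (Suc J) Y = subst_word (val J) l" using m by simp
  ultimately show ?thesis using reaches.step by metis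
qed

end

text \<open>By induction each level supplies the values requested when the next letter is crossed.
  At the end of the word the guard on the final state leaves only \<open>z\<close>.\<close>

lemma vmoves_val:
  assumes "1 \<le> J" "J \<le> L" "x \<in> X" "J = L \<Longrightarrow> x = z"
  shows "vmoves (J, (reverse (corner J), x)) (val J x) (J, (corner J, x))"
  using assms
proof (induction J arbitrary: x)
  case (Suc J)
  show ?case
  proof (cases "J = 0")
    case True
    have "vmoves (1, (reverse (corner 1), x)) (val (Suc 0) x) (1, (corner 1, x))"
      by (rule evaluate[of 0 "corner 1" 1]) (use w(2) climb_first K_corner[of 1 1] Suc.prems in auto)
    then show ?thesis using True by simp
  next
    case False
    then have J: "1 \<le> J" "J < L" using Suc.prems by auto
    obtain nB cB where B: "pair_step (J, corner J) = (nB, cB)" "K (Suc J) (nB, cB)" "nB = L \<Longrightarrow> Suc J = L"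
      "vmoves (nB, (cB, x)) [] (Suc J, (corner (Suc J), x))"
      "vmoves (Suc J, (reverse (corner (Suc J)), x)) [] (nB, (reverse cB, x))"
      using segment_moves[OF J Suc.prems(3,4)] by metis
    obtain j c' where j: "J = cell (ahead (corner J)) j" "climb (E (w ! j)) (corner J) = Some c'"
      "pair_step (J, corner J) = (cell (\<not> ahead c') j, c')"
      using K_step[of "Suc J" J "corner J"] K_corner[of J "Suc J"] J by (metis Suc_leI le_SucI lessI order_refl)
    then have cB: "climb (E (w ! J)) (corner J) = Some cB" "nB = cell (\<not> ahead cB) J" using B(1) by auto
    have "vmoves (nB, (reverse cB, x)) (val (Suc J) x) (nB, (cB, x))"
      by (rule evaluate[OF J(2) cB B(2)]) (use Suc.IH J Suc.prems B(3) in auto)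
    from reaches_trans[OF B(5) reaches_trans[OF this B(4)]] show ?thesis by simp
  qed
qed simp

lemma accepting_moves: "moves w (0, tour z True i) (val L z) (L, summit z r True)"
proof -
  obtain p p' where p: "moves w (0, tour z True i) [] (L - 1, tour z True p)"
    "walk (E REnd) True True p = Some (Inr p')"
    by (rule tour_moves)
  have "vmoves (L, (reverse (corner L), z)) (val L z) (L, (corner L, z))"
    by (rule vmoves_val) (use w(2) distinguished in auto)
  then have "vmoves (L, summit z r False) (val L z) (L, summit z r True)"
    by (simp only: summit_corner)
  moreover have "(L, summit z r True) \<noteq> (L, summit z r False)" by (simp add: summit_def)
  ultimately have "moves w (L - 1, tour z True p) (val L z) (L, summit z r True)"
    using vmoves_start p(2) by blast
  from reaches_trans[OF p(1) this] show ?thesis by simp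
qed

lemma T_accepts: "\<exists>ts. accepting_run T w ts \<and> concat (map (out T) ts) = map dB (val L z)"
  using moves_run[OF accepting_moves w(1)]
  by (auto simp: accepting_run_def conf_def T_def)

end

section \<open>Correctness of the construction\<close>

lemma bracket_facts:
  assumes "u \<in> lists A"
  shows "set (bracket u) \<subseteq> marked A" "2 \<le> length (bracket u)"
    "j < length (bracket u) \<Longrightarrow> bracket u ! j = LEnd \<longleftrightarrow> j = 0"
    "j < length (bracket u) \<Longrightarrow> bracket u ! j = REnd \<longleftrightarrow> Suc j = length (bracket u)"
  using assms by (auto simp: bracket_def marked_def nth_Cons nth_append split: nat.splits)

context machine
begin

definition word_path :: "'a sym list \<Rightarrow> (nat \<Rightarrow> nat) \<Rightarrow> bool" where
  "word_path w \<rho> \<longleftrightarrow> \<rho> 0 = i \<and> \<rho> (length w) = r \<and>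
     (\<forall>n < length w. parent (E (w ! n)) (\<rho> n) = Some (\<rho> (Suc n)))"

lemma word_path_accepted:
  assumes "u \<in> lists A" "word_path (bracket u) \<rho>"
  shows "accepted A E k Q X i r z dB B C (bracket u) \<rho>"
  by standard (use bracket_facts[OF assms(1)] assms(2) in \<open>auto simp: word_path_def\<close>)

text \<open>An accepting run yields a path, the path yields the run computed above, and uniqueness
  of accepting runs identifies the two.\<close>

lemma transduction_T:
  "(u, v) \<in> ft2_transduction T \<longleftrightarrow> u \<in> lists A \<and>
     (\<exists>\<rho>. word_path (bracket u) \<rho> \<and>
        v = map dB (accepted.val E (bracket u) \<rho> (length (bracket u)) z))"
    (is "?l \<longleftrightarrow> u \<in> lists A \<and> ?r")
proof (cases "u \<in> lists A")
  case u: True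
  have A: "in_alph T = A" by (simp add: T_def)
  have unique: "ts = ts'" if "accepting_run T (bracket u) ts" "accepting_run T (bracket u) ts'" for ts ts'
    using accepting_run_unique[OF is_fa2_T _ that] reversible_T by (simp add: reversible_def)
  show ?thesis
  proof (intro iffI)
    assume ?l
    then obtain ts where ts: "accepting_run T (bracket u) ts" "v = concat (map (out T) ts)"
      by (auto simp: ft2_transduction_def)
    have "follow \<Delta> (bracket u) i = Some r"
      by (rule accepting_run_path[OF _ _ ts(1)]) (use bracket_facts[OF u] in auto)
    then obtain \<rho> where \<rho>: "word_path (bracket u) \<rho>"
      using follow_path[of \<Delta> "bracket u" i r] by (auto simp: word_path_def)
    interpret accepted A E k Q X i r z dB B C "bracket u" \<rho>
      by (rule word_path_accepted[OF u \<rho>])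
    show "u \<in> lists A \<and> ?r" using T_accepts unique ts u \<rho> by blast
  next
    assume "u \<in> lists A \<and> ?r"
    then obtain \<rho> where \<rho>: "word_path (bracket u) \<rho>"
      and v: "v = map dB (accepted.val E (bracket u) \<rho> (length (bracket u)) z)" by blast
    interpret accepted A E k Q X i r z dB B C "bracket u" \<rho>
      by (rule word_path_accepted[OF u \<rho>])
    obtain ts where "accepting_run T (bracket u) ts" "concat (map (out T) ts) = v"
      using T_accepts v by blast
    then show ?l unfolding ft2_transduction_def using u A by blast
  qed
qed (auto simp: ft2_transduction_def T_def)

end

section \<open>One-way runs and composition of substitutions\<close>

lemma one_way_run_path:
  assumes M: "one_way M" and "run M w c ts d" "c = (u, p, v)" "d = (w, q, [])"
  shows "\<exists>\<rho>. \<rho> 0 = p \<and> \<rho> (length v) = q \<and> ts = map (\<lambda>n. (\<rho> n, v ! n, \<rho> (Suc n))) [0..<length v] \<and>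
    set ts \<subseteq> delta M"
  using assms(2-4)
proof (induction arbitrary: u p v)
  case (run_step c t c' ts c'')
  from run_step.hyps(1)[unfolded run_step.prems(1)] obtain a v' p' where
    *: "v = a # v'" "t = (p, a, p')" "(p, a, p') \<in> delta M" "c' = (u @ [a], p', v')"
    using M by (auto simp: one_way_def elim: step.cases)
  from run_step.IH[OF *(4) run_step.prems(2)] obtain \<rho> where \<rho>: "\<rho> 0 = p'" "\<rho> (length v') = q"
    "ts = map (\<lambda>n. (\<rho> n, v' ! n, \<rho> (Suc n))) [0..<length v']" "set ts \<subseteq> delta M" by blast
  have "t # ts = map (\<lambda>n. (case_nat p \<rho> n, v ! n, case_nat p \<rho> (Suc n))) [0..<length v]"
    using * \<rho> by (simp add: upt_conv_Cons map_Suc_upt[symmetric] del: upt_Suc)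
  moreover have "set (t # ts) \<subseteq> delta M" using * \<rho>(4) by simp
  ultimately show ?case using *(1) \<rho>(2) by (intro exI[of _ "case_nat p \<rho>"] conjI) simp_all
qed auto

lemma one_way_path_run:
  assumes M: "is_fa2 M" "one_way M" and "w \<in> lists (marked (in_alph M))" "u @ v = w" "\<rho> 0 \<in> states M"
    and "\<And>n. n < length v \<Longrightarrow> (\<rho> n, v ! n, \<rho> (Suc n)) \<in> delta M"
  shows "run M w (u, \<rho> 0, v) (map (\<lambda>n. (\<rho> n, v ! n, \<rho> (Suc n))) [0..<length v]) (w, \<rho> (length v), [])"
  using assms(4-6)
proof (induction v arbitrary: u \<rho>)
  case Nil
  then show ?case using assms(3) by (auto intro: run_refl)
next
  case (Cons a v)
  have d: "(\<rho> 0, a, \<rho> 1) \<in> delta M" using Cons.prems(3)[of 0] by simp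
  then have st: "\<rho> 0 \<in> fwd M" "\<rho> 1 \<in> fwd M"
    using M unfolding is_fa2_def one_way_def states_def by auto
  then have "step M (u, \<rho> 0, a # v) (\<rho> 0, a, \<rho> 1) (u @ [a], \<rho> 1, v)" using d by (auto intro: step.intros)
  moreover have "run M w (u @ [a], \<rho> 1, v)
      (map (\<lambda>n. (\<rho> (Suc n), v ! n, \<rho> (Suc (Suc n)))) [0..<length v]) (w, \<rho> (Suc (length v)), [])"
    using Cons.IH[of "u @ [a]" "\<lambda>n. \<rho> (Suc n)"] Cons.prems st(2) by (force simp: states_def)
  ultimately show ?case
    by (auto simp: upt_conv_Cons map_Suc_upt[symmetric] o_def simp del: upt_Suc intro!: run_step)
qed

lemma subst_comp_assoc: "(\<sigma> \<circ>\<^sub>s \<tau>) \<circ>\<^sub>s \<upsilon> = \<sigma> \<circ>\<^sub>s (\<tau> \<circ>\<^sub>s \<upsilon>)"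
proof -
  have "subst_ext (\<sigma> \<circ>\<^sub>s \<tau>) l = subst_ext \<sigma> (subst_ext \<tau> l)" for l
  proof (induction l)
    case (Cons s l)
    then show ?case
      by (cases s) (simp_all add: subst_ext_def subst_comp_def)
  qed (simp add: subst_ext_def)
  then show ?thesis by (simp add: subst_comp_def fun_eq_iff)
qed

lemma subst_comp_id: "subst_id \<circ>\<^sub>s \<sigma> = \<sigma>" "\<sigma> \<circ>\<^sub>s subst_id = \<sigma>"
proof -
  have "subst_ext subst_id l = l" for l :: "('a + 'b) list"
  proof (induction l)
    case (Cons s l)
    then show ?case by (cases s) (simp_all add: subst_ext_def subst_id_def)
  qed (simp add: subst_ext_def)
  then show "subst_id \<circ>\<^sub>s \<sigma> = \<sigma>" by (simp add: subst_comp_def fun_eq_iff)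
  show "\<sigma> \<circ>\<^sub>s subst_id = \<sigma>" by (simp add: subst_comp_def fun_eq_iff subst_id_def subst_ext_def)
qed

text \<open>The defining \<open>foldr\<close> exposes the first transition, while \<open>val\<close>
  recurses on the last one.\<close>

lemma run_subst_snoc: "run_subst Z (ts @ [t]) = run_subst Z ts \<circ>\<^sub>s update Z t"
proof (induction ts)
  case Nil
  then show ?case by (simp add: run_subst_def subst_comp_id)
next
  case (Cons a ts)
  then show ?case by (simp add: run_subst_def subst_comp_assoc)
qed

text \<open>A transition by itself is a run on a one-letter word, as \<open>copyless\<close> speaks
  of runs from any configuration.\<close>

lemma copyless_update:
  assumes "is_sst Z" "copyless Z" "t \<in> delta Z"
  shows "copyless_subst (vars Z) (update Z t)"
proof -
  obtain p a q where t: "t = (p, a, q)" by (cases t)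
  have Z: "is_fa2 Z" "one_way Z" using assms(1) by (auto simp: is_sst_def)
  then have "a \<in> marked (in_alph Z)" "p \<in> fwd Z" "q \<in> fwd Z"
    using assms(3) by (auto simp: t is_fa2_def one_way_def states_def)
  then have "run Z [a] ([], p, [a]) [t] ([] @ [a], q, [])"
    using assms(3) unfolding t
    by (intro run_step[OF step.fwd_fwd] run_refl) (auto simp: states_def)
  then have "copyless_subst (vars Z) (run_subst Z [t])"
    using assms(2) unfolding copyless_def by blast
  then show ?thesis by (simp add: run_subst_def subst_comp_id)
qed

section \<open>The tables of a coded SST\<close>

lemma count_list_map_inj:
  assumes "inj_on f (insert y (set l))" shows "count_list (map f l) (f y) = count_list l y"
  using assms by (induction l) (auto simp: inj_on_def)

lemma edges_of_eq:
  assumes "D = map (\<lambda>t. ([f t, g t, h t], S t)) ts"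
  shows "edges_of D k = map (\<lambda>t. (f t, h t, if k = 0 then erase (S t) else S t)) (filter (\<lambda>t. g t = k) ts)"
  unfolding assms edges_of_def by (induction ts) auto

lemma set_tracks: "set (tracks ps xs f) = {((p, q, s, s', f), x) | p q s s' x. p \<in> set ps \<and> q \<in> set ps \<and> x \<in> set xs}"
    (is "_ = ?R")
proof (intro equalityI subsetI)
  fix t assume "t \<in> ?R"
  then obtain p q s s' x where t: "t = ((p, q, s, s', f), x)" "p \<in> set ps" "q \<in> set ps" "x \<in> set xs"
    by blast
  then have "((p, q), (s, s'), x) \<in> set (List.product (List.product ps ps)
      (List.product (List.product [True, False] [True, False]) xs))"
    by (cases s; cases s') auto
  from imageI[OF this, of "\<lambda>y. case y of ((p, q), (s, s'), x) \<Rightarrow> ((p, q, s, s', f), x)"]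
  show "t \<in> set (tracks ps xs f)" by (simp add: tracks_def t(1))
qed (auto simp: tracks_def)

lemma distinct_tracks: "distinct ps \<Longrightarrow> distinct xs \<Longrightarrow> distinct (tracks ps xs f)"
  unfolding tracks_def distinct_map by (auto intro!: distinct_product inj_onI simp: distinct_map)

lemma copyless_erase: "distinct (map fst S) \<Longrightarrow> copyless_table (erase S)"
proof -
  assume d: "distinct (map fst S)"
  have *: "Inl x \<notin> set (snd e)" if "e \<in> set (erase S)" for e x
    using that by (auto simp: erase_def)
  have "map fst (erase S) = map fst S" by (simp add: erase_def)
  with d * show ?thesis
    unfolding copyless_table_def by (auto simp: count_list_0_iff[THEN iffD2])
qed

text \<open>The lists \<open>ts\<close> and \<open>xs\<close> are fixed because the tables inherit
  their order, and the code of the SST determines this order.\<close>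

locale coded_sst =
  fixes Z :: "('a, 'q, 'b, 'x) sst" and nA :: "'a \<Rightarrow> nat" and nB :: "'b \<Rightarrow> nat"
    and nQ :: "'q \<Rightarrow> nat" and nX :: "'x \<Rightarrow> nat" and ts :: "('a, 'q) trans list" and xs :: "'x list"
  assumes Z: "is_sst Z" "copyless Z"
    and inj: "inj_on nA (in_alph Z)" "inj_on nB (sst_out_alph Z)" "inj_on nQ (states Z)" "inj_on nX (vars Z)"
    and lists: "enumerates ts (delta Z)" "enumerates xs (vars Z)"
begin

definition word_of :: "('a, 'q) trans \<Rightarrow> 'x \<Rightarrow> (nat + nat) list" where
  "word_of t x = map (map_sum nX nB) (update Z t x)"

definition S :: "('a, 'q) trans \<Rightarrow> subst_table" where
  "S t = map (\<lambda>x. (nX x, word_of t x)) xs"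

definition D :: table where
  "D = map (\<lambda>t. ([nQ (fst t), code_sym nA (fst (snd t)), nQ (snd (snd t))], S t)) ts"

definition E :: "'a sym \<Rightarrow> edges" where
  "E a = edges_of D (code_sym nA a)"

abbreviation "\<Sigma> \<equiv> marked (in_alph Z)"

lemma sst_facts: "is_fa2 Z" "one_way Z" "deterministic Z" "finite (sst_out_alph Z)" "finite (vars Z)"
    "out_var Z \<in> vars Z" "finite (in_alph Z)" "finite (states Z)" "q_init Z \<in> states Z" "q_final Z \<in> states Z"
  using Z by (auto simp: is_sst_def is_fa2_def states_def)

lemma delta_D:
  assumes "t \<in> delta Z"
  shows "fst t \<in> states Z" "fst (snd t) \<in> \<Sigma>" "snd (snd t) \<in> states Z"
  using sst_facts(1) assms by (auto simp: is_fa2_def)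

lemma code_sym_inj: "a \<in> \<Sigma> \<Longrightarrow> b \<in> \<Sigma> \<Longrightarrow>
    code_sym nA a = code_sym nA b \<longleftrightarrow> a = b"
  using inj(1) by (auto simp: marked_def inj_on_def)

lemma E_eq: "E a = map (\<lambda>t. (nQ (fst t), nQ (snd (snd t)), if code_sym nA a = 0 then erase (S t) else S t))
    (filter (\<lambda>t. code_sym nA (fst (snd t)) = code_sym nA a) ts)"
  unfolding E_def by (rule edges_of_eq) (simp add: D_def)

lemma mem_E:
  assumes "a \<in> \<Sigma>"
  shows "(p, p', R) \<in> set (E a) \<longleftrightarrow> (\<exists>q q'. (q, a, q') \<in> delta Z \<and> p = nQ q \<and> p' = nQ q' \<and>
    R = (if a = LEnd then erase (S (q, a, q')) else S (q, a, q')))"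
proof -
  have "code_sym nA b = code_sym nA a \<longleftrightarrow> b = a" if "(q, b, q') \<in> delta Z" for q b q'
    using code_sym_inj[OF _ assms] delta_D[OF that] by simp
  then have F: "set (filter (\<lambda>t. code_sym nA (fst (snd t)) = code_sym nA a) ts) = {t \<in> delta Z. fst (snd t) = a}"
    using lists(1) by (auto simp: enumerates_def)
  have z: "code_sym nA a = 0 \<longleftrightarrow> a = LEnd" by (cases a) auto
  have "(p, p', R) \<in> set (E a) \<longleftrightarrow> (\<exists>t \<in> delta Z. fst (snd t) = a \<and> p = nQ (fst t) \<and>
      p' = nQ (snd (snd t)) \<and> R = (if a = LEnd then erase (S t) else S t))"
    unfolding E_eq set_map F z by blast
  also have "\<dots> \<longleftrightarrow> (\<exists>q q'. (q, a, q') \<in> delta Z \<and> p = nQ q \<and> p' = nQ q' \<and>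
      R = (if a = LEnd then erase (S (q, a, q')) else S (q, a, q')))"
    unfolding Bex_def split_paired_Ex fst_conv snd_conv by blast
  finally show ?thesis .
qed

lemma distinct_E:
  assumes "a \<in> \<Sigma>" shows "distinct (map fst (E a))"
proof -
  let ?F = "filter (\<lambda>t. code_sym nA (fst (snd t)) = code_sym nA a) ts"
  have "inj_on (\<lambda>t. nQ (fst t)) (set ?F)"
  proof (rule inj_onI)
    fix t t' assume t: "t \<in> set ?F" "t' \<in> set ?F" and eq: "nQ (fst t) = nQ (fst t')"
    then have d: "t \<in> delta Z" "t' \<in> delta Z" using lists(1) by (auto simp: enumerates_def)
    then have "fst t = fst t'" using inj_onD[OF inj(3) eq] delta_D(1)[OF d(1)] delta_D(1)[OF d(2)] by simp
    moreover have "fst (snd t) = fst (snd t')" using t code_sym_inj[OF delta_D(2)[OF d(1)] delta_D(2)[OF d(2)]] by simp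
    ultimately have "snd (snd t) = snd (snd t')"
      using sst_facts(3) d unfolding deterministic_def by (metis prod.collapse)
    with \<open>fst t = fst t'\<close> \<open>fst (snd t) = fst (snd t')\<close> show "t = t'" by (simp add: prod_eq_iff)
  qed
  then show ?thesis using lists(1) by (simp add: E_eq o_def distinct_map enumerates_def)
qed

lemma update_letters:
  assumes "t \<in> delta Z" "x \<in> vars Z" shows "set (update Z t x) \<subseteq> vars Z <+> sst_out_alph Z"
proof -
  have "update Z t x \<in> lists (vars Z <+> sst_out_alph Z)"
    using Z(1) assms unfolding is_sst_def substitutions_def by blast
  then show ?thesis by (simp add: lists_eq_set)
qed

lemma inj_letters: "inj_on (map_sum nX nB) (vars Z <+> sst_out_alph Z)"
  by (rule inj_onI) (use inj(2,4) in \<open>auto dest: inj_onD\<close>)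

text \<open>Names are injective on the variables and letters that occur, so renaming neither merges
  nor multiplies occurrences.\<close>

lemma copyless_S:
  assumes t: "t \<in> delta Z" shows "copyless_table (S t)"
  unfolding copyless_table_def
proof (intro conjI ballI allI impI)
  have c: "copyless_subst (vars Z) (update Z t)" using copyless_update[OF Z t] .
  have S: "\<exists>y \<in> vars Z. e = (nX y, word_of t y)" if "e \<in> set (S t)" for e
    using that lists(2) by (auto simp: S_def enumerates_def)
  have Inl: "\<exists>y \<in> vars Z. x = nX y \<and> Inl y \<in> set (update Z t x')"
    if "Inl x \<in> set (word_of t x')" "x' \<in> vars Z" for x x'
  proof -
    obtain s where s: "s \<in> set (update Z t x')" "Inl x = map_sum nX nB s"
      using \<open>Inl x \<in> _\<close> by (auto simp: word_of_def)
    then have "s \<in> vars Z <+> sst_out_alph Z" using update_letters[OF t that(2)] by blast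
    then show ?thesis using s by (elim PlusE) auto
  qed
  show "distinct (map fst (S t))"
    using lists(2) inj(4) by (simp add: S_def o_def distinct_map enumerates_def)
  show "count_list (snd e) (Inl x) \<le> 1" if e: "e \<in> set (S t)" for e x
  proof (cases "Inl x \<in> set (snd e)")
    case True
    obtain x' where x': "x' \<in> vars Z" "e = (nX x', word_of t x')" using S[OF e] by blast
    with True Inl obtain y where y: "y \<in> vars Z" "x = nX y" by auto
    have "inj_on (map_sum nX nB) (insert (Inl y) (set (update Z t x')))"
      by (rule inj_on_subset[OF inj_letters]) (use update_letters[OF t x'(1)] y in auto)
    from count_list_map_inj[OF this] have "count_list (snd e) (Inl x) = count_list (update Z t x') (Inl y)"
      by (simp add: x' y word_of_def)
    then show ?thesis using c x'(1) y(1) by (simp add: copyless_subst_def)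
  qed (simp add: count_list_0_iff[THEN iffD2])
  show "e = e'" if e: "e \<in> set (S t)" "e' \<in> set (S t)" "Inl x \<in> set (snd e)" "Inl x \<in> set (snd e')" for e e' x
  proof -
    obtain v v' where v: "v \<in> vars Z" "e = (nX v, word_of t v)" "v' \<in> vars Z" "e' = (nX v', word_of t v')"
      using S[OF e(1)] S[OF e(2)] by blast
    then obtain y y' where "y \<in> vars Z" "x = nX y" "Inl y \<in> set (update Z t v)"
      "y' \<in> vars Z" "x = nX y'" "Inl y' \<in> set (update Z t v')"
      using Inl[of x v] Inl[of x v'] e(3,4) by auto
    moreover from this have "y = y'" using inj(4) by (auto dest: inj_onD)
    ultimately have "v = v'" using c v unfolding copyless_subst_def by blast
    then show ?thesis using v by simp
  qed
qed

lemma fst_S: "fst ` set (S t) = nX ` vars Z" "fst ` set (erase (S t)) = nX ` vars Z"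
  using lists(2) by (auto simp: S_def erase_def enumerates_def image_iff)

lemma set_word_of:
  "t \<in> delta Z \<Longrightarrow> x \<in> vars Z \<Longrightarrow> set (word_of t x) \<subseteq> nX ` vars Z <+> nB ` sst_out_alph Z"
  using update_letters by (fastforce simp: word_of_def)

sublocale machine "in_alph Z" E "code_sym nA" "nQ ` states Z" "nX ` vars Z" "nQ (q_init Z)"
  "nQ (q_final Z)" "nX (out_var Z)" "inv_into (sst_out_alph Z) nB" "sst_out_alph Z" "nB ` sst_out_alph Z"
proof
  show "edges_ok (E a)" if a: "a \<in> \<Sigma>" for a
  proof -
    have "copyless_table R" if "(p, p', R) \<in> set (E a)" for p p' R
      using that copyless_S copyless_erase
      by (auto simp: mem_E[OF a] copyless_table_def[of "S _"] split: if_splits)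
    then show ?thesis using distinct_E[OF a] by (auto simp: edges_ok_def)
  qed
  show "p \<in> nQ ` states Z \<and> p' \<in> nQ ` states Z" if "a \<in> \<Sigma>" "(p, p', R) \<in> set (E a)" for a p p' R
    using that delta_D by (auto simp: mem_E)
  show "fst ` set R = nX ` vars Z" if a: "a \<in> \<Sigma>" "(p, p', R) \<in> set (E a)" for a p p' R
  proof -
    obtain t where "R = S t \<or> R = erase (S t)"
      using a(2) unfolding mem_E[OF a(1)] by metis
    then show ?thesis by (elim disjE) (simp_all only: fst_S)
  qed
  show "set l \<subseteq> nX ` vars Z <+> nB ` sst_out_alph Z"
    if a: "a \<in> \<Sigma>" "(p, p', R) \<in> set (E a)" "(y, l) \<in> set R" for a p p' R y l
  proof -
    obtain t where t: "t \<in> delta Z" "R = erase (S t) \<or> R = S t" using a by (auto simp: mem_E)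
    then obtain l' where "(y, l') \<in> set (S t)" "set l \<subseteq> set l'" using a(3) by (auto simp: erase_def)
    then show ?thesis using set_word_of[OF t(1)] lists(2) by (fastforce simp: S_def enumerates_def)
  qed
  have m: "LEnd \<in> \<Sigma>" "REnd \<in> \<Sigma>" by (auto simp: marked_def)
  show "p = nQ (q_init Z)" if "(p, p', R) \<in> set (E LEnd)" for p p' R
    using that sst_facts(1,2) unfolding mem_E[OF m(1)] is_fa2_def one_way_def states_def by auto
  show "p' = nQ (q_final Z)" if "(p, p', R) \<in> set (E REnd)" for p p' R
    using that sst_facts(1,2) unfolding mem_E[OF m(2)] is_fa2_def one_way_def states_def by auto
  show "Inl x \<notin> set l" if "(p, p', R) \<in> set (E LEnd)" "(y, l) \<in> set R" for p p' R y l x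
    using that by (auto simp: mem_E[OF m(1)] erase_def)
qed (use sst_facts in \<open>auto simp: inv_into_f_f[OF inj(2)]\<close>)

end

text \<open>Justifies \<open>erase\<close>: as long as all values are empty, variables contribute
  nothing.\<close>

lemma subst_word_erase:
  "subst_word (\<lambda>x. []) (filter is_letter l) = subst_word (\<lambda>x. []) l"
proof (induction l)
  case (Cons s l)
  then show ?case by (cases s) simp_all
qed simp

text \<open>Turns the nested loops of \<open>table_out\<close> into a filtered product, in the order
  in which the transitions of \<open>T\<close> will be enumerated.\<close>

lemma concat_option_product:
  "concat (map (\<lambda>a. concat (map (\<lambda>t. case f a t of None \<Rightarrow> [] | Some u \<Rightarrow> [g a t u]) l)) k) =
     map (\<lambda>(a, t). g a t (the (f a t))) (filter (\<lambda>(a, t). f a t \<noteq> None) (List.product k l))"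
proof (induction k)
  case (Cons a k)
  have "concat (map (\<lambda>t. case f a t of None \<Rightarrow> [] | Some u \<Rightarrow> [g a t u]) l) =
      map (\<lambda>(a, t). g a t (the (f a t))) (filter (\<lambda>(a, t). f a t \<noteq> None) (map (Pair a) l))"
    by (induction l) (auto split: option.split)
  with Cons show ?case by simp
qed simp

lemma enc_sum_nat: "enc (s :: nat + nat) = sum_encode s"
  by (cases s) (simp_all add: enc_simps enc_nat_def sum_encode_def)

section \<open>Equality of the transductions\<close>

context coded_sst
begin

lemma map_of_E:
  assumes "(q, a, q') \<in> delta Z"
  shows "map_of (E a) (nQ q) =
    Some (nQ q', if a = LEnd then erase (S (q, a, q')) else S (q, a, q'))"
proof -
  have a: "a \<in> \<Sigma>" using delta_D(2)[OF assms] by simp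
  have "(nQ q, nQ q', if a = LEnd then erase (S (q, a, q')) else S (q, a, q')) \<in> set (E a)"
    unfolding mem_E[OF a] using assms by blast
  then show ?thesis by (rule map_of_is_SomeI[OF distinct_E[OF a]])
qed

lemma map_of_S:
  assumes "x \<in> vars Z"
  shows "map_of (S t) (nX x) = Some (word_of t x)"
    and "map_of (erase (S t)) (nX x) =
      Some (filter is_letter (word_of t x))"
proof -
  have d: "distinct (map fst (S t))"
    using lists(2) inj(4) by (simp add: S_def o_def distinct_map enumerates_def)
  have m: "(nX x, word_of t x) \<in> set (S t)"
    using assms lists(2) by (auto simp: S_def enumerates_def)
  show "map_of (S t) (nX x) = Some (word_of t x)"
    using map_of_is_SomeI[OF d m] .
  have "map fst (erase (S t)) = map fst (S t)" by (simp add: erase_def)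
  then have d': "distinct (map fst (erase (S t)))" using d by (simp only:)
  show "map_of (erase (S t)) (nX x) =
      Some (filter is_letter (word_of t x))"
    by (rule map_of_is_SomeI[OF d'])
      (use imageI[OF m, of "\<lambda>e. (fst e, filter is_letter (snd e))"]
        in \<open>simp add: erase_def\<close>)
qed

text \<open>One word \<open>v\<close> witnesses both evaluations, that of the SST and that of the
  tables, which works with the codes of letters.\<close>

lemma letter_words:
  assumes "\<And>x. x \<in> vars Z \<Longrightarrow> \<exists>v. f x = map Inr v \<and> g (nX x) = map nB v \<and> set v \<subseteq> sst_out_alph Z"
    and "set l \<subseteq> vars Z <+> sst_out_alph Z"
  shows "\<exists>v. subst_ext f l = map Inr v \<and> subst_word g (map (map_sum nX nB) l) = map nB v \<and>
    set v \<subseteq> sst_out_alph Z"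
  using assms(2)
proof (induction l)
  case Nil
  then show ?case by (simp add: subst_ext_def)
next
  case (Cons s l)
  then obtain v where v: "subst_ext f l = map Inr v" "subst_word g (map (map_sum nX nB) l) = map nB v"
    "set v \<subseteq> sst_out_alph Z" by auto
  from Cons.prems have "s \<in> vars Z <+> sst_out_alph Z" by simp
  then show ?case
  proof (elim PlusE)
    fix x assume x: "s = Inl x" "x \<in> vars Z"
    obtain v' where "f x = map Inr v'" "g (nX x) = map nB v'" "set v' \<subseteq> sst_out_alph Z"
      using assms(1)[OF x(2)] by blast
    with x v show ?thesis by (intro exI[of _ "v' @ v"]) (simp add: subst_ext_def)
  next
    fix b assume "s = Inr b" "b \<in> sst_out_alph Z"
    with v show ?thesis by (intro exI[of _ "b # v"]) (simp add: subst_ext_def)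
  qed
qed

definition sst_path :: "'a sym list \<Rightarrow> (nat \<Rightarrow> 'q) \<Rightarrow> bool" where
  "sst_path w \<sigma> \<longleftrightarrow> \<sigma> 0 = q_init Z \<and> \<sigma> (length w) = q_final Z \<and>
     (\<forall>n < length w. (\<sigma> n, w ! n, \<sigma> (Suc n)) \<in> delta Z)"

definition path_trans :: "'a sym list \<Rightarrow> (nat \<Rightarrow> 'q) \<Rightarrow> nat \<Rightarrow> ('a, 'q) trans list" where
  "path_trans w \<sigma> n = map (\<lambda>n. (\<sigma> n, w ! n, \<sigma> (Suc n))) [0..<n]"

lemma accepting_run_iff:
  assumes "u \<in> lists (in_alph Z)"
  shows "accepting_run Z (bracket u) rs \<longleftrightarrow>
    (\<exists>\<sigma>. sst_path (bracket u) \<sigma> \<and> rs = path_trans (bracket u) \<sigma> (length (bracket u)))"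
proof
  assume "accepting_run Z (bracket u) rs"
  then obtain \<sigma> where "\<sigma> 0 = q_init Z" "\<sigma> (length (bracket u)) = q_final Z"
    "rs = path_trans (bracket u) \<sigma> (length (bracket u))" "set rs \<subseteq> delta Z"
    using one_way_run_path[OF sst_facts(2)] unfolding accepting_run_def path_trans_def by blast
  then show "\<exists>\<sigma>. sst_path (bracket u) \<sigma> \<and> rs = path_trans (bracket u) \<sigma> (length (bracket u))"
    by (intro exI[of _ \<sigma>]) (auto simp: sst_path_def path_trans_def)
next
  assume "\<exists>\<sigma>. sst_path (bracket u) \<sigma> \<and> rs = path_trans (bracket u) \<sigma> (length (bracket u))"
  then obtain \<sigma> where \<sigma>: "sst_path (bracket u) \<sigma>" "rs = path_trans (bracket u) \<sigma> (length (bracket u))"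
    by blast
  have "run Z (bracket u) ([], \<sigma> 0, bracket u) (path_trans (bracket u) \<sigma> (length (bracket u)))
      (bracket u, \<sigma> (length (bracket u)), [])"
    unfolding path_trans_def
    by (rule one_way_path_run[OF sst_facts(1,2)])
      (use \<sigma>(1) sst_facts(9) bracket_facts(1)[OF assms] in \<open>auto simp: sst_path_def\<close>)
  then show "accepting_run Z (bracket u) rs" using \<sigma> by (simp add: accepting_run_def sst_path_def)
qed

lemma sst_path_word_path:
  assumes "sst_path w \<sigma>" shows "word_path w (\<lambda>n. nQ (\<sigma> n))"
  using assms map_of_E by (auto simp: sst_path_def word_path_def parent_def)

lemma word_path_sst_path:
  assumes "set w \<subseteq> \<Sigma>" "word_path w \<rho>"
  obtains \<sigma> where "sst_path w \<sigma>" "\<And>n. n \<le> length w \<Longrightarrow> \<rho> n = nQ (\<sigma> n)"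
proof -
  define \<sigma> where "\<sigma> n = inv_into (states Z) nQ (\<rho> n)" for n
  have step: "\<exists>q q'. (q, w ! n, q') \<in> delta Z \<and> \<rho> n = nQ q \<and> \<rho> (Suc n) = nQ q'" if "n < length w" for n
  proof -
    have a: "w ! n \<in> \<Sigma>" using assms(1) that by auto
    have "parent (E (w ! n)) (\<rho> n) = Some (\<rho> (Suc n))" using assms(2) that by (simp add: word_path_def)
    then obtain R where "(\<rho> n, \<rho> (Suc n), R) \<in> set (E (w ! n))"
      by (auto simp: parent_def dest: map_of_SomeD)
    then show ?thesis unfolding mem_E[OF a] by blast
  qed
  have inv: "inv_into (states Z) nQ (nQ q) = q" if "q \<in> states Z" for q
    using inv_into_f_f[OF inj(3) that] .
  have "\<rho> n \<in> nQ ` states Z" if "n \<le> length w" for n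
  proof (cases "n < length w")
    case True
    then show ?thesis using step delta_D(1) by fastforce
  next
    case False
    then show ?thesis using that assms(2) sst_facts(10) by (simp add: word_path_def)
  qed
  then have \<rho>: "\<rho> n = nQ (\<sigma> n)" if "n \<le> length w" for n
    using that by (simp add: \<sigma>_def f_inv_into_f)
  have "(\<sigma> n, w ! n, \<sigma> (Suc n)) \<in> delta Z" if n: "n < length w" for n
  proof -
    obtain q q' where q: "(q, w ! n, q') \<in> delta Z" "\<rho> n = nQ q" "\<rho> (Suc n) = nQ q'" using step[OF n] by blast
    then have "\<sigma> n = q" "\<sigma> (Suc n) = q'" using delta_D[OF q(1)] inv by (simp_all add: \<sigma>_def)
    then show ?thesis using q by simp
  qed
  then have "sst_path w \<sigma>"
    using assms(2) inv sst_facts(9,10) by (simp add: sst_path_def word_path_def \<sigma>_def)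
  then show thesis using that \<rho> by blast
qed

lemma path_value:
  assumes u: "u \<in> lists (in_alph Z)" and \<rho>: "word_path (bracket u) \<rho>"
    and \<sigma>: "sst_path (bracket u) \<sigma>" "\<And>n. n \<le> length (bracket u) \<Longrightarrow> \<rho> n = nQ (\<sigma> n)"
    and "n \<le> length (bracket u)" "x \<in> vars Z"
  shows "\<exists>v. (subst_empty \<circ>\<^sub>s run_subst Z (path_trans (bracket u) \<sigma> n)) x = map Inr v \<and>
    accepted.val E (bracket u) \<rho> n (nX x) = map nB v \<and> set v \<subseteq> sst_out_alph Z"
proof -
  interpret accepted "in_alph Z" E "code_sym nA" "nQ ` states Z" "nX ` vars Z" "nQ (q_init Z)"
    "nQ (q_final Z)" "nX (out_var Z)" "inv_into (sst_out_alph Z) nB" "sst_out_alph Z"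
    "nB ` sst_out_alph Z" "bracket u" \<rho>
    by (rule word_path_accepted[OF u \<rho>])
  show ?thesis
    using assms(5,6)
  proof (induction n arbitrary: x)
    case 0
    then show ?case
      by (simp add: path_trans_def run_subst_def subst_comp_id) (simp add: subst_empty_def)
  next
    case (Suc n)
    let ?t = "(\<sigma> n, bracket u ! n, \<sigma> (Suc n))"
    let ?f = "subst_empty \<circ>\<^sub>s run_subst Z (path_trans (bracket u) \<sigma> n)"
    have t: "?t \<in> delta Z" and n: "n < L" using Suc.prems \<sigma>(1) by (simp_all add: sst_path_def)
    have tab: "tab n = (if bracket u ! n = LEnd then erase (S ?t) else S ?t)"
      using map_of_E[OF t] \<sigma>(2)[of n] n by (simp add: tab_def)
    have "val (Suc n) (nX x) = subst_word (val n) (word_of ?t x)"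
    proof (cases "n = 0")
      case True
      then have "bracket u ! n = LEnd" "val n = (\<lambda>x. [])" using LEnd_iff[OF n] by simp_all
      then show ?thesis by (simp add: tab map_of_S[OF Suc.prems(2)] subst_word_erase)
    next
      case False
      then show ?thesis
        using LEnd_iff[OF n] by (simp add: tab map_of_S[OF Suc.prems(2)])
    qed
    moreover have "(subst_empty \<circ>\<^sub>s run_subst Z (path_trans (bracket u) \<sigma> (Suc n))) x =
        subst_ext ?f (update Z ?t x)"
    proof -
      have "path_trans (bracket u) \<sigma> (Suc n) = path_trans (bracket u) \<sigma> n @ [?t]"
        by (simp add: path_trans_def)
      then show ?thesis
        by (simp only: run_subst_snoc subst_comp_assoc[symmetric]) (simp add: subst_comp_def)
    qed
    moreover have "\<exists>v. subst_ext ?f (update Z ?t x) = map Inr v \<and>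
        subst_word (val n) (word_of ?t x) = map nB v \<and> set v \<subseteq> sst_out_alph Z"
      unfolding word_of_def
      by (rule letter_words) (use Suc n update_letters[OF t Suc.prems(2)] in auto)
    ultimately show ?case by simp
  qed
qed

lemma transduction_eq: "ft2_transduction T = sst_transduction Z"
proof -
  let ?dB = "inv_into (sst_out_alph Z) nB"
  let ?r = "\<lambda>w \<sigma>. (subst_empty \<circ>\<^sub>s run_subst Z (path_trans w \<sigma> (length w))) (out_var Z)"
  let ?v = "\<lambda>w \<rho>. accepted.val E w \<rho> (length w) (nX (out_var Z))"
  have dB: "map ?dB (map nB v) = v" if "set v \<subseteq> sst_out_alph Z" for v
    using that by (intro nth_equalityI) (auto intro!: inv_into_f_f[OF inj(2)])
  have "(u, v) \<in> ft2_transduction T \<longleftrightarrow> (u, v) \<in> sst_transduction Z" if u: "u \<in> lists (in_alph Z)" for u v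
  proof
    let ?w = "bracket u"
    assume "(u, v) \<in> ft2_transduction T"
    then obtain \<rho> where \<rho>: "word_path ?w \<rho>"
      and v: "v = map ?dB (?v ?w \<rho>)"
      unfolding transduction_T by blast
    obtain \<sigma> where \<sigma>: "sst_path ?w \<sigma>" "\<And>n. n \<le> length ?w \<Longrightarrow> \<rho> n = nQ (\<sigma> n)"
      using word_path_sst_path[OF bracket_facts(1)[OF u] \<rho>] by metis
    obtain v' where v': "?r ?w \<sigma> = map Inr v'"
      "?v ?w \<rho> = map nB v'" "set v' \<subseteq> sst_out_alph Z"
      using path_value[OF u \<rho> \<sigma> order_refl sst_facts(6)] by blast
    then have "v = v'" using v dB by simp
    then show "(u, v) \<in> sst_transduction Z"
      using u v'(1) accepting_run_iff[OF u] \<sigma>(1) unfolding sst_transduction_def by auto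
  next
    let ?w = "bracket u"
    assume "(u, v) \<in> sst_transduction Z"
    then obtain \<sigma> where \<sigma>: "sst_path ?w \<sigma>"
      and v: "map Inr v = ?r ?w \<sigma>"
      using accepting_run_iff[OF u] unfolding sst_transduction_def by auto
    define \<rho> where "\<rho> n = nQ (\<sigma> n)" for n
    have \<rho>: "word_path ?w \<rho>" using sst_path_word_path[OF \<sigma>] by (simp add: \<rho>_def[abs_def])
    obtain v' where v': "?r ?w \<sigma> = map Inr v'"
      "?v ?w \<rho> = map nB v'" "set v' \<subseteq> sst_out_alph Z"
      using path_value[OF u \<rho> \<sigma> \<rho>_def order_refl sst_facts(6)] by blast
    have "inj (Inr :: 'b \<Rightarrow> 'x + 'b)" by simp
    then have "v = v'" using v v'(1) by (metis map_injective)
    then show "(u, v) \<in> ft2_transduction T"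
      unfolding transduction_T using u \<rho> v' dB by metis
  qed
  moreover have "u \<in> lists (in_alph Z)" if "(u, v) \<in> ft2_transduction T \<or> (u, v) \<in> sst_transduction Z" for u v
    using that by (auto simp: transduction_T sst_transduction_def)
  ultimately show ?thesis by (intro set_eqI) (metis surj_pair)
qed

text \<open>The last component of the SST code is the code of \<open>D\<close>, so
  \<open>compile\<close> gets the table by \<open>inv enc\<close> without any translation.\<close>

lemma enc_D:
  "enc D = code_list (\<lambda>t. prod_encode (code_trans nA nQ t, code_subst nB nX xs (update Z t))) ts"
proof -
  have w: "enc (word_of t x) = code_list (\<lambda>s. sum_encode (map_sum nX nB s)) (update Z t x)" for t x
    by (simp add: enc_list_def word_of_def code_list_def enc_sum_nat o_def)
  have S: "enc (S t) = code_subst nB nX xs (update Z t)" for t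
    by (simp add: S_def code_subst_def enc_list_def[of "map _ _"] o_def enc_Pair w code_list_def[of _ xs] enc_nat_def)
  have "enc ([nQ (fst t), code_sym nA (fst (snd t)), nQ (snd (snd t))], S t) =
      prod_encode (code_trans nA nQ t, code_subst nB nX xs (update Z t))" for t
    by (cases t) (simp add: enc_Pair S enc_nat_list)
  then show ?thesis
    unfolding D_def code_list_def enc_list_def[of "map _ _"] map_map o_def by simp
qed

section \<open>The code of the transducer\<close>

context
  fixes as bs ps
  assumes as: "enumerates as (in_alph Z)" and bs: "enumerates bs (sst_out_alph Z)"
    and ps: "enumerates ps (fwd Z)"
begin

definition tracks_list :: "bool \<Rightarrow> track list" where
  "tracks_list f = tracks (map nQ ps) (map nX xs) f"

lemma states_fwd: "states Z = fwd Z"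
  using sst_facts(2) by (simp add: states_def one_way_def)

lemma set_tracks_list: "set (tracks_list f) = {t \<in> Tr. ahead (fst t) = f}"
proof -
  have "set (map nQ ps) = nQ ` states Z" "set (map nX xs) = nX ` vars Z"
    using ps lists(2) states_fwd by (simp_all add: enumerates_def)
  then show ?thesis unfolding tracks_list_def set_tracks Tr_def by (auto simp: ahead_def)
qed

lemma distinct_tracks_list: "distinct (tracks_list f)"
  unfolding tracks_list_def
  by (rule distinct_tracks) (use ps lists(2) inj(3,4) states_fwd in \<open>auto simp: enumerates_def distinct_map\<close>)

definition symbols :: "'a sym list" where
  "symbols = LEnd # REnd # map Letter as"

definition trans_list :: "('a, nat) trans list" where
  "trans_list = map (\<lambda>(a, t). (enc t, a, enc (fst (the (nt a t)))))
     (filter (\<lambda>(a, t). nt a t \<noteq> None) (List.product symbols (tracks_list True @ tracks_list False)))"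

lemma set_symbols: "set symbols = \<Sigma>" and distinct_symbols: "distinct symbols"
  using as by (auto simp: symbols_def marked_def enumerates_def distinct_map inj_on_def)

lemma enumerates_trans_list: "enumerates trans_list (delta T)"
  unfolding enumerates_def
proof
  let ?ts = "tracks_list True @ tracks_list False" and ?f = "\<lambda>(a, t). (enc t, a, enc (fst (the (nt a t))))"
  let ?R = "{(a, t). a \<in> \<Sigma> \<and> t \<in> Tr \<and> nt a t \<noteq> None}"
  have "distinct ?ts" using distinct_tracks_list set_tracks_list by auto
  then have "distinct (List.product symbols ?ts)" by (intro distinct_product distinct_symbols)
  then show "distinct trans_list"
    unfolding trans_list_def distinct_map by (auto intro!: inj_onI simp: enc_eq_iff)
  have "set ?ts = Tr" using set_tracks_list by auto
  then have s: "set (filter (\<lambda>(a, t). nt a t \<noteq> None) (List.product symbols ?ts)) = ?R"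
    unfolding set_filter set_product set_symbols by auto
  show "set trans_list = delta T"
    unfolding trans_list_def set_map s
  proof (intro equalityI subsetI)
    fix d assume "d \<in> ?f ` ?R"
    then obtain a t u v where "d = (enc t, a, enc u)" "a \<in> \<Sigma>" "t \<in> Tr" "nt a t = Some (u, v)"
      by force
    then show "d \<in> delta T" using delta_T by blast
  next
    fix d assume "d \<in> delta T"
    then obtain a t u v where *: "d = (enc t, a, enc u)" "a \<in> \<Sigma>" "t \<in> Tr" "nt a t = Some (u, v)"
      using delta_T by (metis prod_cases3)
    then show "d \<in> ?f ` ?R"
      by (intro image_eqI[of _ _ "(a, t)"])
        (simp_all only: * mem_Collect_eq case_prod_conv option.sel fst_conv option.distinct simp_thms)
  qed
qed

text \<open>The table stores codes of output letters, while \<open>T\<close> outputs the letters;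
  decoding and naming again is the identity on the codes that occur.\<close>

lemma enc_table_out:
  "enc (table_out (nX (out_var Z)) (nQ (q_final Z)) D (map (code_sym nA) symbols)
     (tracks_list True @ tracks_list False)) =
   code_list (\<lambda>t. prod_encode (code_trans nA id t, code_list nB (out T t))) trans_list"
    (is "enc ?table = code_list ?code _")
proof -
  let ?ts = "tracks_list True @ tracks_list False"
  let ?l = "filter (\<lambda>(a, t). nt a t \<noteq> None) (List.product symbols ?ts)"
  let ?f = "\<lambda>(a, t). ([enc t, code_sym nA a, enc (fst (the (nt a t)))], snd (the (nt a t)))"
  let ?g = "\<lambda>(a, t). (enc t, a, enc (fst (the (nt a t))))"
  have "?table = concat (map (\<lambda>a. concat (map (\<lambda>t. case nt a t of None \<Rightarrow> []
       | Some u \<Rightarrow> [([enc t, code_sym nA a, enc (fst u)], snd u)]) ?ts)) symbols)"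
    by (simp add: table_out_def nt_def E_def o_def)
  also have "\<dots> = map ?f ?l" by (rule concat_option_product)
  finally have t: "?table = map ?f ?l" .
  have "(enc \<circ> ?f) y = (?code \<circ> ?g) y" if "y \<in> set ?l" for y
  proof -
    obtain a t where y: "y = (a, t)" by (cases y)
    with that have at: "a \<in> \<Sigma>" "t \<in> Tr" "nt a t \<noteq> None"
      by (auto simp: set_symbols set_tracks_list)
    then obtain u v where uv: "nt a t = Some (u, v)" by auto
    then have "set v \<subseteq> nB ` sst_out_alph Z" using nt_states at by blast
    then have "map nB (map (inv_into (sst_out_alph Z) nB) v) = v"
      by (auto intro!: map_idI simp: o_def f_inv_into_f)
    then have "code_list nB (out T (enc t, a, enc u)) = list_encode v"
      by (simp only: code_list_def out_T[OF uv])
    then show ?thesis by (simp add: y uv enc_Pair enc_nat_list)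
  qed
  then have eq: "map (enc \<circ> ?f) ?l = map (?code \<circ> ?g) ?l" by (rule map_cong[OF HOL.refl])
  show ?thesis
    unfolding t trans_list_def enc_list_def[of "map _ _"] code_list_def[of _ "map _ _"] map_map
    by (rule arg_cong[OF eq])
qed

lemma codes_T:
  assumes z: "z = list_encode
    [code_list nA as, code_list nB bs, code_list nQ ps, nQ (q_init Z), nQ (q_final Z),
     code_list nX xs, nX (out_var Z),
     code_list (\<lambda>t. prod_encode (code_trans nA nQ t, code_subst nB nX xs (update Z t))) ts]"
  shows "codes_ft2 nA nB id T (compile z)"
proof -
  have inv_list: "inv enc (code_list f l) = map f l" for f :: "'c \<Rightarrow> nat" and l
    using inv_f_f[OF inj_enc, of "map f l"] by (simp add: enc_nat_list code_list_def)
  have inv_D: "inv enc (code_list (\<lambda>t. prod_encode (code_trans nA nQ t, code_subst nB nX xs (update Z t))) ts) = D"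
    by (simp add: enc_D[symmetric] inv_f_f[OF inj_enc])
  have sym: "0 # 1 # map (\<lambda>a. Suc (Suc a)) (map nA as) = map (code_sym nA) symbols"
    by (simp add: symbols_def)
  have fields: "in_alph T = in_alph Z" "out_alph T = sst_out_alph Z"
    "q_init T = enc (tour (nX (out_var Z)) True (nQ (q_init Z)))"
    "q_final T = enc (summit (nX (out_var Z)) (nQ (q_final Z)) True)"
    by (simp_all add: T_def)
  have "compile z = list_encode [code_list nA as, code_list nB bs, code_list id (map enc (tracks_list True)),
      code_list id (map enc (tracks_list False)), id (q_init T), id (q_final T),
      code_list (\<lambda>t. prod_encode (code_trans nA id t, code_list nB (out T t))) trans_list]"
    unfolding z compile_def list_encode_inverse list.case Let_def inv_list inv_D sym
      tracks_list_def[symmetric] enc_table_out enc_nat_list fields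
    by (simp add: code_list_def)
  moreover have "enumerates (map enc (tracks_list True)) (fwd T)" "enumerates (map enc (tracks_list False)) (bwd T)"
    using distinct_tracks_list set_tracks_list
    by (auto simp: enumerates_def distinct_map inj_enc T_def)
  ultimately show ?thesis
    unfolding codes_ft2_def using inj(1,2) as bs enumerates_trans_list fields by fastforce
qed

end

end

theorem theorem7:
  shows "\<exists>F. recursive F \<and>
    (\<forall>(Z :: ('a, 'q, 'b, 'x) sst) nA nB nQ nX z.
       is_sst Z \<longrightarrow> copyless Z \<longrightarrow> codes_sst nA nB nQ nX Z z \<longrightarrow>
       (\<exists>T :: ('a, nat, 'b) ft2.
          codes_ft2 nA nB id T (F z) \<and>
          is_ft2 T \<and> in_alph T = in_alph Z \<and> out_alph T = sst_out_alph Z \<and>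
          reversible T \<and>
          card (states T) = 8 * card (vars Z) * (card (states Z))\<^sup>2 \<and>
          ft2_transduction T = sst_transduction Z))"
proof (intro exI[of _ compile] conjI allI impI)
  show "recursive compile" by (rule recursive_compile)
next
  fix Z :: "('a, 'q, 'b, 'x) sst" and nA nB nQ nX z
  assume Z: "is_sst Z" "copyless Z" and "codes_sst nA nB nQ nX Z z"
  then obtain as bs ps ts xs where *: "inj_on nA (in_alph Z)" "inj_on nB (sst_out_alph Z)"
    "inj_on nQ (states Z)" "inj_on nX (vars Z)"
    "enumerates as (in_alph Z)" "enumerates bs (sst_out_alph Z)"
    "enumerates ps (fwd Z)" "enumerates ts (delta Z)" "enumerates xs (vars Z)"
    and z: "z = list_encode
      [code_list nA as, code_list nB bs, code_list nQ ps, nQ (q_init Z), nQ (q_final Z),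
       code_list nX xs, nX (out_var Z),
       code_list (\<lambda>t. prod_encode (code_trans nA nQ t, code_subst nB nX xs (update Z t))) ts]"
    unfolding codes_sst_def by blast
  interpret coded_sst Z nA nB nQ nX ts xs by standard fact+
  have "card (states T) = 8 * card (vars Z) * (card (states Z))\<^sup>2"
    by (simp add: card_states_T card_image inj)
  moreover have "in_alph T = in_alph Z" "out_alph T = sst_out_alph Z" by (simp_all add: T_def)
  ultimately show "\<exists>T :: ('a, nat, 'b) ft2.
      codes_ft2 nA nB id T (compile z) \<and>
      is_ft2 T \<and> in_alph T = in_alph Z \<and> out_alph T = sst_out_alph Z \<and>
      reversible T \<and>
      card (states T) = 8 * card (vars Z) * (card (states Z))\<^sup>2 \<and>
      ft2_transduction T = sst_transduction Z"
    using codes_T[OF *(5-7) z] is_ft2_T reversible_T transduction_eq by blast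
qed

end
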